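(* Let $p\neq \ell$ be primes, let $K$ be a finite extension of $\mathbb{Q}_\ell$, and let $q$ be the cardinality of the residue field of $K$. Fix a square root $q^{1/2}$ of $q$ in $\overline{\mathbb{Q}}_p$. Let $\psi: W_K\to \overline{\mathbb{Q}}_p^\times$ be the unramified character sending the geometric Frobenius element to $q^{1/2}$. Let $\rho_1,\rho_2$ be continuous representations of $G_K=\mathrm{Gal}(\overline K/K)$ on finite-dimensional $\overline{\mathbb{Q}}_p$-vector spaces which are pure of weights $w_1$ and $w_2$ respectively. Suppose $\rho_1,\rho_2$ have equal normalized traces, i.e. $\mathrm{tr}(\psi^{-w_1}\otimes \rho_1|_{W_K})(g)=\mathrm{tr}(\psi^{-w_2}\otimes\rho_2|_{W_K})(g)$ for all $g\in W_K$. Then $\mathrm{WD}(\rho_1)^{\mathrm{Fr\text{-}ss}}$ is isomorphic (as a Weil--Deligne representation) to $\psi^{w}\otimes \mathrm{WD}(\rho_2)^{\mathrm{Fr\text{-}ss}}$, where $w=w_1-w_2$.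
   Context: Notation: $I_K\subset G_K$ is the inertia subgroup, $I_K^{\mathrm{wild}}$ the wild inertia subgroup, $\mathrm{Fr}\in G_K/I_K$ the geometric Frobenius. The Weil group $W_K$ is the preimage in $G_K$ of the subgroup generated by $\mathrm{Fr}$, topologized so that $I_K$ (with its usual topology) is open. $v_K:W_K\to\mathbb{Z}$ is the homomorphism trivial on $I_K$ with $v_K(\mathrm{Fr})=1$. Fix a lift $\varphi\in W_K$ of $\mathrm{Fr}$. Fix a uniformizer $\varpi$ of $K$ and a compatible system $\zeta=(\zeta_n)_{\ell\nmid n}$ of roots of unity; this gives $t_\zeta: I_K/I_K^{\mathrm{wild}}\xrightarrow{\sim}\prod_{\ell'\neq\ell}\mathbb{Z}_{\ell'}$ with $\sigma(\varpi^{1/n})=\zeta_n^{t_\zeta(\sigma)}\varpi^{1/n}$; let $t_{\zeta,p}:I_K\to\mathbb{Z}_p$ be the composite of $I_K\to I_K/I_K^{\mathrm{wild}}$, $t_\zeta$, and projection to $\mathbb{Z}_p$. A Weil--Deligne representation of $W_K$ on a finite-dimensional $\overline{\mathbb{Q}}_p$-space $V$ is a pair $(r,N)$ with $r$ a representation of $W_K$ on $V$ with open kernel and $N$ a nilpotent endomorphism of $V$ with $r(\sigma)Nr(\sigma)^{-1}=q^{-v_K(\sigma)}N$ for all $\sigma\in W_K$. Isomorphisms are linear isomorphisms intertwining both $r$ and $N$; for a character $\chi$ of $W_K$ (with open kernel), $\chi\otimes(r,N)$ means $(\chi\otimes r,N)$. By Grothendieck's theorem, for a continuous $\rho:G_K\to\mathrm{GL}(V)$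 there is an open subgroup $U\subset I_K$ and a unique nilpotent $N$ with $\rho(u)=\exp(t_{\zeta,p}(u)N)$ for $u\in U$. Then $\mathrm{WD}(\rho)$ is the Weil--Deligne representation $(r,N)$ with $r(g)=\rho(g)\exp(-t_{\zeta,p}(\varphi^{-v_K(g)}g)N)$ for $g\in W_K$. Frobenius-semisimplification: write $r(\varphi)=r(\varphi)^{ss}r(\varphi)^u$ (commuting semisimple and unipotent parts) and set $\tilde r(g)=r(g)(r(\varphi)^u)^{-v_K(g)}$; then $(r,N)^{\mathrm{Fr\text{-}ss}}:=(\tilde r,N)$. Monodromy filtration of $(r,N)$: the unique increasing filtration $(M_k)_{k\in\mathbb{Z}}$ of $V$ with $NM_k\subset M_{k-2}$ and $N^k:\mathrm{Gr}^M_k\to\mathrm{Gr}^M_{-k}$ an isomorphism for $k\ge0$. A $q$-Weil number of weight $m$ is an algebraic number all of whose complex conjugates have absolute value $q^{m/2}$. $(r,N)$ is pure of weight $w$ if for each $i$ the eigenvalues of $r(\varphi)$ on $\mathrm{Gr}^M_i$ are $q$-Weil numbers of weight $w+i$. A continuous representation $\rho$ of $G_K$ is pure of weight $w$ if $\mathrm{WD}(\rho)$ is. *)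

theory Defs
  imports
    "HOL-Analysis.Analysis"
    "HOL-Algebra.Coset"
    "HOL-Algebra.Generated_Groups"
    "HOL-Computational_Algebra.Computational_Algebra"
begin

section \<open>Local fields\<close>

definition nonarch_absolute_value :: "('a::field \<Rightarrow> real) \<Rightarrow> bool" where
  "nonarch_absolute_value absv \<longleftrightarrow>
     (\<forall>x. 0 \<le> absv x) \<and> (\<forall>x. absv x = 0 \<longleftrightarrow> x = 0) \<and>
     (\<forall>x y. absv (x * y) = absv x * absv y) \<and>
     (\<forall>x y. absv (x + y) \<le> max (absv x) (absv y))"

definition padic_abs :: "nat \<Rightarrow> rat \<Rightarrow> real" where
  "padic_abs p r = (if r = 0 then 0 else
     real p powi (int (multiplicity (int p) (snd (quotient_of r)))
                - int (multiplicity (int p) (fst (quotient_of r)))))"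

definition valuation_topology :: "('a::field \<Rightarrow> real) \<Rightarrow> 'a topology" where
  "valuation_topology absv = Metric_space.mtopology UNIV (\<lambda>x y. absv (x - y))"

text \<open>Inside a valued field extending \<open>\<rat>\<close> with a \<open>p\<close>-adic absolute value, \<open>\<rat>\<^sub>p\<close> is
  the topological closure of \<open>\<rat>\<close>, provided that this closure is complete.\<close>

definition padic_numbers :: "('a::field_char_0 \<Rightarrow> real) \<Rightarrow> 'a set" where
  "padic_numbers absv = valuation_topology absv closure_of \<rat>"

definition padic_integers :: "('a::field_char_0 \<Rightarrow> real) \<Rightarrow> 'a set" where
  "padic_integers absv = {x \<in> padic_numbers absv. absv x \<le> 1}"

text \<open>The type \<open>'a\<close> with \<open>absv\<close> is an algebraic closure of the completion of \<open>\<rat>\<close> at \<open>p\<close>,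
  with the (unique) absolute value extending the normalized \<open>p\<close>-adic one. That \<open>'a\<close> is
  algebraically closed is expressed by its sort.\<close>

definition padic_algebraic_closure ::
  "nat \<Rightarrow> ('a::{alg_closed_field, field_char_0} \<Rightarrow> real) \<Rightarrow> bool" where
  "padic_algebraic_closure p absv \<longleftrightarrow>
     nonarch_absolute_value absv \<and>
     (\<forall>r. absv (of_rat r) = padic_abs p r) \<and>
     Metric_space.mcomplete (padic_numbers absv) (\<lambda>x y. absv (x - y)) \<and>
     (\<forall>x. \<exists>P. P \<noteq> 0 \<and> (\<forall>i. coeff P i \<in> padic_numbers absv) \<and> poly P x = 0)"

definition is_subfield :: "'a::field set \<Rightarrow> bool" where
  "is_subfield F \<longleftrightarrow> 0 \<in> F \<and> 1 \<in> F \<and>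
     (\<forall>x\<in>F. \<forall>y\<in>F. x + y \<in> F \<and> x * y \<in> F) \<and> (\<forall>x\<in>F. - x \<in> F \<and> inverse x \<in> F)"

definition finite_extension :: "'a::field set \<Rightarrow> 'a set \<Rightarrow> bool" where
  "finite_extension F L \<longleftrightarrow> is_subfield F \<and> is_subfield L \<and> F \<subseteq> L \<and>
     (\<exists>B. finite B \<and> B \<subseteq> L \<and> L = {\<Sum>b\<in>B. c b * b | c. \<forall>b\<in>B. c b \<in> F})"

definition uniformizer :: "('k::field \<Rightarrow> real) \<Rightarrow> 'k set \<Rightarrow> 'k \<Rightarrow> bool" where
  "uniformizer absK K \<pi> \<longleftrightarrow> \<pi> \<in> K \<and> \<pi> \<noteq> 0 \<and> absK \<pi> < 1 \<and>
     (\<forall>x\<in>K. absK x < 1 \<longrightarrow> absK x \<le> absK \<pi>)"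

text \<open>The residue field is the quotient of \<open>{x \<in> K. |x| \<le> 1}\<close> by \<open>{x \<in> K. |x| < 1}\<close>.\<close>

definition residue_card :: "('k::field \<Rightarrow> real) \<Rightarrow> 'k set \<Rightarrow> nat" where
  "residue_card absK K =
     card ({x \<in> K. absK x \<le> 1} //
           {(x, y). x \<in> K \<and> y \<in> K \<and> absK x \<le> 1 \<and> absK y \<le> 1 \<and> absK (x - y) < 1})"

definition compatible_roots_of_unity :: "nat \<Rightarrow> (nat \<Rightarrow> 'k::field) \<Rightarrow> bool" where
  "compatible_roots_of_unity l \<zeta> \<longleftrightarrow>
     (\<forall>n. \<not> l dvd n \<longrightarrow> \<zeta> n ^ n = 1 \<and> (\<forall>d. 0 < d \<and> d < n \<longrightarrow> \<zeta> n ^ d \<noteq> 1)) \<and>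
     (\<forall>m n. \<not> l dvd m * n \<longrightarrow> \<zeta> (m * n) ^ m = \<zeta> n)"

section \<open>Galois, inertia and Weil groups\<close>

text \<open>The ambient type \<open>'k\<close> plays the role of the algebraic closure of \<open>K\<close>.\<close>

definition gal_group :: "'k::field set \<Rightarrow> ('k \<Rightarrow> 'k) monoid" where
  "gal_group K =
     \<lparr>carrier = {\<sigma>. bij \<sigma> \<and> (\<forall>x y. \<sigma> (x + y) = \<sigma> x + \<sigma> y \<and> \<sigma> (x * y) = \<sigma> x * \<sigma> y) \<and>
                     (\<forall>x\<in>K. \<sigma> x = x)},
      mult = (\<circ>), one = id\<rparr>"

text \<open>Krull topology: the cosets of the subgroups fixing finite extensions of \<open>K\<close> are a basis.\<close>

definition krull_topology :: "'k::field set \<Rightarrow> ('k \<Rightarrow> 'k) topology" where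
  "krull_topology K = topology_generated_by
     {{\<tau> \<in> carrier (gal_group K). \<forall>x\<in>L. \<tau> x = \<sigma> x} | \<sigma> L.
        \<sigma> \<in> carrier (gal_group K) \<and> finite_extension K L}"

text \<open>Inertia is the kernel of the action on the residue field of the algebraic closure.\<close>

definition inertia :: "('k::field \<Rightarrow> real) \<Rightarrow> 'k set \<Rightarrow> ('k \<Rightarrow> 'k) set" where
  "inertia absK K =
     {\<sigma> \<in> carrier (gal_group K). \<forall>x. absK x \<le> 1 \<longrightarrow> absK (\<sigma> x - x) < 1}"

definition inertia_topology :: "('k::field \<Rightarrow> real) \<Rightarrow> 'k set \<Rightarrow> ('k \<Rightarrow> 'k) topology" where
  "inertia_topology absK K = subtopology (krull_topology K) (inertia absK K)"

text \<open>The geometric Frobenius as an element of the quotient of the Galois group by inertia, i.e.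
  the coset of all \<open>\<sigma>\<close> acting on the residue field as the inverse of \<open>x \<mapsto> x\<^sup>q\<close>.\<close>

definition geom_frobenius :: "('k::field \<Rightarrow> real) \<Rightarrow> 'k set \<Rightarrow> ('k \<Rightarrow> 'k) set" where
  "geom_frobenius absK K = {\<sigma> \<in> carrier (gal_group K).
     \<forall>x. absK x \<le> 1 \<longrightarrow> absK (\<sigma> (x ^ residue_card absK K) - x) < 1}"

definition weil_group :: "('k::field \<Rightarrow> real) \<Rightarrow> 'k set \<Rightarrow> ('k \<Rightarrow> 'k) monoid" where
  "weil_group absK K = (gal_group K)
     \<lparr>carrier := {\<sigma> \<in> carrier (gal_group K).
        inertia absK K #>\<^bsub>gal_group K\<^esub> \<sigma>
          \<in> generate (gal_group K Mod inertia absK K) {geom_frobenius absK K}}\<rparr>"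

definition weil_topology :: "('k::field \<Rightarrow> real) \<Rightarrow> 'k set \<Rightarrow> ('k \<Rightarrow> 'k) topology" where
  "weil_topology absK K = topology_generated_by
     {(\<lambda>u. g \<circ> u) ` U | g U.
        g \<in> carrier (weil_group absK K) \<and> openin (inertia_topology absK K) U}"

definition weil_val :: "('k::field \<Rightarrow> real) \<Rightarrow> 'k set \<Rightarrow> ('k \<Rightarrow> 'k) \<Rightarrow> int" where
  "weil_val absK K \<sigma> = (THE n. inertia absK K #>\<^bsub>gal_group K\<^esub> \<sigma>
     = geom_frobenius absK K [^]\<^bsub>gal_group K Mod inertia absK K\<^esub> n)"

text \<open>The \<open>p\<close>-component of the tame character, viewed in \<open>\<int>\<^sub>p \<subseteq> 'e\<close>: the action on
  \<open>p\<^sup>m\<close>-th roots of \<open>\<pi>\<close> only depends on the class modulo \<open>p\<^sup>m\<close>, and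
  \<open>|c - a| \<le> 1 / p\<^sup>m\<close> says that \<open>c\<close> is congruent to \<open>a\<close> modulo \<open>p\<^sup>m\<close>.\<close>

definition tame_char ::
  "nat \<Rightarrow> ('e::field_char_0 \<Rightarrow> real) \<Rightarrow> 'k::field \<Rightarrow> (nat \<Rightarrow> 'k) \<Rightarrow> ('k \<Rightarrow> 'k) \<Rightarrow> 'e" where
  "tame_char p absE \<pi> \<zeta> \<sigma> = (THE c. c \<in> padic_integers absE \<and>
     (\<forall>m x. \<forall>a::nat. x ^ (p ^ m) = \<pi> \<and> absE (c - of_nat a) \<le> 1 / real p ^ m \<longrightarrow>
        \<sigma> x = \<zeta> (p ^ m) ^ a * x))"

section \<open>Linear algebra\<close>

definition fin_dim_space :: "('e::field \<Rightarrow> 'v::ab_group_add \<Rightarrow> 'v) \<Rightarrow> bool" where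
  "fin_dim_space smul \<longleftrightarrow> vector_space smul \<and> (\<exists>B. finite B \<and> module.span smul B = UNIV)"

abbreviation endo :: "('e::field \<Rightarrow> 'v::ab_group_add \<Rightarrow> 'v) \<Rightarrow> ('v \<Rightarrow> 'v) \<Rightarrow> bool" where
  "endo smul f \<equiv> Vector_Spaces.linear smul smul f"

definition GL :: "('e::field \<Rightarrow> 'v::ab_group_add \<Rightarrow> 'v) \<Rightarrow> ('v \<Rightarrow> 'v) monoid" where
  "GL smul = \<lparr>carrier = {f. endo smul f \<and> bij f}, mult = (\<circ>), one = id\<rparr>"

definition lin_trace :: "('e::field \<Rightarrow> 'v::ab_group_add \<Rightarrow> 'v) \<Rightarrow> ('v \<Rightarrow> 'v) \<Rightarrow> 'e" where
  "lin_trace smul f =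
     (let B = (SOME B. \<not> module.dependent smul B \<and> module.span smul B = UNIV)
      in \<Sum>b\<in>B. module.representation smul B (f b) b)"

definition nilpotent_map :: "('v::ab_group_add \<Rightarrow> 'v) \<Rightarrow> bool" where
  "nilpotent_map f \<longleftrightarrow> (\<exists>n. \<forall>v. (f ^^ n) v = 0)"

definition unipotent_map :: "('v::ab_group_add \<Rightarrow> 'v) \<Rightarrow> bool" where
  "unipotent_map f \<longleftrightarrow> nilpotent_map (\<lambda>v. f v - v)"

definition semisimple_map ::
  "('e::field \<Rightarrow> 'v::ab_group_add \<Rightarrow> 'v) \<Rightarrow> ('v \<Rightarrow> 'v) \<Rightarrow> bool" where
  "semisimple_map smul f \<longleftrightarrow>
     (\<forall>S. module.subspace smul S \<and> f ` S \<subseteq> S \<longrightarrow>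
        (\<exists>S'. module.subspace smul S' \<and> f ` S' \<subseteq> S' \<and>
              S \<inter> S' = {0} \<and> {x + y | x y. x \<in> S \<and> y \<in> S'} = UNIV))"

definition unipotent_part ::
  "('e::field \<Rightarrow> 'v::ab_group_add \<Rightarrow> 'v) \<Rightarrow> ('v \<Rightarrow> 'v) \<Rightarrow> 'v \<Rightarrow> 'v" where
  "unipotent_part smul f = (THE u. endo smul u \<and> unipotent_map u \<and>
     (\<exists>s. endo smul s \<and> semisimple_map smul s \<and> f = s \<circ> u \<and> s \<circ> u = u \<circ> s))"

text \<open>The exponential of a nilpotent map; the index set is then finite.\<close>

definition nilp_exp ::
  "('e::field_char_0 \<Rightarrow> 'v::ab_group_add \<Rightarrow> 'v) \<Rightarrow> ('v \<Rightarrow> 'v) \<Rightarrow> 'v \<Rightarrow> 'v" where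
  "nilp_exp smul N v = (\<Sum>k | \<exists>x. (N ^^ k) x \<noteq> 0. smul (inverse (fact k)) ((N ^^ k) v))"

section \<open>Galois representations\<close>

text \<open>The topology on \<open>GL(V)\<close> is that of \<open>End(V)\<close>, the coarsest one for which all matrix
  coefficients are continuous.\<close>

definition continuous_galois_rep ::
  "('e::field \<Rightarrow> real) \<Rightarrow> 'k::field set \<Rightarrow> ('e \<Rightarrow> 'v::ab_group_add \<Rightarrow> 'v) \<Rightarrow>
   (('k \<Rightarrow> 'k) \<Rightarrow> 'v \<Rightarrow> 'v) \<Rightarrow> bool" where
  "continuous_galois_rep absE K smul \<rho> \<longleftrightarrow>
     \<rho> \<in> hom (gal_group K) (GL smul) \<and>
     (\<forall>v f. Vector_Spaces.linear smul (*) f \<longrightarrow>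
        continuous_map (krull_topology K) (valuation_topology absE) (\<lambda>g. f (\<rho> g v)))"

definition unramified_character ::
  "('k::field \<Rightarrow> real) \<Rightarrow> 'k set \<Rightarrow> (('k \<Rightarrow> 'k) \<Rightarrow> 'e::field) \<Rightarrow> bool" where
  "unramified_character absK K \<eta> \<longleftrightarrow>
     (\<forall>g\<in>carrier (weil_group absK K). \<eta> g \<noteq> 0) \<and>
     (\<forall>g\<in>carrier (weil_group absK K). \<forall>h\<in>carrier (weil_group absK K).
        \<eta> (g \<circ> h) = \<eta> g * \<eta> h) \<and>
     (\<forall>g\<in>inertia absK K. \<eta> g = 1)"

definition twist ::
  "('e \<Rightarrow> 'v \<Rightarrow> 'v) \<Rightarrow> ('g \<Rightarrow> 'e) \<Rightarrow> ('g \<Rightarrow> 'v \<Rightarrow> 'v) \<Rightarrow> 'g \<Rightarrow> 'v \<Rightarrow> 'v" where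
  "twist smul \<eta> r = (\<lambda>g v. smul (\<eta> g) (r g v))"

section \<open>Weil--Deligne representations\<close>

type_synonym ('k, 'v) wd_rep = "(('k \<Rightarrow> 'k) \<Rightarrow> 'v \<Rightarrow> 'v) \<times> ('v \<Rightarrow> 'v)"

definition weil_deligne_rep ::
  "('k::field \<Rightarrow> real) \<Rightarrow> 'k set \<Rightarrow> ('e::field \<Rightarrow> 'v::ab_group_add \<Rightarrow> 'v) \<Rightarrow>
   ('k, 'v) wd_rep \<Rightarrow> bool" where
  "weil_deligne_rep absK K smul D \<longleftrightarrow> (case D of (r, N) \<Rightarrow>
     r \<in> hom (weil_group absK K) (GL smul) \<and>
     openin (weil_topology absK K) {g \<in> carrier (weil_group absK K). r g = id} \<and>
     endo smul N \<and> nilpotent_map N \<and>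
     (\<forall>g\<in>carrier (weil_group absK K). r g \<circ> N \<circ> inv\<^bsub>GL smul\<^esub> (r g) =
        (\<lambda>v. smul (of_nat (residue_card absK K) powi (- weil_val absK K g)) (N v))))"

definition wd_iso ::
  "('k::field \<Rightarrow> real) \<Rightarrow> 'k set \<Rightarrow>
   ('e::field \<Rightarrow> 'v::ab_group_add \<Rightarrow> 'v) \<Rightarrow> ('e \<Rightarrow> 'w::ab_group_add \<Rightarrow> 'w) \<Rightarrow>
   ('k, 'v) wd_rep \<Rightarrow> ('k, 'w) wd_rep \<Rightarrow> bool" where
  "wd_iso absK K smul smul' D D' \<longleftrightarrow> (case D of (r, N) \<Rightarrow> case D' of (r', N') \<Rightarrow>
     \<exists>T. Vector_Spaces.linear smul smul' T \<and> bij T \<and>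
         (\<forall>g\<in>carrier (weil_group absK K). T \<circ> r g = r' g \<circ> T) \<and> T \<circ> N = N' \<circ> T)"

definition wd_twist ::
  "('e \<Rightarrow> 'v \<Rightarrow> 'v) \<Rightarrow> (('k \<Rightarrow> 'k) \<Rightarrow> 'e) \<Rightarrow> ('k, 'v) wd_rep \<Rightarrow> ('k, 'v) wd_rep" where
  "wd_twist smul \<eta> D = (twist smul \<eta> (fst D), snd D)"

definition monodromy_operator ::
  "nat \<Rightarrow> ('k::field \<Rightarrow> real) \<Rightarrow> 'k set \<Rightarrow> ('e::field_char_0 \<Rightarrow> real) \<Rightarrow> 'k \<Rightarrow> (nat \<Rightarrow> 'k) \<Rightarrow>
   ('e \<Rightarrow> 'v::ab_group_add \<Rightarrow> 'v) \<Rightarrow> (('k \<Rightarrow> 'k) \<Rightarrow> 'v \<Rightarrow> 'v) \<Rightarrow> 'v \<Rightarrow> 'v" where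
  "monodromy_operator p absK K absE \<pi> \<zeta> smul \<rho> =
     (THE N. endo smul N \<and> nilpotent_map N \<and>
        (\<exists>U. subgroup U (gal_group K) \<and> openin (inertia_topology absK K) U \<and>
             (\<forall>u\<in>U. \<rho> u = nilp_exp smul (\<lambda>v. smul (tame_char p absE \<pi> \<zeta> u) (N v)))))"

definition WD ::
  "nat \<Rightarrow> ('k::field \<Rightarrow> real) \<Rightarrow> 'k set \<Rightarrow> ('e::field_char_0 \<Rightarrow> real) \<Rightarrow>
   ('k \<Rightarrow> 'k) \<Rightarrow> 'k \<Rightarrow> (nat \<Rightarrow> 'k) \<Rightarrow>
   ('e \<Rightarrow> 'v::ab_group_add \<Rightarrow> 'v) \<Rightarrow> (('k \<Rightarrow> 'k) \<Rightarrow> 'v \<Rightarrow> 'v) \<Rightarrow> ('k, 'v) wd_rep" where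
  "WD p absK K absE \<phi> \<pi> \<zeta> smul \<rho> =
     (let N = monodromy_operator p absK K absE \<pi> \<zeta> smul \<rho>;
          t = tame_char p absE \<pi> \<zeta>
      in (\<lambda>g. \<rho> g \<circ> nilp_exp smul
             (\<lambda>v. smul (- t (\<phi> [^]\<^bsub>gal_group K\<^esub> (- weil_val absK K g) \<circ> g)) (N v)),
          N))"

definition frobenius_ss ::
  "('k::field \<Rightarrow> real) \<Rightarrow> 'k set \<Rightarrow> ('k \<Rightarrow> 'k) \<Rightarrow> ('e::field \<Rightarrow> 'v::ab_group_add \<Rightarrow> 'v) \<Rightarrow>
   ('k, 'v) wd_rep \<Rightarrow> ('k, 'v) wd_rep" where
  "frobenius_ss absK K \<phi> smul D = (case D of (r, N) \<Rightarrow>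
     (\<lambda>g. r g \<circ> unipotent_part smul (r \<phi>) [^]\<^bsub>GL smul\<^esub> (- weil_val absK K g), N))"

section \<open>Purity\<close>

text \<open>The last condition spells out that the map from \<open>M k / M (k - 1)\<close> to
  \<open>M (- k) / M (- k - 1)\<close> induced by the \<open>k\<close>-th power of \<open>N\<close> is injective and surjective.
  Filtrations are understood to be exhaustive and separated.\<close>

definition monodromy_filtration ::
  "('e::field \<Rightarrow> 'v::ab_group_add \<Rightarrow> 'v) \<Rightarrow> ('v \<Rightarrow> 'v) \<Rightarrow> (int \<Rightarrow> 'v set) \<Rightarrow> bool" where
  "monodromy_filtration smul N M \<longleftrightarrow>
     (\<forall>k. module.subspace smul (M k)) \<and> mono M \<and>
     (\<exists>a. M a = {0}) \<and> (\<exists>b. M b = UNIV) \<and>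
     (\<forall>k. N ` M k \<subseteq> M (k - 2)) \<and>
     (\<forall>k::nat.
        (\<forall>v\<in>M (int k). (N ^^ k) v \<in> M (- int k - 1) \<longrightarrow> v \<in> M (int k - 1)) \<and>
        (\<forall>w\<in>M (- int k). \<exists>v\<in>M (int k). w - (N ^^ k) v \<in> M (- int k - 1)))"

text \<open>The irreducible polynomial below is, up to a scalar, the minimal polynomial of \<open>a\<close>, so its
  complex roots are the complex conjugates of \<open>a\<close>.\<close>

definition weil_number :: "nat \<Rightarrow> int \<Rightarrow> 'e::field_char_0 \<Rightarrow> bool" where
  "weil_number q m a \<longleftrightarrow> (\<exists>P :: rat poly. irreducible P \<and> poly (map_poly of_rat P) a = 0 \<and>
     (\<forall>z::complex. poly (map_poly of_rat P) z = 0 \<longrightarrow> cmod z = real q powr (real_of_int m / 2)))"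

text \<open>A vector \<open>v\<close> in \<open>M i\<close> but not in \<open>M (i - 1)\<close> represents a nonzero element of the graded
  piece.\<close>

definition wd_pure ::
  "('k::field \<Rightarrow> real) \<Rightarrow> 'k set \<Rightarrow> ('k \<Rightarrow> 'k) \<Rightarrow>
   ('e::field_char_0 \<Rightarrow> 'v::ab_group_add \<Rightarrow> 'v) \<Rightarrow> int \<Rightarrow> ('k, 'v) wd_rep \<Rightarrow> bool" where
  "wd_pure absK K \<phi> smul w D \<longleftrightarrow> weil_deligne_rep absK K smul D \<and> (case D of (r, N) \<Rightarrow>
     \<exists>M. monodromy_filtration smul N M \<and>
       (\<forall>i a v. v \<in> M i \<and> v \<notin> M (i - 1) \<and> r \<phi> v - smul a v \<in> M (i - 1) \<longrightarrow>
          weil_number (residue_card absK K) (w + i) a))"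

definition galois_pure ::
  "nat \<Rightarrow> ('k::field \<Rightarrow> real) \<Rightarrow> 'k set \<Rightarrow> ('e::field_char_0 \<Rightarrow> real) \<Rightarrow>
   ('k \<Rightarrow> 'k) \<Rightarrow> 'k \<Rightarrow> (nat \<Rightarrow> 'k) \<Rightarrow>
   ('e \<Rightarrow> 'v::ab_group_add \<Rightarrow> 'v) \<Rightarrow> int \<Rightarrow> (('k \<Rightarrow> 'k) \<Rightarrow> 'v \<Rightarrow> 'v) \<Rightarrow> bool" where
  "galois_pure p absK K absE \<phi> \<pi> \<zeta> smul w \<rho> \<longleftrightarrow>
     wd_pure absK K \<phi> smul w (WD p absK K absE \<phi> \<pi> \<zeta> smul \<rho>)"

end

theory Submission
  imports Defs
begin

text \<open>Both representations have the same trace as their Weil--Deligne counterparts, because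
  \<open>exp (t N)\<close> is unipotent along the flag of the \<open>ker N\<^sup>j\<close>, and Frobenius-semisimplification
  does not change traces either. After the twist, the two representations \<open>r\<^sub>1\<close>, \<open>r\<^sub>2\<close> of the Weil
  group therefore have equal traces; they are finite modulo a power \<open>z\<close> of Frobenius that acts
  centrally and semisimply.

  Purity says that the eigenvalues of \<open>z\<close> carry a weight and that \<open>N\<^sup>k\<close> maps the part of weight
  \<open>k\<close> isomorphically onto the part of weight \<open>-k\<close>; taking \<open>z\<close> to be an even power makes the weight a
  function of the eigenvalue alone, common to both representations. Character theory on an
  eigenspace of \<open>z\<close> of highest weight yields irreducible summands \<open>A: W\<^sub>1 \<cong> W\<^sub>2\<close>, and
  \<open>N\<^sup>j v \<mapsto> N\<^sup>j (A v)\<close> extends \<open>A\<close> to the summands generated by them under \<open>N\<close>. Splitting these off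
  and repeating exhausts both representations. Everything is carried out inside
  \<open>V\<^sub>1 \<oplus> V\<^sub>2\<close> with idempotents in place of subrepresentations, so that only traces of
  endomorphisms of one space occur.\<close>

section \<open>Linear maps and traces\<close>

text \<open>Traces see the action of the Weil group but not \<open>N\<close>. What recovers
  \<open>N\<close> is that in a pure representation the absolute value of a Frobenius eigenvalue
  tells in which graded piece it occurs, so the strings of \<open>N\<close> can be read off from
  \<open>r\<close>. The Weil group is infinite and cannot be averaged over directly; on an
  eigenspace of \<open>z\<close>, however, it is finite modulo scalars, and scalars cancel under
  conjugation, which is enough for the arguments of Maschke and Schur. Two obstacles shape the rest.
  Eigenvalues live in 'e and absolute values in \<complex>, and no embedding is chosen, so weights
  pass through rational polynomials only. An even power \<open>z\<close> makes the contribution of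
  \<psi> to it a rational number, and multiplication by a rational number is a mere substitution in
  the polynomial. Moreover, finiteness of the image of inertia yields commutation of inertia with a
  power of Frobenius only; that the unipotent part of Frobenius itself commutes with inertia, as
  semisimplification requires, takes an extraction of roots.\<close>

lemma lin_add: "Vector_Spaces.linear s1 s2 f \<Longrightarrow> f (x + y) = f x + f y"
  by (simp add: Vector_Spaces.linear_iff)

lemma lin_scale: "Vector_Spaces.linear s1 s2 f \<Longrightarrow> f (s1 c x) = s2 c (f x)"
  by (simp add: Vector_Spaces.linear_iff)

lemma lin_zero: "Vector_Spaces.linear s1 s2 f \<Longrightarrow> f 0 = 0"
  by (metis add_cancel_right_right lin_add)

lemma lin_neg: "Vector_Spaces.linear s1 s2 f \<Longrightarrow> f (- x) = - f x"
  by (metis add_eq_0_iff lin_add lin_zero add.right_inverse)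

lemma lin_diff: "Vector_Spaces.linear s1 s2 f \<Longrightarrow> f (x - y) = f x - f y"
  by (metis add_uminus_conv_diff lin_add lin_neg)

lemma lin_sum: "Vector_Spaces.linear s1 s2 f \<Longrightarrow> f (\<Sum>i\<in>A. g i) = (\<Sum>i\<in>A. f (g i))"
  by (induction A rule: infinite_finite_induct) (auto simp: lin_add lin_zero)

lemma lin_pair: "Vector_Spaces.linear s1 s2 f \<Longrightarrow> vector_space_pair s1 s2"
  by (simp add: Vector_Spaces.linear_iff vector_space_pair_def)

lemma vector_space_mult: "vector_space ((*) :: 'a::field \<Rightarrow> 'a \<Rightarrow> 'a)"
  by (rule vector_space.intro) (simp_all add: distrib_left distrib_right mult.assoc)

lemma lin_comp:
  "Vector_Spaces.linear s1 s2 f \<Longrightarrow> Vector_Spaces.linear s2 s3 g \<Longrightarrow>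
   Vector_Spaces.linear s1 s3 (\<lambda>x. g (f x))"
  by (simp add: Vector_Spaces.linear_iff)

lemma lin_plus:
  "Vector_Spaces.linear s1 s2 f \<Longrightarrow> Vector_Spaces.linear s1 s2 g \<Longrightarrow>
   Vector_Spaces.linear s1 s2 (\<lambda>x. f x + g x)"
  by (simp add: Vector_Spaces.linear_iff vector_space.vector_space_assms(1) algebra_simps)

lemma lin_minus:
  "Vector_Spaces.linear s1 s2 f \<Longrightarrow> Vector_Spaces.linear s1 s2 g \<Longrightarrow>
   Vector_Spaces.linear s1 s2 (\<lambda>x. f x - g x)"
  by (rule vector_space_pair.linear_compose_sub[OF lin_pair])

lemma lin_smult:
  "Vector_Spaces.linear s1 s2 f \<Longrightarrow> Vector_Spaces.linear s1 s2 (\<lambda>x. s2 c (f x))"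
  by (rule vector_space_pair.linear_compose_scale_right[OF lin_pair])

lemma lin_const0:
  "vector_space s1 \<Longrightarrow> vector_space s2 \<Longrightarrow> Vector_Spaces.linear s1 s2 (\<lambda>x. 0)"
  by (simp add: Vector_Spaces.linear_iff vector_space.vector_space_assms(1) module.scale_zero_right
      flip: module_iff_vector_space)

lemma lin_Sum:
  assumes "vector_space s1" "vector_space s2" "\<And>i. i \<in> A \<Longrightarrow> Vector_Spaces.linear s1 s2 (f i)"
  shows "Vector_Spaces.linear s1 s2 (\<lambda>x. \<Sum>i\<in>A. f i x)"
  using assms(3)
  by (induction A rule: infinite_finite_induct) (simp_all add: lin_const0 lin_plus assms(1,2))

lemma lin_inv:
  assumes "Vector_Spaces.linear s1 s2 f" "bij f"
  shows "Vector_Spaces.linear s2 s1 (inv_into UNIV f)"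
proof -
  have "inv_into UNIV f (x + y) = inv_into UNIV f x + inv_into UNIV f y"
    "inv_into UNIV f (s2 c x) = s1 c (inv_into UNIV f x)" for x y c
    using assms by (metis bij_inv_eq_iff lin_add, metis bij_inv_eq_iff lin_scale)
  then show ?thesis using assms by (simp add: Vector_Spaces.linear_iff)
qed

lemma funpow_commute:
  assumes "\<And>v. f (g v) = g (f v)"
  shows "(f ^^ n) (g v) = g ((f ^^ n) v)"
  by (induction n) (auto simp: assms)

lemma funpow_funpow_commute:
  assumes "\<And>v. f (g v) = g (f v)"
  shows "(f ^^ n) ((g ^^ m) v) = (g ^^ m) ((f ^^ n) v)"
  by (rule funpow_commute, rule sym, rule funpow_commute) (simp add: assms)

text \<open>Expanding \<open>f b\<close> in \<open>C\<close> and \<open>g c\<close> in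
  \<open>B\<close> turns both sides into the same double sum of products of matrix entries. As the
  two spaces may differ, this covers cyclicity on a single space as well as the transfer of traces
  between a direct sum and its summands.\<close>

lemma representation_bilinear_swap:
  fixes s1 :: "'a::field \<Rightarrow> 'b::ab_group_add \<Rightarrow> 'b" and s2 :: "'a \<Rightarrow> 'c::ab_group_add \<Rightarrow> 'c"
  assumes f: "Vector_Spaces.linear s1 s2 f" and g: "Vector_Spaces.linear s2 s1 g"
    and B: "finite B" "\<not> module.dependent s1 B" "module.span s1 B = UNIV"
    and C: "finite C" "\<not> module.dependent s2 C" "module.span s2 C = UNIV"
  shows "(\<Sum>b\<in>B. module.representation s1 B (g (f b)) b) =
         (\<Sum>c\<in>C. module.representation s2 C (f (g c)) c)"
proof -
  interpret v1: vector_space s1 using f by (simp add: Vector_Spaces.linear_iff)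
  interpret v2: vector_space s2 using f by (simp add: Vector_Spaces.linear_iff)
  have e1: "x = (\<Sum>b\<in>B. s1 (v1.representation B x b) b)" for x
    by (rule v1.sum_representation_eq[symmetric]) (use B in auto)
  have e2: "x = (\<Sum>b\<in>C. s2 (v2.representation C x b) b)" for x
    by (rule v2.sum_representation_eq[symmetric]) (use C in auto)
  have r1: "v1.representation B (g y) b =
     (\<Sum>c\<in>C. v2.representation C y c * v1.representation B (g c) b)" for y b
  proof -
    have "g y = (\<Sum>c\<in>C. s1 (v2.representation C y c) (g c))"
      by (subst e2[of y]) (simp add: lin_sum[OF g] lin_scale[OF g])
    then show ?thesis
      using B by (simp add: v1.representation_sum v1.representation_scale)
  qed
  have r2: "v2.representation C (f y) b =
     (\<Sum>c\<in>B. v1.representation B y c * v2.representation C (f c) b)" for y b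
  proof -
    have "f y = (\<Sum>c\<in>B. s2 (v1.representation B y c) (f c))"
      by (subst e1[of y]) (simp add: lin_sum[OF f] lin_scale[OF f])
    then show ?thesis
      using C by (simp add: v2.representation_sum v2.representation_scale)
  qed
  show ?thesis
    by (simp add: r1[of "f _"] r2[of "g _"] mult.commute)
      (rule sum.swap)
qed

locale fd_space = vector_space scale
  for scale :: "'a::field_char_0 \<Rightarrow> 'b::ab_group_add \<Rightarrow> 'b" (infixr \<open>\<star>\<close> 75) +
  assumes finite_spanning: "\<exists>B. finite B \<and> span B = UNIV"
begin

lemma endo_iff:
  "endo scale f \<longleftrightarrow> (\<forall>x y. f (x + y) = f x + f y) \<and> (\<forall>c x. f (scale c x) = scale c (f x))"
  using vector_space_axioms by (simp add: Vector_Spaces.linear_iff)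

lemma endo_id: "endo scale (\<lambda>x. x)" and endo_id': "endo scale id"
  by (simp_all add: endo_iff)

lemma endo_zero: "endo scale (\<lambda>x. 0)"
  by (simp add: endo_iff)

lemma endo_Sum: "(\<And>i. i \<in> A \<Longrightarrow> endo scale (f i)) \<Longrightarrow> endo scale (\<lambda>x. \<Sum>i\<in>A. f i x)"
  by (rule lin_Sum) (use vector_space_axioms in auto)

lemma endo_funpow: "endo scale f \<Longrightarrow> endo scale (f ^^ n)"
  by (induction n) (auto simp: endo_iff)

lemma subspace_range: "endo scale f \<Longrightarrow> subspace (range f)"
  by (rule module_hom.subspace_image[OF _ subspace_UNIV]) (simp add: linear_iff_module_hom)

lemma subspace_eigen: "endo scale f \<Longrightarrow> subspace {v. f v = scale a v}"
  by (simp add: subspace_def lin_add lin_scale lin_zero scale_right_distrib mult.commute)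

text \<open>The choice is literally the one inside \<open>lin_trace\<close>, so
  \<open>trace_def\<close> holds by unfolding.\<close>

definition basis :: "'b set" where
  "basis = (SOME B. independent B \<and> span B = UNIV)"

lemma finite_independent: "independent B \<Longrightarrow> finite B"
proof -
  obtain C where "finite C" "span C = UNIV" using finite_spanning by blast
  then show "independent B \<Longrightarrow> finite B" using independent_span_bound[of C B] by auto
qed

lemma basis: "finite basis" "independent basis" "span basis = UNIV"
proof -
  have "\<exists>B. independent B \<and> span B = UNIV"
    by (metis basis_exists subset_UNIV top.extremum_uniqueI)
  then have "independent basis \<and> span basis = UNIV"
    unfolding basis_def by (rule someI_ex)
  then show "finite basis" "independent basis" "span basis = UNIV"
    using finite_independent by auto
qed

sublocale finite_dimensional_vector_space scale basis
  by unfold_locales (use basis in auto)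

abbreviation tr :: "('b \<Rightarrow> 'b) \<Rightarrow> 'a" where "tr \<equiv> lin_trace scale"

abbreviation crd :: "'b \<Rightarrow> 'b \<Rightarrow> 'a" where "crd b x \<equiv> representation basis x b"

lemma trace_def: "tr f = (\<Sum>b\<in>basis. crd b (f b))"
  unfolding lin_trace_def basis_def Let_def by (rule refl)

lemma crd_add: "crd b (x + y) = crd b x + crd b y"
  and crd_scale: "crd b (c \<star> x) = c * crd b x"
  and crd_zero: "crd b 0 = 0"
  and crd_sum: "crd b (\<Sum>i\<in>I. h i) = (\<Sum>i\<in>I. crd b (h i))"
  using basis by (simp_all add: representation_add representation_scale representation_zero
      representation_sum)

lemma sum_crd: "(\<Sum>b\<in>basis. crd b x \<star> b) = x"
  by (rule sum_representation_eq) (use basis in auto)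

lemma endo_crd_sum: "endo scale f \<Longrightarrow> (\<Sum>b\<in>basis. crd b x \<star> f b) = f x"
  using lin_sum[of scale scale f "\<lambda>b. crd b x \<star> b" basis] by (simp add: sum_crd lin_scale)

lemma trace_plus: "tr (\<lambda>v. f v + g v) = tr f + tr g"
  by (simp add: trace_def crd_add sum.distrib)

lemma trace_scale: "tr (\<lambda>v. c \<star> f v) = c * tr f"
  by (simp add: trace_def crd_scale sum_distrib_left)

lemma trace_zero: "tr (\<lambda>v. 0) = 0"
  by (simp add: trace_def crd_zero)

lemma trace_minus: "tr (\<lambda>v. f v - g v) = tr f - tr g"
  using trace_plus[of f "\<lambda>v. (-1) \<star> g v"] trace_scale[of "-1" g] by simp

lemma trace_Sum: "tr (\<lambda>v. \<Sum>i\<in>I. f i v) = (\<Sum>i\<in>I. tr (f i))"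
  by (induction I rule: infinite_finite_induct) (simp_all add: trace_zero trace_plus)

lemma trace_cyclic:
  "endo scale f \<Longrightarrow> endo scale g \<Longrightarrow> tr (\<lambda>v. g (f v)) = tr (\<lambda>v. f (g v))"
  unfolding trace_def by (rule representation_bilinear_swap) (use basis in auto)

text \<open>These rank-one maps play the part of matrix units: they test single coordinates in
  \<open>trace_nondegenerate\<close> and resolve the character sum in
  \<open>trace_eq_imp_nonzero_composite\<close>.\<close>

lemma trace_rank_one: "tr (\<lambda>v. crd b v \<star> x) = crd b x"
proof -
  have "tr (\<lambda>v. crd b v \<star> x) = (\<Sum>c\<in>basis. crd b (crd c x \<star> c))"
    by (simp add: trace_def crd_scale mult.commute)
  also have "\<dots> = crd b x" by (simp flip: crd_sum add: sum_crd)
  finally show ?thesis .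
qed

lemma trace_nondegenerate:
  assumes "\<And>X. endo scale X \<Longrightarrow> tr (\<lambda>v. X (Z v)) = 0" "endo scale Z"
  shows "Z v = 0"
proof -
  have "crd b (Z x) = 0" for b x
  proof -
    have e: "endo scale (\<lambda>v. crd b v \<star> x)"
      by (simp add: endo_iff crd_add crd_scale scale_left_distrib)
    have "0 = tr (\<lambda>v. crd b (Z v) \<star> x)" using assms(1)[OF e] by simp
    also have "\<dots> = tr (\<lambda>v. Z (crd b v \<star> x))"
      using trace_cyclic[OF assms(2) e] by simp
    also have "\<dots> = crd b (Z x)"
      by (simp add: lin_scale[OF assms(2)] trace_rank_one)
    finally show ?thesis by simp
  qed
  then show ?thesis by (metis (no_types, lifting) scale_zero_left sum.neutral sum_crd)
qed

section \<open>Projections, and the traces of idempotent and nilpotent maps\<close>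

lemma projection_exists:
  assumes "subspace S"
  obtains e where "endo scale e" "\<And>v. e v \<in> S" "\<And>v. v \<in> S \<Longrightarrow> e v = v"
proof -
  interpret p: vector_space_pair scale scale by unfold_locales
  obtain g where g: "range g \<subseteq> S" "endo scale g" "\<forall>v\<in>S. g v = v"
  proof -
    have "\<exists>g. range g \<subseteq> S \<and> endo scale g \<and> (\<forall>x\<in>id ` S. id (g x) = x)"
      by (rule p.linear_exists_right_inverse_on) (use assms endo_id' in auto)
    then show ?thesis using that by auto
  qed
  show ?thesis by (rule that[of g]) (use g in auto)
qed

text \<open>The trace of an idempotent is its rank, as the decomposition into rank-one maps along a
  basis \<open>C\<close> of the range shows; in characteristic zero a vanishing rank leaves only the
  zero map.\<close>

lemma trace_idempotent_nonzero:
  assumes e: "endo scale e" "\<And>v. e (e v) = e v" and "tr e = 0"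
  shows "e v = 0"
proof -
  have S: "subspace (range e)"
    by (rule subspace_range) (rule e)
  obtain C where C: "C \<subseteq> range e" "independent C" "range e = span C"
    using basis_exists[of "range e"] S by (metis span_subspace)
  have fC: "finite C" using C(2) finite_independent by blast
  have ev: "e v = (\<Sum>c\<in>C. representation C (e v) c \<star> c)" for v
    by (rule sum_representation_eq[symmetric]) (use C fC in auto)
  have lin: "Vector_Spaces.linear scale (*) (\<lambda>v. representation C (e v) c)" for c
  proof -
    have "e v \<in> span C" for v using C(3) by auto
    then show ?thesis
      using C(2) by (simp add: Vector_Spaces.linear_iff vector_space_axioms vector_space_mult
        lin_add[OF e(1)] lin_scale[OF e(1)] representation_add representation_scale)
  qed
  have rank1: "tr (\<lambda>v. representation C (e v) c \<star> c) = representation C (e c) c" for c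
  proof -
    have "tr (\<lambda>v. representation C (e v) c \<star> c) =
        (\<Sum>b\<in>basis. representation C (e (crd b c \<star> b)) c)"
      by (simp add: trace_def crd_scale lin_scale[OF lin] mult.commute)
    also have "\<dots> = representation C (e c) c"
      using lin_sum[OF lin, of "\<lambda>b. crd b c \<star> b" basis c] by (simp add: sum_crd)
    finally show ?thesis .
  qed
  have "e c = c" if "c \<in> C" for c using that C(1) e(2) by auto
  moreover have "tr e = tr (\<lambda>v. \<Sum>c\<in>C. representation C (e v) c \<star> c)"
    by (rule arg_cong[where f = tr], rule ext, rule ev)
  ultimately have "tr e = (\<Sum>c\<in>C. 1)"
    using C(2) by (simp add: trace_Sum rank1 representation_basis)
  then have "C = {}" using \<open>tr e = 0\<close> fC by simp
  then show ?thesis using C(3) by auto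
qed

text \<open>With \<open>e\<close> a projection onto the range of \<open>f\<close>, the map
  \<open>f e\<close> has the same trace by cyclicity, because \<open>e f = f\<close>, and is again
  nilpotent. Its range is smaller unless \<open>f\<close> vanishes, so induction on the rank
  applies.\<close>

lemma trace_nilpotent:
  assumes "endo scale f" "nilpotent_map f"
  shows "tr f = 0"
  using assms
proof (induction "dim (range f)" arbitrary: f rule: less_induct)
  case less
  note f = less.prems(1)
  have S: "subspace (range f)"
    by (rule subspace_range) (rule f)
  obtain e where e: "endo scale e" "\<And>v. e v \<in> range f" "\<And>v. v \<in> range f \<Longrightarrow> e v = v"
    using projection_exists[OF S] by blast
  define g where "g v = f (e v)" for v
  have g: "endo scale g" unfolding g_def by (rule lin_comp[OF e(1) f])
  have pw: "(g ^^ n) v = (f ^^ n) (e v)" if "n > 0" for n v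
    using that
  proof (induction n)
    case (Suc n)
    then show ?case by (cases n) (auto simp: g_def e(3))
  qed simp
  obtain n where "\<And>v. (f ^^ n) v = 0" using less.prems(2) by (auto simp: nilpotent_map_def)
  then have "(g ^^ Suc n) v = 0" for v by (subst pw) (auto simp: lin_zero[OF f])
  then have nil: "nilpotent_map g" unfolding nilpotent_map_def by blast
  have tr: "tr f = tr g"
    using trace_cyclic[OF f e(1)] by (simp add: e(3) g_def[abs_def])
  show ?case
  proof (cases "range g = range f")
    case True
    \<comment> \<open>An unchanged range means that \<open>f\<close> maps its range onto itself, so
      every power of \<open>f\<close> has at least that range; a vanishing power then forces
      \<open>f = 0\<close>.\<close>
    have "range (f ^^ k) \<supseteq> range f" if "k > 0" for k
      using that
    proof (induction k)
      case (Suc k)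
      show ?case
      proof (cases k)
        case 0 then show ?thesis by auto
      next
        case (Suc m)
        have "range f = g ` UNIV" using True by simp
        also have "\<dots> \<subseteq> f ` range f" unfolding g_def using e(2) by auto
        also have "\<dots> \<subseteq> f ` range (f ^^ k)" using Suc.IH Suc by auto
        finally show ?thesis by (auto simp: image_comp)
      qed
    qed simp
    from this[of "Suc n"] have "f v = 0" for v
      using \<open>\<And>v. (f ^^ n) v = 0\<close> lin_zero[OF f] by force
    then show ?thesis by (simp add: trace_def crd_zero)
  next
    case False
    have "range g \<subseteq> range f" by (auto simp: g_def)
    moreover have "subspace (range g)"
      by (rule subspace_range) (rule g)
    ultimately have "dim (range g) < dim (range f)"
      using False S by (intro dim_psubset) (auto simp: span_eq_iff[THEN iffD2])
    then show ?thesis using less.hyps[OF _ g nil] tr by simp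
  qed
qed

end

lemma fd_spaceI: "fin_dim_space smul \<Longrightarrow> fd_space smul"
  by (auto simp: fin_dim_space_def fd_space_def fd_space_axioms_def)

lemma trace_swap:
  assumes "fd_space s1" "fd_space s2" "Vector_Spaces.linear s1 s2 f" "Vector_Spaces.linear s2 s1 g"
  shows "lin_trace s1 (\<lambda>v. g (f v)) = lin_trace s2 (\<lambda>v. f (g v))"
  using assms
  by (simp add: fd_space.trace_def representation_bilinear_swap fd_space.basis)

section \<open>Polynomials in an endomorphism\<close>

text \<open>Coprimality is kept as a Bezout identity, which survives products and powers by ring
  identities alone and later also serves polynomials over \<complex>.\<close>

definition comaximal :: "'a::comm_ring_1 \<Rightarrow> 'a \<Rightarrow> bool" where
  "comaximal a b \<longleftrightarrow> (\<exists>u v. u * a + v * b = 1)"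

lemma comaximal_sym: "comaximal a b \<Longrightarrow> comaximal b a"
  unfolding comaximal_def by (metis add.commute)

lemma comaximal_mult:
  assumes "comaximal a b" "comaximal a c"
  shows "comaximal a (b * c)"
proof -
  obtain u v s t where e: "u * a + v * b = 1" "s * a + t * c = 1"
    using assms unfolding comaximal_def by blast
  have "(u * a + v * b) * (s * a + t * c) = 1" using e by simp
  then have "(u * (s * a + t * c) + v * b * s) * a + (v * t) * (b * c) = 1"
    by (simp add: algebra_simps)
  then show ?thesis unfolding comaximal_def by blast
qed

lemma comaximal_1: "comaximal a 1"
  unfolding comaximal_def by (metis add.left_neutral mult_1 mult_zero_left)

lemma comaximal_power: "comaximal a b \<Longrightarrow> comaximal (a ^ n) (b ^ m)"
proof -
  have "comaximal a b \<Longrightarrow> comaximal a (b ^ m)" for a b :: 'a and m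
    by (induction m) (auto simp: comaximal_1 comaximal_mult)
  then show "comaximal a b \<Longrightarrow> comaximal (a ^ n) (b ^ m)" by (meson comaximal_sym)
qed

lemma comaximal_prod: "(\<And>i. i \<in> I \<Longrightarrow> comaximal a (f i)) \<Longrightarrow> comaximal a (\<Prod>i\<in>I. f i)"
  by (induction I rule: infinite_finite_induct) (auto simp: comaximal_1 comaximal_mult)

lemma comaximal_dvd_mult:
  assumes "comaximal a b" "a dvd c" "b dvd c"
  shows "a * b dvd c"
proof -
  obtain u v where e: "u * a + v * b = 1" using assms(1) unfolding comaximal_def by blast
  have "c = (u * a + v * b) * c" using e by simp
  also have "\<dots> = u * (a * c) + v * (b * c)" by (simp add: algebra_simps)
  also have "a * b dvd \<dots>"
    using mult_dvd_mono[OF dvd_refl[of a] assms(3)] mult_dvd_mono[OF dvd_refl[of b] assms(2)]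
    by (intro dvd_add[OF dvd_mult dvd_mult]) (simp_all add: mult.commute[of b a])
  finally show ?thesis .
qed

lemma comaximal_linear_poly: "a \<noteq> b \<Longrightarrow> comaximal [:- a, 1:] [:- b, 1 :: 'a::field:]"
proof -
  assume "a \<noteq> b"
  then have "inverse (b - a) * b - inverse (b - a) * a = 1" by (simp flip: right_diff_distrib)
  then have "[:inverse (b - a):] * [:- a, 1:] + [:- inverse (b - a):] * [:- b, 1:] = 1"
    by (simp add: one_pCons mult.commute[of b] mult.commute[of a])
  then show ?thesis unfolding comaximal_def by blast
qed

lemma prod_linear_power_dvd:
  fixes P :: "'a::field poly"
  assumes "finite A" "\<And>a. a \<in> A \<Longrightarrow> [:- a, 1:] ^ n dvd P"
  shows "(\<Prod>a\<in>A. [:- a, 1:] ^ n) dvd P"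
  using assms
proof (induction A rule: finite_induct)
  case (insert a A)
  have "comaximal ([:- a, 1:] ^ n) (\<Prod>a\<in>A. [:- a, 1:] ^ n)"
    using insert.hyps by (intro comaximal_prod comaximal_power comaximal_linear_poly) auto
  then show ?case using insert by (simp add: comaximal_dvd_mult)
qed simp

lemma prod_linear_dvd:
  fixes P :: "'a::field poly"
  assumes "finite A" "\<And>a. a \<in> A \<Longrightarrow> poly P a = 0"
  shows "(\<Prod>a\<in>A. [:- a, 1:]) dvd P"
  using prod_linear_power_dvd[of A 1 P] assms by (simp add: poly_eq_0_iff_dvd)

text \<open>The order \<open>n\<close> covers two uses: \<open>n = 1\<close> is interpolation and
  gives eigenprojections, while a large \<open>n\<close> gives the semisimple part in
  \<open>jordan_exists\<close>.\<close>

lemma poly_chinese_remainder: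
  fixes c :: "'a::field \<Rightarrow> 'a"
  assumes "finite A"
  shows "\<exists>P. \<forall>a\<in>A. [:- a, 1:] ^ n dvd P - [:c a:]"
  using assms
proof (induction A rule: finite_induct)
  case (insert b A)
  then obtain P where P: "\<forall>a\<in>A. [:- a, 1:] ^ n dvd P - [:c a:]" by blast
  define Q where "Q = (\<Prod>a\<in>A. [:- a, 1:] ^ n)"
  have "comaximal ([:- b, 1:] ^ n) Q" unfolding Q_def
    using insert.hyps by (intro comaximal_prod comaximal_power comaximal_linear_poly) auto
  then obtain u v where uv: "u * [:- b, 1:] ^ n + v * Q = 1" unfolding comaximal_def by blast
  \<comment> \<open>\<open>v * Q\<close> is congruent to 1 modulo the new factor and to 0 modulo the
    old ones, so this corrects \<open>P\<close> at \<open>b\<close> only.\<close>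
  define R where "R = P + ([:c b:] - P) * (v * Q)"
  have "[:- b, 1:] ^ n dvd R - [:c b:]"
  proof -
    have vq: "v * Q = 1 - u * [:- b, 1:] ^ n" using uv by (simp add: algebra_simps)
    have "R - [:c b:] = - (([:c b:] - P) * u) * [:- b, 1:] ^ n"
      unfolding R_def vq by (simp add: algebra_simps)
    then show ?thesis by (metis dvd_triv_right)
  qed
  moreover have "[:- a, 1:] ^ n dvd R - [:c a:]" if "a \<in> A" for a
  proof -
    have "[:- a, 1:] ^ n dvd Q" unfolding Q_def using that insert.hyps by auto
    moreover have "R - [:c a:] = (P - [:c a:]) + (([:c b:] - P) * v) * Q"
      by (simp add: R_def algebra_simps)
    ultimately show ?thesis using P that by (metis dvd_add dvd_mult)
  qed
  ultimately show ?case by blast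
qed simp

lemma poly_interpolation:
  fixes c :: "'a::field \<Rightarrow> 'a"
  assumes "finite A"
  obtains P where "\<And>a. a \<in> A \<Longrightarrow> poly P a = c a"
proof -
  obtain P where "\<forall>a\<in>A. [:- a, 1:] ^ 1 dvd P - [:c a:]"
    using poly_chinese_remainder[OF assms] by blast
  then have "\<forall>a\<in>A. poly P a = c a" by (simp add: poly_eq_0_iff_dvd[symmetric])
  then show ?thesis using that by blast
qed

context fd_space
begin

definition pev :: "('b \<Rightarrow> 'b) \<Rightarrow> 'a poly \<Rightarrow> 'b \<Rightarrow> 'b" where
  "pev f P v = (\<Sum>i\<le>degree P. coeff P i \<star> (f ^^ i) v)"

lemma pev_bound:
  assumes "degree P \<le> n"
  shows "pev f P v = (\<Sum>i\<le>n. coeff P i \<star> (f ^^ i) v)"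
  unfolding pev_def using assms
  by (intro sum.mono_neutral_left) (auto simp: coeff_eq_0)

lemma pev_0 [simp]: "pev f 0 v = 0"
  by (simp add: pev_def)

lemma pev_add: "pev f (P + Q) v = pev f P v + pev f Q v"
proof -
  define n where "n = max (degree P) (degree Q)"
  have "degree P \<le> n" "degree Q \<le> n" "degree (P + Q) \<le> n"
    by (auto simp: n_def degree_add_le)
  then show ?thesis
    by (simp add: pev_bound[of _ n] scale_left_distrib sum.distrib)
qed

lemma pev_smult: "pev f (smult c P) v = c \<star> pev f P v"
  by (simp add: pev_bound[of "smult c P" "degree P"] degree_smult_le pev_def scale_sum_right)

lemma pev_pCons:
  assumes "endo scale f"
  shows "pev f (pCons a P) v = a \<star> v + f (pev f P v)"
proof -
  have "pev f (pCons a P) v = (\<Sum>i\<le>Suc (degree P). coeff (pCons a P) i \<star> (f ^^ i) v)"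
    by (rule pev_bound) (simp add: degree_pCons_le)
  then show ?thesis
    unfolding sum.atMost_Suc_shift pev_def
    by (simp add: lin_sum[OF assms] lin_scale[OF assms] coeff_pCons)
qed

lemma pev_1 [simp]: "pev f 1 v = v"
  by (simp add: pev_def)

lemma pev_diff: "pev f (P - Q) v = pev f P v - pev f Q v"
  using pev_add[of f "P - Q" Q] by simp

lemma pev_sum: "pev f (\<Sum>i\<in>I. P i) v = (\<Sum>i\<in>I. pev f (P i) v)"
  by (induction I rule: infinite_finite_induct) (auto simp: pev_add)

lemma pev_mult:
  assumes "endo scale f"
  shows "pev f (P * Q) v = pev f P (pev f Q v)"
proof (induction P)
  case (pCons a P)
  then show ?case by (simp add: pev_pCons[OF assms] pev_add pev_smult)
qed simp

lemma pev_linear: "endo scale f \<Longrightarrow> pev f [:- a, 1:] v = f v - a \<star> v"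
  by (simp add: pev_pCons lin_zero)

lemma pev_linear_power:
  assumes "endo scale f"
  shows "pev f ([:- a, 1:] ^ n) v = ((\<lambda>v. f v - a \<star> v) ^^ n) v"
  by (induction n) (simp_all only: power_0 power_Suc pev_1 pev_mult[OF assms] pev_linear[OF assms]
    funpow.simps id_apply o_apply)

lemma pev_monom: "endo scale f \<Longrightarrow> pev f (monom 1 n) v = (f ^^ n) v"
  by (induction n) (simp_all add: monom_0 pev_pCons monom_Suc lin_zero)

lemma endo_pev: 
  assumes "endo scale f"
  shows "endo scale (pev f P)"
  unfolding pev_def[abs_def]
  by (rule endo_Sum, rule lin_smult, rule endo_funpow, rule assms)

lemma pev_commute:
  assumes "endo scale g" "\<And>v. f (g v) = g (f v)"
  shows "pev f P (g v) = g (pev f P v)"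
  by (simp add: pev_def lin_sum[OF assms(1)] lin_scale[OF assms(1)] funpow_commute[of f g] assms(2))

lemma pev_pev_commute:
  assumes "endo scale f"
  shows "pev f P (pev f Q v) = pev f Q (pev f P v)"
  by (metis assms mult.commute pev_mult)

lemma pev_eigen:
  assumes "endo scale f" "f v = a \<star> v"
  shows "pev f P v = poly P a \<star> v"
  by (induction P)
    (simp_all add: pev_pCons[OF assms(1)] lin_scale[OF assms(1)] assms(2) scale_left_distrib mult.commute)

lemma pev_mem:
  assumes "subspace S" "\<And>v. v \<in> S \<Longrightarrow> f v \<in> S" "v \<in> S"
  shows "pev f P v \<in> S"
proof -
  have "(f ^^ i) v \<in> S" for i by (induction i) (use assms in auto)
  then show ?thesis unfolding pev_def using assms(1) by (intro subspace_sum subspace_scale)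
qed

end

lemma funpow_last_nonzero:
  assumes "(h ^^ n) y = 0" "y \<noteq> 0"
  obtains k where "(h ^^ k) y \<noteq> 0" "h ((h ^^ k) y) = 0"
proof -
  define m where "m = (LEAST n. (h ^^ n) y = 0)"
  have m: "(h ^^ m) y = 0" unfolding m_def by (rule LeastI) (rule assms(1))
  then obtain k where k: "m = Suc k" using assms(2) by (cases m) auto
  then have "(h ^^ k) y \<noteq> 0" using not_less_Least[of k "\<lambda>n. (h ^^ n) y = 0"] m_def by auto
  with m k that show ?thesis by simp
qed

section \<open>Annihilating polynomials\<close>

context fd_space
begin

lemma annihilator_at:
  assumes f: "endo scale f"
  obtains P where "P \<noteq> 0" "pev f P v = 0"
proof -
  define B where "B k = (\<lambda>i. (f ^^ i) v) ` {..<k}" for k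
  have "\<exists>k. (f ^^ k) v \<in> span (B k)"
  proof (rule ccontr)
    assume *: "\<not> ?thesis"
    have "independent (B k) \<and> card (B k) = k" for k
    proof (induction k)
      case (Suc k)
      have "B (Suc k) = insert ((f ^^ k) v) (B k)" by (auto simp: B_def lessThan_Suc)
      moreover have "(f ^^ k) v \<notin> B k" using * span_base by blast
      ultimately show ?case using Suc * by (simp add: independent_insertI B_def)
    qed (simp add: B_def independent_empty)
    from this[of "Suc dimension"] show False
      using independent_card_le_dim[of "B (Suc dimension)" UNIV] dim_UNIV
      by (simp add: dimension_def)
  qed
  then obtain k where k: "(f ^^ k) v \<in> span (B k)" by blast
  \<comment> \<open>A description of the span of \<open>B k\<close> by polynomials of degree below
    \<open>k\<close>.\<close>
  define S where "S = {pev f P v | P. \<forall>i\<ge>k. coeff P i = 0}"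
  have "subspace S"
    unfolding subspace_def
  proof (intro conjI ballI allI)
    show "0 \<in> S" unfolding S_def by (rule CollectI, rule exI[of _ 0]) simp
    show "x + y \<in> S" if "x \<in> S" "y \<in> S" for x y
    proof -
      from that obtain P Q where "x = pev f P v" "y = pev f Q v"
        "\<forall>i\<ge>k. coeff P i = 0" "\<forall>i\<ge>k. coeff Q i = 0" by (auto simp: S_def)
      then show ?thesis unfolding S_def by (intro CollectI exI[of _ "P + Q"]) (simp add: pev_add)
    qed
    show "c \<star> x \<in> S" if "x \<in> S" for x c
    proof -
      from that obtain P where "x = pev f P v" "\<forall>i\<ge>k. coeff P i = 0" by (auto simp: S_def)
      then show ?thesis unfolding S_def by (intro CollectI exI[of _ "smult c P"]) (simp add: pev_smult)
    qed
  qed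
  moreover have "B k \<subseteq> S"
    unfolding B_def S_def
    by (auto simp: pev_monom[OF f, symmetric] intro!: exI[of _ "monom 1 _"])
  ultimately have "(f ^^ k) v \<in> S" using k span_minimal by blast
  then obtain P where P: "(f ^^ k) v = pev f P v" "\<forall>i\<ge>k. coeff P i = 0" by (auto simp: S_def)
  show ?thesis
  proof (rule that)
    have "coeff (monom 1 k - P) k = 1" using P(2) by simp
    then show "monom 1 k - P \<noteq> 0" by auto
    show "pev f (monom 1 k - P) v = 0" using P(1) by (simp add: pev_diff pev_monom[OF f])
  qed
qed

text \<open>Polynomials in \<open>f\<close> commute, so the product of annihilators of the basis
  vectors annihilates all of them.\<close>

lemma annihilator:
  assumes f: "endo scale f"
  obtains P where "P \<noteq> 0" "\<And>v. pev f P v = 0"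
proof -
  have "\<forall>b. \<exists>P. P \<noteq> 0 \<and> pev f P b = 0" using annihilator_at[OF f] by metis
  then obtain P where P: "\<And>b. P b \<noteq> 0" "\<And>b. pev f (P b) b = 0" by metis
  define Q where "Q = (\<Prod>b\<in>basis. P b)"
  have "pev f Q b = 0" if "b \<in> basis" for b
  proof -
    have "Q = (\<Prod>b\<in>basis - {b}. P b) * P b"
      unfolding Q_def using that basis(1) by (simp add: prod.remove mult.commute)
    then show ?thesis using P(2) by (simp add: pev_mult[OF f] lin_zero[OF endo_pev[OF f]])
  qed
  then have "pev f Q v = 0" for v
    using endo_crd_sum[OF endo_pev[OF f, of Q], of v] by simp
  moreover have "Q \<noteq> 0" unfolding Q_def using P(1) basis(1) by simp
  ultimately show ?thesis using that by blast
qed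

end

section \<open>Eigenvectors, diagonalizable maps and eigenprojections\<close>

locale alg_fd_space = fd_space scale
  for scale :: "'a::{alg_closed_field, field_char_0} \<Rightarrow> 'b::ab_group_add \<Rightarrow> 'b" (infixr \<open>\<star>\<close> 75)
begin

text \<open>Take \<open>P'\<close> of least degree among the nonzero polynomials with
  \<open>P'(f) v\<close> in \<open>S\<close>; splitting off a linear factor leaves an eigenvector
  modulo \<open>S\<close>. That it is a polynomial in \<open>f\<close> applied to \<open>v\<close>
  keeps it in every \<open>f\<close>-stable subspace containing \<open>v\<close>, and in every
  eigenspace containing \<open>v\<close> of an operator commuting with \<open>f\<close>.\<close>

lemma eigenvector_mod_subspace:
  assumes f: "endo scale f" and S: "subspace S" "v \<notin> S"
  obtains Q a where "pev f Q v \<notin> S" "f (pev f Q v) - a \<star> pev f Q v \<in> S"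
proof -
  obtain P where P: "P \<noteq> 0 \<and> pev f P v \<in> S"
    using annihilator[OF f] subspace_0[OF S(1)] by metis
  define P' where "P' = (ARG_MIN degree P. P \<noteq> 0 \<and> pev f P v \<in> S)"
  have P': "P' \<noteq> 0" "pev f P' v \<in> S"
    and min: "\<And>Q. Q \<noteq> 0 \<Longrightarrow> pev f Q v \<in> S \<Longrightarrow> degree P' \<le> degree Q"
    using arg_min_natI[of "\<lambda>P. P \<noteq> 0 \<and> pev f P v \<in> S", OF P, where m = degree]
      arg_min_nat_le[of "\<lambda>P. P \<noteq> 0 \<and> pev f P v \<in> S" _ degree]
    unfolding P'_def by blast+
  have "degree P' > 0"
  proof (rule ccontr)
    assume "\<not> ?thesis"
    then obtain c where c: "P' = [:c:]" using degree_eq_zeroE by blast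
    then have "c \<noteq> 0" "c \<star> v \<in> S" using P' by (auto simp: pev_pCons[OF f] lin_zero[OF f])
    then have "inverse c \<star> c \<star> v \<in> S" using S(1) subspace_scale by blast
    then show False using S(2) \<open>c \<noteq> 0\<close> by simp
  qed
  then obtain a where "poly P' a = 0"
    using alg_closed_imp_poly_has_root by blast
  then obtain Q where Q: "P' = [:- a, 1:] * Q" by (auto simp: poly_eq_0_iff_dvd)
  have "Q \<noteq> 0" using Q P' by auto
  then have "degree P' = Suc (degree Q)" unfolding Q by (subst degree_mult_eq) auto
  then have "pev f Q v \<notin> S" using min \<open>Q \<noteq> 0\<close> by fastforce
  moreover have "f (pev f Q v) - a \<star> pev f Q v \<in> S"
    using P'(2) unfolding Q by (simp only: pev_mult[OF f] pev_linear[OF f])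
  ultimately show ?thesis by (rule that)
qed

lemma eigenvector_in_subspace:
  assumes f: "endo scale f" and S: "subspace S" "\<And>v. v \<in> S \<Longrightarrow> f v \<in> S" and v: "v \<in> S" "v \<noteq> 0"
  obtains w a where "w \<in> S" "w \<noteq> 0" "f w = a \<star> w"
proof -
  obtain Q a where "pev f Q v \<noteq> 0" "f (pev f Q v) - a \<star> pev f Q v = 0"
    using eigenvector_mod_subspace[OF f subspace_single_0, of v] v by auto
  then show ?thesis using that pev_mem[of S f, OF S v(1)] by auto
qed

text \<open>Since \<open>A\<close> is a set, the annihilating product has no repeated
  factors.\<close>

definition diagonalizable :: "('b \<Rightarrow> 'b) \<Rightarrow> bool" where
  "diagonalizable s \<longleftrightarrow> endo scale s \<and>
     (\<exists>A. finite A \<and> (\<forall>v. pev s (\<Prod>a\<in>A. [:- a, 1:]) v = 0))"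

lemma diagonalizable_endo: "diagonalizable s \<Longrightarrow> endo scale s"
  by (simp add: diagonalizable_def)

lemma diagonalizableI:
  assumes s: "endo scale s" and A: "finite A" "span {w. \<exists>a\<in>A. s w = a \<star> w} = UNIV"
  shows "diagonalizable s"
proof -
  define P where "P = (\<Prod>a\<in>A. [:- a, 1:])"
  have "{w. \<exists>a\<in>A. s w = a \<star> w} \<subseteq> {v. pev s P v = 0}"
  proof clarify
    fix w a assume "a \<in> A" "s w = a \<star> w"
    moreover have "poly P a = 0" using A(1) \<open>a \<in> A\<close> by (auto simp: P_def poly_prod)
    ultimately show "pev s P w = 0" using pev_eigen[OF s, of w a P] by simp
  qed
  moreover have "subspace {v. pev s P v = 0}"
    using subspace_eigen[OF endo_pev[OF s], of P 0] by simp
  ultimately have "pev s P v = 0" for v using span_minimal A(2) by blast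
  then show ?thesis using s A(1) unfolding diagonalizable_def P_def by blast
qed

text \<open>Eigenprojections are chosen as polynomials in \<open>s\<close>: they then commute with
  whatever commutes with \<open>s\<close>, preserve every \<open>s\<close>-stable subspace, and
  expand into powers of \<open>s\<close> under traces. If \<open>a\<close> is not an eigenvalue, the
  projection is zero.\<close>

definition eigenpoly :: "('b \<Rightarrow> 'b) \<Rightarrow> 'a \<Rightarrow> 'a poly" where
  "eigenpoly s a = (SOME P. \<forall>v. s (pev s P v) = a \<star> pev s P v \<and>
     (s v = a \<star> v \<longrightarrow> pev s P v = v) \<and> (\<forall>b. b \<noteq> a \<and> s v = b \<star> v \<longrightarrow> pev s P v = 0))"

definition eigenproj :: "('b \<Rightarrow> 'b) \<Rightarrow> 'a \<Rightarrow> 'b \<Rightarrow> 'b" where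
  "eigenproj s a = pev s (eigenpoly s a)"

lemma eigenpoly:
  assumes "diagonalizable s"
  shows "\<forall>v. s (eigenproj s a v) = a \<star> eigenproj s a v \<and>
     (s v = a \<star> v \<longrightarrow> eigenproj s a v = v) \<and>
     (\<forall>b. b \<noteq> a \<and> s v = b \<star> v \<longrightarrow> eigenproj s a v = 0)"
proof -
  note s = diagonalizable_endo[OF assms]
  obtain A0 where A0: "finite A0" "\<And>v. pev s (\<Prod>a\<in>A0. [:- a, 1:]) v = 0"
    using assms by (auto simp: diagonalizable_def)
  have ann0: "pev s R v = 0" if d: "(\<Prod>a\<in>A0. [:- a, 1:]) dvd R" for R v
  proof -
    obtain T where "R = (\<Prod>a\<in>A0. [:- a, 1:]) * T" using d by (auto elim: dvdE)
    then show ?thesis by (simp only: pev_mult[OF s] A0(2))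
  qed
  \<comment> \<open>The node \<open>a\<close> is added so that the value 1 can be prescribed there
    even when \<open>a\<close> is not among the roots.\<close>
  define A where "A = insert a A0"
  have A: "finite A" "a \<in> A" using A0(1) by (auto simp: A_def)
  have "(\<Prod>a\<in>A0. [:- a, 1:]) dvd (\<Prod>a\<in>A. [:- a, 1:])"
    using A by (intro prod_dvd_prod_subset) (auto simp: A_def)
  then have ann: "pev s R v = 0" if "(\<Prod>a\<in>A. [:- a, 1:]) dvd R" for R v
    by (rule ann0[OF dvd_trans[OF _ that]])
  obtain P where P: "\<And>b. b \<in> A \<Longrightarrow> poly P b = (if b = a then 1 else 0)"
    using poly_interpolation[OF A(1), of "\<lambda>b. if b = a then 1 else 0"] by blast
  have "\<forall>v. s (pev s P v) = a \<star> pev s P v \<and>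
     (s v = a \<star> v \<longrightarrow> pev s P v = v) \<and> (\<forall>b. b \<noteq> a \<and> s v = b \<star> v \<longrightarrow> pev s P v = 0)"
  proof (intro allI conjI impI)
    fix v
    have "pev s ([:- a, 1:] * P) v = 0"
      by (rule ann, rule prod_linear_dvd) (use A P in auto)
    then show "s (pev s P v) = a \<star> pev s P v" by (simp only: pev_mult[OF s] pev_linear[OF s]) simp
    show "pev s P v = v" if "s v = a \<star> v" using pev_eigen[OF s that] P[OF A(2)] by simp
    show "pev s P v = 0" if "b \<noteq> a \<and> s v = b \<star> v" for b
    proof (cases "v = 0")
      case False
      have "poly (\<Prod>a\<in>A. [:- a, 1:]) b \<star> v = 0"
        using ann[of "\<Prod>a\<in>A. [:- a, 1:]" v] pev_eigen[OF s, of v b] that by simp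
      then have "b \<in> A" using False A(1) by (auto simp: poly_prod)
      then show ?thesis using pev_eigen[OF s, of v b] P that by simp
    qed (simp add: lin_zero[OF endo_pev[OF s]])
  qed
  then show ?thesis unfolding eigenproj_def eigenpoly_def
    by (rule someI[of _ P])
qed

lemma eigenproj_eigen: "diagonalizable s \<Longrightarrow> s (eigenproj s a v) = a \<star> eigenproj s a v"
  and eigenproj_id: "diagonalizable s \<Longrightarrow> s v = a \<star> v \<Longrightarrow> eigenproj s a v = v"
  and eigenproj_other: "diagonalizable s \<Longrightarrow> s v = b \<star> v \<Longrightarrow> b \<noteq> a \<Longrightarrow> eigenproj s a v = 0"
  using eigenpoly by blast+

lemma eigenproj_idem: "diagonalizable s \<Longrightarrow> eigenproj s a (eigenproj s a v) = eigenproj s a v"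
  by (simp add: eigenproj_id eigenproj_eigen)

lemma endo_eigenproj: "diagonalizable s \<Longrightarrow> endo scale (eigenproj s a)"
  by (simp add: eigenproj_def endo_pev diagonalizable_endo)

lemma eigenproj_commute:
  "endo scale g \<Longrightarrow> (\<And>v. s (g v) = g (s v)) \<Longrightarrow> eigenproj s a (g v) = g (eigenproj s a v)"
  unfolding eigenproj_def by (rule pev_commute)

lemma eigenproj_mem:
  "subspace S \<Longrightarrow> (\<And>v. v \<in> S \<Longrightarrow> s v \<in> S) \<Longrightarrow> v \<in> S \<Longrightarrow> eigenproj s a v \<in> S"
  unfolding eigenproj_def by (rule pev_mem)

text \<open>The interpolating polynomials add up to 1 on \<open>A\<close>, so their sum minus 1 is a
  multiple of the annihilating product.\<close>

lemma eigenproj_sum: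
  assumes "diagonalizable s"
  obtains A where "finite A" "\<And>v. (\<Sum>a\<in>A. eigenproj s a v) = v"
proof -
  note s = diagonalizable_endo[OF assms]
  obtain A where A: "finite A" "\<And>v. pev s (\<Prod>a\<in>A. [:- a, 1:]) v = 0"
    using assms by (auto simp: diagonalizable_def)
  have "\<exists>P. \<forall>b\<in>A. poly P b = (if b = a then 1 else 0)" for a
    using poly_interpolation[OF A(1), of "\<lambda>b. if b = a then 1 else 0"] by metis
  then obtain P where P: "\<And>a b. b \<in> A \<Longrightarrow> poly (P a) b = (if b = a then 1 else 0)" by metis
  have ann: "pev s R v = 0" if d: "(\<Prod>a\<in>A. [:- a, 1:]) dvd R" for R v
  proof -
    obtain T where "R = (\<Prod>a\<in>A. [:- a, 1:]) * T" using d by (auto elim: dvdE)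
    then show ?thesis by (simp only: pev_mult[OF s] A(2))
  qed
  have dec: "v = (\<Sum>a\<in>A. pev s (P a) v)" for v
  proof -
    have "pev s ((\<Sum>a\<in>A. P a) - 1) v = 0"
      by (rule ann, rule prod_linear_dvd) (use A P in \<open>auto simp: poly_sum\<close>)
    then show ?thesis by (simp add: pev_diff pev_sum)
  qed
  have eig: "s (pev s (P a) v) = a \<star> pev s (P a) v" if "a \<in> A" for a v
  proof -
    have "pev s ([:- a, 1:] * P a) v = 0"
      by (rule ann, rule prod_linear_dvd) (use A P in auto)
    then show ?thesis by (simp only: pev_mult[OF s] pev_linear[OF s]) simp
  qed
  have "eigenproj s a v = pev s (P a) v" if "a \<in> A" for a v
  proof -
    have "eigenproj s a v = (\<Sum>b\<in>A. eigenproj s a (pev s (P b) v))"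
      by (subst dec[of v]) (rule lin_sum[OF endo_eigenproj[OF assms]])
    also have "\<dots> = (\<Sum>b\<in>A. if b = a then pev s (P b) v else 0)"
      by (rule sum.cong) (auto intro: eigenproj_id[OF assms] eigenproj_other[OF assms] eig)
    finally show ?thesis using that A(1) by simp
  qed
  then have "(\<Sum>a\<in>A. eigenproj s a v) = v" for v using dec[of v] by simp
  then show ?thesis using that A(1) by blast
qed

lemma diagonalizable_ext:
  assumes "diagonalizable s" "Vector_Spaces.linear scale scale2 f" "Vector_Spaces.linear scale scale2 g"
    "\<And>a v. s v = a \<star> v \<Longrightarrow> f v = g v"
  shows "f v = g v"
proof -
  obtain A where A: "finite A" "\<And>v. (\<Sum>a\<in>A. eigenproj s a v) = v"
    using eigenproj_sum[OF assms(1)] by blast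
  have "f v = (\<Sum>a\<in>A. f (eigenproj s a v))" by (subst A(2)[of v, symmetric]) (rule lin_sum[OF assms(2)])
  also have "\<dots> = (\<Sum>a\<in>A. g (eigenproj s a v))"
    by (intro sum.cong refl assms(4)[OF eigenproj_eigen[OF assms(1)]])
  also have "\<dots> = g v" by (subst (2) A(2)[of v, symmetric]) (rule lin_sum[OF assms(3), symmetric])
  finally show ?thesis .
qed

text \<open>\<open>g\<close> carries the \<open>b\<close>-eigenspace to the
  \<open>c * b\<close>-eigenspace, and \<open>c \<noteq> 0\<close> keeps distinct eigenvalues
  distinct. This is applied to \<open>N\<close>, which multiplies the eigenvalues of a power of
  Frobenius by a fixed power of 1/q.\<close>

lemma eigenproj_twist:
  assumes s: "diagonalizable s" and g: "endo scale g" "\<And>v. s (g v) = c \<star> g (s v)" and "c \<noteq> 0"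
  shows "eigenproj s (c * a) (g v) = g (eigenproj s a v)"
proof (rule diagonalizable_ext[OF s, where f = "\<lambda>v. eigenproj s (c * a) (g v)"
      and g = "\<lambda>v. g (eigenproj s a v)"])
  show "Vector_Spaces.linear scale scale (\<lambda>v. eigenproj s (c * a) (g v))"
    by (rule lin_comp[OF g(1) endo_eigenproj[OF s]])
  show "Vector_Spaces.linear scale scale (\<lambda>v. g (eigenproj s a v))"
    by (rule lin_comp[OF endo_eigenproj[OF s] g(1)])
  fix b v assume v: "s v = b \<star> v"
  then have "s (g v) = (c * b) \<star> g v" by (simp add: g(2) lin_scale[OF g(1)])
  then show "eigenproj s (c * a) (g v) = g (eigenproj s a v)"
    using eigenproj_id[OF s v] eigenproj_id[OF s, of "g v" "c * b"]
      eigenproj_other[OF s v, of a] eigenproj_other[OF s, of "g v" "c * b" "c * a"] \<open>c \<noteq> 0\<close>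
    by (cases "b = a") (auto simp: lin_zero[OF g(1)])
qed

lemma diagonalizable_imp_semisimple:
  assumes "diagonalizable s"
  shows "semisimple_map scale s"
  unfolding semisimple_map_def
proof (intro allI impI, elim conjE)
  fix S assume S: "subspace S" "s ` S \<subseteq> S"
  note s = diagonalizable_endo[OF assms]
  obtain A where A: "finite A" "\<And>v. (\<Sum>a\<in>A. eigenproj s a v) = v"
    using eigenproj_sum[OF assms] by blast
  obtain p where p: "endo scale p" "\<And>v. p v \<in> S" "\<And>v. v \<in> S \<Longrightarrow> p v = v"
    using projection_exists[OF S(1)] by blast
  have mem: "eigenproj s a v \<in> S" if "v \<in> S" for a v
    by (rule eigenproj_mem) (use S that in auto)
  \<comment> \<open>Keeping only the blocks of \<open>p\<close> between equal eigenspaces makes it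
    commute with \<open>s\<close>; the kernel of the result is the stable complement.\<close>
  define q where "q v = (\<Sum>a\<in>A. eigenproj s a (p (eigenproj s a v)))" for v
  have q: "endo scale q" unfolding q_def[abs_def]
    by (intro endo_Sum) (rule lin_comp[OF lin_comp[OF endo_eigenproj[OF assms] p(1)] endo_eigenproj[OF assms]])
  have qS: "q v \<in> S" for v unfolding q_def by (intro subspace_sum S(1) mem p(2))
  have qid: "q v = v" if "v \<in> S" for v
    unfolding q_def using that by (simp add: p(3) mem eigenproj_idem[OF assms] A(2))
  have qs: "q (s v) = s (q v)" for v
  proof -
    have "eigenproj s a (s v) = s (eigenproj s a v)" for a v
      by (rule eigenproj_commute[OF s]) simp
    then show ?thesis
      by (simp add: q_def lin_sum[OF s] eigenproj_eigen[OF assms] lin_scale[OF p(1)]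
          lin_scale[OF endo_eigenproj[OF assms]])
  qed
  let ?S' = "{v. q v = 0}"
  have "subspace ?S'" using subspace_eigen[OF q, of 0] by simp
  moreover have "s ` ?S' \<subseteq> ?S'" by (auto simp: qs lin_zero[OF s])
  moreover have "S \<inter> ?S' = {0}" using qid S(1) by (auto simp: subspace_0 lin_zero[OF q])
  moreover have "{x + y | x y. x \<in> S \<and> y \<in> ?S'} = UNIV"
  proof -
    have "v = q v + (v - q v)" "q v \<in> S" "v - q v \<in> ?S'" for v
      using qS qid by (auto simp: lin_diff[OF q])
    then show ?thesis by blast
  qed
  ultimately show "\<exists>S'. subspace S' \<and> s ` S' \<subseteq> S' \<and> S \<inter> S' = {0} \<and>
      {x + y | x y. x \<in> S \<and> y \<in> S'} = UNIV" by blast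
qed

text \<open>A stable complement of the span of all eigenvectors would, if nonzero, contain a further
  eigenvector. With the converse above, this translates semisimplicity by complements into a
  condition on polynomials.\<close>

lemma semisimple_imp_diagonalizable:
  assumes s: "endo scale s" and "semisimple_map scale s"
  shows "diagonalizable s"
proof -
  obtain P where P: "P \<noteq> 0" "\<And>v. pev s P v = 0" using annihilator[OF s] by blast
  define A where "A = {a. poly P a = 0}"
  have A: "finite A" unfolding A_def using P(1) by (rule poly_roots_finite)
  have root: "a \<in> A" if "s w = a \<star> w" "w \<noteq> 0" for a w
    using P(2)[of w] pev_eigen[OF s that(1), of P] that(2) by (simp add: A_def)
  define S where "S = span {w. \<exists>a\<in>A. s w = a \<star> w}"
  have "s ` S \<subseteq> S"
  proof -
    have "S \<subseteq> {v. s v \<in> S}" unfolding S_def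
    proof (rule span_minimal)
      show "{w. \<exists>a\<in>A. s w = a \<star> w} \<subseteq> {v. s v \<in> span {w. \<exists>a\<in>A. s w = a \<star> w}}"
        by clarsimp (rule span_scale, rule span_base, blast)
      show "subspace {v. s v \<in> span {w. \<exists>a\<in>A. s w = a \<star> w}}"
        using subspace_span[of "{w. \<exists>a\<in>A. s w = a \<star> w}"]
        by (simp add: subspace_def lin_zero[OF s] lin_add[OF s] lin_scale[OF s])
    qed
    then show ?thesis by auto
  qed
  then obtain S' where S': "subspace S'" "s ` S' \<subseteq> S'" "S \<inter> S' = {0}"
    "{x + y | x y. x \<in> S \<and> y \<in> S'} = UNIV"
    using assms(2)[unfolded semisimple_map_def, rule_format, of S] by (auto simp: S_def)
  have "S' \<subseteq> {0}"
  proof (rule ccontr)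
    assume "\<not> ?thesis"
    then obtain v where "v \<in> S'" "v \<noteq> 0" by blast
    then obtain w a where w: "w \<in> S'" "w \<noteq> 0" "s w = a \<star> w"
      using eigenvector_in_subspace[OF s S'(1), of v] S'(2) by blast
    then have "w \<in> S" unfolding S_def using root by (intro span_base) blast
    then show False using w S'(3) by blast
  qed
  then have "S = UNIV" using S'(4) by force
  then show ?thesis using diagonalizableI[OF s A] unfolding S_def by blast
qed

end

section \<open>The multiplicative Jordan decomposition\<close>

context fd_space
begin

lemma unipotent_iff_pev:
  assumes "endo scale u"
  shows "unipotent_map u \<longleftrightarrow> (\<exists>n. \<forall>v. pev u ([:- 1, 1:] ^ n) v = 0)"
  unfolding unipotent_map_def nilpotent_map_def pev_linear_power[OF assms] by simp

lemma unipotent_injective: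
  assumes "endo scale u" "unipotent_map u" "u v = 0"
  shows "v = 0"
proof -
  obtain n where n: "\<And>v. pev u ([:- 1, 1:] ^ n) v = 0"
    using assms unipotent_iff_pev by blast
  have "u v = 0 \<star> v" using assms by simp
  then have "poly ([:- 1, 1:] ^ n) 0 \<star> v = 0" using n pev_eigen[OF assms(1)] by metis
  then show ?thesis by (auto simp: poly_power)
qed

lemma pev_funpow:
  assumes "endo scale f"
  shows "pev (f ^^ m) P v = pev f (P \<circ>\<^sub>p monom 1 m) v"
  by (induction P)
    (simp_all add: pcompose_pCons pev_pCons endo_funpow assms pev_add pev_mult pev_monom lin_zero[OF assms])

text \<open>\<open>x - 1\<close> divides \<open>x ^ m - 1\<close>, so the \<open>n\<close>-th power
  of \<open>u ^^ m - 1\<close> contains that of \<open>u - 1\<close> as a factor.\<close>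

lemma unipotent_funpow:
  assumes "endo scale u" "unipotent_map u"
  shows "unipotent_map (u ^^ m)"
proof -
  obtain n where n: "\<And>v. pev u ([:- 1, 1:] ^ n) v = 0"
    using assms unipotent_iff_pev by blast
  have "poly (monom 1 m - 1 :: 'a poly) 1 = 0" by (simp add: poly_monom)
  then obtain Q where Q: "monom 1 m - 1 = [:- 1, 1:] * (Q :: 'a poly)"
    unfolding poly_eq_0_iff_dvd by (rule dvdE)
  have "[:- 1, 1 :: 'a:] ^ n \<circ>\<^sub>p monom 1 m = ([:- 1, 1:] \<circ>\<^sub>p monom 1 m) ^ n"
    by (induction n) (simp_all only: power_0 power_Suc pcompose_mult pcompose_1)
  also have "[:- 1, 1 :: 'a:] \<circ>\<^sub>p monom 1 m = monom 1 m - 1"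
    by (simp add: pcompose_pCons one_pCons)
  finally have "[:- 1, 1 :: 'a:] ^ n \<circ>\<^sub>p monom 1 m = [:- 1, 1:] ^ n * Q ^ n"
    unfolding Q by (simp only: power_mult_distrib)
  then have "pev (u ^^ m) ([:- 1, 1:] ^ n) v = 0" for v
    by (simp only: pev_funpow[OF assms(1)] pev_mult[OF assms(1)] n)
  then show ?thesis using unipotent_iff_pev[OF endo_funpow[OF assms(1)]] by blast
qed

text \<open>The operator \<open>X \<mapsto> u X - X u\<close> is nilpotent; were its last nonzero iterate \<open>Z\<close> on \<open>X\<close> of
  positive order, the iterate \<open>Y\<close> before it would satisfy \<open>u\<^sup>m Y = Y u\<^sup>m + m u\<^sup>m\<^sup>-\<^sup>1 Z\<close>.\<close>

lemma unipotent_commute_root: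
  assumes u: "endo scale u" "unipotent_map u" and X: "endo scale X"
    and "m > 0" and comm: "\<And>v. (u ^^ m) (X v) = X ((u ^^ m) v)"
  shows "u (X v) = X (u v)"
proof -
  define D where "D = (\<lambda>Y v. u (Y v) - Y (u v))"
  define x where "x v = u v - v" for v
  obtain n where n: "\<And>v. (x ^^ n) v = 0"
    using u(2) unfolding unipotent_map_def nilpotent_map_def x_def[abs_def] by blast
  have x: "endo scale x" unfolding x_def[abs_def] by (rule lin_minus[OF u(1) endo_id])
  have endoD: "endo scale ((D ^^ k) X)" for k
    by (induction k) (auto simp: D_def X intro!: lin_minus lin_comp[OF u(1)] lin_comp[OF _ u(1)])
  have xn: "(x ^^ i) v = 0" if "i \<ge> n" for i v
  proof -
    have "(x ^^ i) v = (x ^^ (i - n)) ((x ^^ n) v)"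
      using that by (simp flip: funpow_add[THEN fun_cong, unfolded o_apply])
    then show ?thesis by (simp add: n lin_zero[OF endo_funpow[OF x]])
  qed
  have Dx: "D Y v = x (Y v) - Y (x v)" if "endo scale Y" for Y v
    by (simp add: D_def x_def lin_diff[OF that])
  \<comment> \<open>\<open>D\<close> is left minus right multiplication by \<open>x\<close>, so each
    application adds one \<open>x\<close> on one side of \<open>X\<close>. With \<open>2 * n\<close>
    of them in total, one side carries at least \<open>n\<close>.\<close>
  have nil: "(x ^^ i) ((D ^^ k) X ((x ^^ j) v)) = 0" if "i + j + k \<ge> 2 * n" for i j k v
    using that
  proof (induction k arbitrary: i j v)
    case 0
    then have "i \<ge> n \<or> j \<ge> n" by linarith
    then show ?case by (auto simp: xn lin_zero[OF X] lin_zero[OF endo_funpow[OF x]])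
  next
    case (Suc k)
    have "(x ^^ i) ((D ^^ Suc k) X ((x ^^ j) v)) =
      (x ^^ Suc i) ((D ^^ k) X ((x ^^ j) v)) - (x ^^ i) ((D ^^ k) X ((x ^^ Suc j) v))"
      using Dx[OF endoD[of k]]
      by (simp add: lin_diff[OF endo_funpow[OF x]] funpow_swap1)
    then show ?case using Suc.IH[of "Suc i" j v] Suc.IH[of i "Suc j" v] Suc.prems by simp
  qed
  have "(D ^^ (2 * n)) X v = 0" for v using nil[of 0 0 "2 * n" v] by simp
  then have ex: "\<exists>k. \<forall>v. (D ^^ k) X v = 0" by blast
  define k where "k = (LEAST k. \<forall>v. (D ^^ k) X v = 0)"
  have k: "\<And>v. (D ^^ k) X v = 0" unfolding k_def using LeastI_ex[OF ex] by blast
  have commD: "(u ^^ m) ((D ^^ j) X v) = (D ^^ j) X ((u ^^ m) v)" for j v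
  proof (induction j arbitrary: v)
    case (Suc j)
    have "(u ^^ m) (u v) = u ((u ^^ m) v)" for v by (simp add: funpow_swap1)
    then show ?case by (simp add: D_def lin_diff[OF endo_funpow[OF u(1)]] Suc[unfolded D_def])
  qed (simp add: comm)
  show ?thesis
  proof (cases "k \<le> 1")
    case True
    then have "D X v = 0" using k by (cases k) (auto simp: D_def lin_zero[OF u(1)])
    then show ?thesis by (simp add: D_def)
  next
    case False
    then obtain j where j: "k = Suc (Suc j)" by (metis One_nat_def not_less_eq_eq Suc_diff_Suc diff_Suc_1 less_Suc_eq_le nat.exhaust le0)
    define Y where "Y = (D ^^ j) X"
    define Z where "Z = (D ^^ Suc j) X"
    have YZ: "u (Y v) = Y (u v) + Z v" for v by (simp add: Y_def Z_def D_def)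
    have Zu: "u (Z v) = Z (u v)" for v using k[of v] by (simp add: j Z_def D_def)
    have Zui: "(u ^^ i) (Z v) = Z ((u ^^ i) v)" for i v
      by (rule funpow_commute) (rule Zu)
    have "(u ^^ Suc i) (Y v) = Y ((u ^^ Suc i) v) + of_nat (Suc i) \<star> (u ^^ i) (Z v)" for i v
    proof (induction i)
      case (Suc i)
      have "(u ^^ Suc (Suc i)) (Y v) = u (Y ((u ^^ Suc i) v)) + of_nat (Suc i) \<star> u ((u ^^ i) (Z v))"
        using Suc by (simp add: lin_add[OF u(1)] lin_scale[OF u(1)])
      moreover have "of_nat (Suc (Suc i)) = 1 + (of_nat (Suc i) :: 'a)" by simp
      ultimately show ?case unfolding YZ using Zui[of "Suc i" v]
        by (simp only: scale_left_distrib add.assoc scale_one funpow.simps o_apply)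
    qed (simp add: YZ)
    \<comment> \<open>As \<open>u ^^ m\<close> commutes with \<open>Y\<close>, the extra term with
      coefficient \<open>m\<close> vanishes; \<open>m\<close> is invertible in characteristic zero,
      and \<open>u\<close> is injective.\<close>
    from this[of "m - 1"] \<open>m > 0\<close> have "(u ^^ (m - 1)) (Z v) = 0" for v
      using commD[of j v] by (simp add: Y_def)
    moreover have "w = 0" if "(u ^^ i) w = 0" for i w
      using that by (induction i) (auto dest: unipotent_injective[OF u])
    ultimately have "Z v = 0" for v by blast
    moreover have "\<not> (\<forall>v. Z v = 0)"
      using not_less_Least[of "Suc j" "\<lambda>k. \<forall>v. (D ^^ k) X v = 0"] j unfolding Z_def k_def by simp
    ultimately show ?thesis by blast
  qed
qed

end

section \<open>The decomposition into a diagonalizable and a unipotent factor\<close>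

context alg_fd_space
begin

definition jordan_decomposition :: "('b \<Rightarrow> 'b) \<Rightarrow> ('b \<Rightarrow> 'b) \<Rightarrow> ('b \<Rightarrow> 'b) \<Rightarrow> bool" where
  "jordan_decomposition f s u \<longleftrightarrow> endo scale u \<and> unipotent_map u \<and>
     diagonalizable s \<and> (\<forall>v. f v = s (u v)) \<and> (\<forall>v. s (u v) = u (s v))"

lemma jordan_decompositionD:
  assumes "jordan_decomposition f s u"
  shows "endo scale u" "unipotent_map u" "diagonalizable s" "\<And>v. f v = s (u v)"
    "\<And>v. s (u v) = u (s v)" "endo scale s" "endo scale f"
proof -
  show *: "endo scale u" "unipotent_map u" "diagonalizable s" "\<And>v. f v = s (u v)"
    "\<And>v. s (u v) = u (s v)"
    using assms by (auto simp: jordan_decomposition_def)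
  then show s: "endo scale s" by (simp add: diagonalizable_endo)
  have "f = (\<lambda>v. s (u v))" using *(4) by auto
  then show "endo scale f" using lin_comp[OF *(1) s] by simp
qed

text \<open>On this eigenspace \<open>f - a\<close> equals \<open>a * (u - 1)\<close>. Together with
  the next lemma this identifies the eigenspaces of \<open>s\<close> with the generalized
  eigenspaces of \<open>f\<close>, which determines \<open>s\<close> from \<open>f\<close> and
  yields uniqueness and all commutation statements.\<close>

lemma jordan_eigen_imp_generalized:
  assumes "jordan_decomposition f s u" and "s v = a \<star> v"
  shows "\<exists>n. ((\<lambda>v. f v - a \<star> v) ^^ n) v = 0"
proof -
  note J = jordan_decompositionD[OF assms(1)]
  define x where "x v = u v - v" for v
  obtain n where n: "\<And>v. (x ^^ n) v = 0"
    using J(2) unfolding unipotent_map_def nilpotent_map_def x_def[abs_def] by blast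
  have "((\<lambda>v. f v - a \<star> v) ^^ k) v = a ^ k \<star> (x ^^ k) v \<and> s ((x ^^ k) v) = a \<star> (x ^^ k) v" for k
  proof (induction k)
    case (Suc k)
    let ?w = "(x ^^ k) v"
    have "f w - a \<star> w = a \<star> x w \<and> s (x w) = a \<star> x w" if "s w = a \<star> w" for w
      using that by (simp add: J(4,5) x_def lin_scale[OF J(1)] lin_diff[OF J(6)] scale_right_diff_distrib)
    then have "f ?w - a \<star> ?w = a \<star> x ?w" "s (x ?w) = a \<star> x ?w" using Suc by blast+
    moreover have "f (a ^ k \<star> ?w) - a \<star> a ^ k \<star> ?w = a ^ k \<star> (f ?w - a \<star> ?w)"
      by (simp add: lin_scale[OF J(7)] scale_right_diff_distrib mult.commute)
    ultimately show ?case using Suc by (simp add: mult.commute)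
  qed (simp add: assms(2))
  from this[of n] show ?thesis by (metis n scale_zero_right)
qed

text \<open>A component of \<open>v\<close> for some \<open>b \<noteq> a\<close> would have a last
  nonzero image \<open>w\<close> under powers of \<open>f - a\<close>, with
  \<open>b * u w = a * w\<close>. Then \<open>a / b\<close> would be an eigenvalue of the unipotent
  map \<open>u\<close>, hence 1.\<close>

lemma jordan_generalized_imp_eigen:
  assumes "jordan_decomposition f s u" and gen: "((\<lambda>v. f v - a \<star> v) ^^ n) v = 0"
  shows "s v = a \<star> v"
proof -
  note J = jordan_decompositionD[OF assms(1)]
  define h where "h v = f v - a \<star> v" for v
  have sf: "s (f v) = f (s v)" for v using J(4,5) by simp
  have h: "endo scale h" unfolding h_def[abs_def]
    by (rule lin_minus[OF J(7)], rule lin_smult, rule endo_id)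
  have sh: "s (h v) = h (s v)" for v
    by (simp add: h_def lin_diff[OF J(6)] lin_scale[OF J(6)] sf)
  have zero: "eigenproj s b v = 0" if "b \<noteq> a" for b
  proof (rule ccontr)
    let ?y = "eigenproj s b v"
    assume "?y \<noteq> 0"
    have "(h ^^ n) ?y = 0"
    proof -
      have "eigenproj s b ((h ^^ n) v) = (h ^^ n) ?y"
        by (rule eigenproj_commute[OF endo_funpow[OF h]]) (rule funpow_commute[symmetric], rule sh[symmetric])
      then show ?thesis using gen by (simp add: h_def[abs_def] lin_zero[OF endo_eigenproj[OF J(3)]])
    qed
    then obtain k where k: "(h ^^ k) ?y \<noteq> 0" "h ((h ^^ k) ?y) = 0"
      using funpow_last_nonzero \<open>?y \<noteq> 0\<close> by blast
    let ?w = "(h ^^ k) ?y"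
    have sw: "s ?w = b \<star> ?w"
      using funpow_commute[of h s k ?y, OF sh[symmetric]]
      by (simp add: eigenproj_eigen[OF J(3)] lin_scale[OF endo_funpow[OF h]])
    have "b \<star> u ?w = a \<star> ?w"
      using k(2) sw by (simp add: h_def J(4,5) lin_scale[OF J(1)])
    moreover have "b \<noteq> 0" using calculation k(1) \<open>b \<noteq> a\<close> by auto
    ultimately have uw: "u ?w = (a / b) \<star> ?w"
      by (metis divide_inverse mult.commute scale_scale scale_left_imp_eq right_inverse scale_one)
    obtain m where m: "\<And>v. pev u ([:- 1, 1:] ^ m) v = 0"
      using J(1,2) unipotent_iff_pev by blast
    have "poly ([:- 1, 1:] ^ m) (a / b) \<star> ?w = 0" using m pev_eigen[OF J(1) uw] by metis
    then have "a / b = 1" using k(1) by (auto simp: poly_power)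
    then show False using \<open>b \<noteq> a\<close> \<open>b \<noteq> 0\<close> by simp
  qed
  obtain A where A: "finite A" "\<And>v. (\<Sum>a\<in>A. eigenproj s a v) = v"
    using eigenproj_sum[OF J(3)] by blast
  have "s v = (\<Sum>b\<in>A. s (eigenproj s b v))"
    by (subst A(2)[of v, symmetric]) (rule lin_sum[OF J(6)])
  also have "\<dots> = (\<Sum>b\<in>A. a \<star> eigenproj s b v)"
    by (intro sum.cong refl) (metis zero eigenproj_eigen[OF J(3)] scale_zero_right)
  also have "\<dots> = a \<star> v" by (simp flip: scale_sum_right add: A(2))
  finally show ?thesis .
qed

text \<open>\<open>X\<close> takes generalized eigenvectors of \<open>f\<close> for \<open>a\<close>
  to those for \<open>c * a\<close>. The case \<open>c = 1\<close> serves inertia, the case where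
  \<open>c\<close> is the inverse of q serves \<open>N\<close>.\<close>

lemma jordan_twisted_commute:
  assumes "jordan_decomposition f s u" and X: "endo scale X" "\<And>v. f (X v) = c \<star> X (f v)"
  shows "s (X v) = c \<star> X (s v)"
proof -
  note J = jordan_decompositionD[OF assms(1)]
  show ?thesis
  proof (rule diagonalizable_ext[OF J(3), where f = "\<lambda>v. s (X v)" and g = "\<lambda>v. c \<star> X (s v)"])
    show "endo scale (\<lambda>v. s (X v))" by (rule lin_comp[OF X(1) J(6)])
    show "endo scale (\<lambda>v. c \<star> X (s v))" by (rule lin_smult, rule lin_comp[OF J(6) X(1)])
    fix a v assume v: "s v = a \<star> v"
    then obtain n where n: "((\<lambda>v. f v - a \<star> v) ^^ n) v = 0"
      using jordan_eigen_imp_generalized[OF assms(1)] by blast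
    have "((\<lambda>v. f v - (c * a) \<star> v) ^^ k) (X v) = c ^ k \<star> X (((\<lambda>v. f v - a \<star> v) ^^ k) v)" for k
      by (induction k)
        (simp_all add: lin_scale[OF J(7)] lin_scale[OF X(1)] X(2) lin_diff[OF X(1)]
          scale_right_diff_distrib mult_ac)
    then have "((\<lambda>v. f v - (c * a) \<star> v) ^^ n) (X v) = 0"
      by (simp add: n lin_zero[OF X(1)])
    then show "s (X v) = c \<star> X (s v)"
      using jordan_generalized_imp_eigen[OF assms(1)] v by (simp add: lin_scale[OF X(1)])
  qed
qed

text \<open>The semisimple part absorbs the whole factor \<open>c\<close>, so \<open>u\<close>
  commutes with \<open>X\<close> without a twist. For \<open>X = N\<close> this is why removing the
  unipotent part of Frobenius preserves the relation between \<open>r\<close> and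
  \<open>N\<close>.\<close>

lemma jordan_twisted_commute_unipotent:
  assumes "jordan_decomposition f s u" and inj: "\<And>v. f v = 0 \<Longrightarrow> v = 0" and "c \<noteq> 0"
    and X: "endo scale X" "\<And>v. f (X v) = c \<star> X (f v)"
  shows "u (X v) = X (u v)"
proof -
  note J = jordan_decompositionD[OF assms(1)]
  note sX = jordan_twisted_commute[OF assms(1) X]
  have s0: "w = 0" if "s w = 0" for w
    using inj[of w] that by (simp add: J(4,5) lin_zero[OF J(1)])
  have "c \<star> s (u (X v) - X (u v)) = 0" 
    using X(2)[of v] by (simp add: J(4,5)[of "X v"] sX lin_diff[OF J(6)] scale_right_diff_distrib)
      (simp add: J(4) J(5)[symmetric] sX)
  then show ?thesis using s0[of "u (X v) - X (u v)"] \<open>c \<noteq> 0\<close> by simp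
qed

lemma jordan_unique:
  assumes "jordan_decomposition f s u" "jordan_decomposition f s' u'"
    and inj: "\<And>v. f v = 0 \<Longrightarrow> v = 0"
  shows "s = s'" "u = u'"
proof -
  note J = jordan_decompositionD[OF assms(1)]
  note J' = jordan_decompositionD[OF assms(2)]
  have ss: "s v = s' v" for v
  proof (rule diagonalizable_ext[OF J(3,6) J'(6)])
    fix a v assume "s v = a \<star> v"
    then show "s v = s' v"
      using jordan_eigen_imp_generalized[OF assms(1)] jordan_generalized_imp_eigen[OF assms(2)] by metis
  qed
  then show "s = s'" by blast
  have s0: "w = 0" if "s w = 0" for w
    using inj[of w] that by (simp add: J(4,5) lin_zero[OF J(1)])
  have "s (u v - u' v) = 0" for v
    using J(4)[of v] J'(4)[of v] by (simp add: lin_diff[OF J'(6)] ss)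
  then show "u = u'" using s0 by (metis ext eq_iff_diff_eq_0)
qed

lemma dvd_prod_roots_power:
  fixes P :: "'a poly"
  assumes "P \<noteq> 0"
  shows "P dvd (\<Prod>a | poly P a = 0. [:- a, 1:]) ^ degree P"
  using assms
proof (induction "degree P" arbitrary: P)
  case 0
  then obtain c where "P = [:c:]" "c \<noteq> 0" by (metis degree_eq_zeroE pCons_0_0)
  then have "P dvd 1" by (simp add: is_unit_triv)
  then show ?case using 0 by simp
next
  case (Suc n)
  then obtain a where a: "poly P a = 0" using alg_closed_imp_poly_has_root[of P] by auto
  then obtain Q where Q: "P = [:- a, 1:] * Q" by (auto simp: poly_eq_0_iff_dvd)
  have "Q \<noteq> 0" using Q Suc.prems by auto
  then have deg: "degree P = Suc (degree Q)" unfolding Q by (subst degree_mult_eq) auto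
  let ?R = "\<lambda>P. \<Prod>a | poly P a = 0. [:- a, 1:]"
  have fin: "finite {a. poly P a = 0}" using Suc.prems by (rule poly_roots_finite)
  have "?R Q dvd ?R P"
    by (rule prod_dvd_prod_subset[OF fin]) (auto simp: Q)
  moreover have "Q dvd ?R Q ^ degree Q" using Suc(1)[of Q] Suc(2) deg \<open>Q \<noteq> 0\<close> by simp
  ultimately have "Q dvd ?R P ^ degree Q" by (meson dvd_power_same dvd_trans)
  moreover have "[:- a, 1:] dvd ?R P" using fin a by (intro dvd_prodI) auto
  ultimately have "[:- a, 1:] * Q dvd ?R P * ?R P ^ degree Q" by (intro mult_dvd_mono)
  then show ?case by (simp only: deg power_Suc Q[symmetric])
qed

lemma injective_imp_bij:
  assumes "endo scale f" "\<And>v. f v = 0 \<Longrightarrow> v = 0"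
  shows "bij f"
proof -
  have "inj f" using assms(2) lin_diff[OF assms(1)] by (metis injI eq_iff_diff_eq_0)
  then show ?thesis using linear_inj_imp_surj[OF assms(1)] by (simp add: bij_def)
qed

text \<open>Chevalley's construction: \<open>s = S(f)\<close> for a polynomial \<open>S\<close>
  congruent to \<open>a\<close> modulo a high power of \<open>x - a\<close> at each nonzero root
  \<open>a\<close>, and \<open>u\<close> is the inverse of \<open>s\<close> composed with
  \<open>f\<close>. As \<open>s\<close> is a polynomial in \<open>f\<close>, both factors
  commute.\<close>

lemma jordan_exists:
  assumes f: "endo scale f" and inj: "\<And>v. f v = 0 \<Longrightarrow> v = 0"
  obtains s u where "jordan_decomposition f s u"
proof -
  obtain P where P: "P \<noteq> 0" "\<And>v. pev f P v = 0" using annihilator[OF f] by blast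
  \<comment> \<open>The root 0 is dropped: injectivity of \<open>f\<close> lets powers of
    \<open>x\<close> be cancelled from the annihilator, and without the root 0 the map
    \<open>s\<close> is invertible.\<close>
  define A where "A = {a. poly P a = 0} - {0}"
  have A: "finite A" unfolding A_def using poly_roots_finite[OF P(1)] by simp
  \<comment> \<open>The successor guarantees an exponent of at least 1, so that each
    \<open>x - a\<close> divides \<open>S - a\<close>.\<close>
  define n where "n = Suc (degree P)"
  have n: "pev f ((\<Prod>a\<in>A. [:- a, 1:]) ^ n) v = 0" for v
  proof -
    have "(\<Prod>a | poly P a = 0. [:- a, 1:]) dvd (\<Prod>a\<in>insert 0 A. [:- a, 1:])"
      using A by (intro prod_dvd_prod_subset) (auto simp: A_def)
    also have "(\<Prod>a\<in>insert 0 A. [:- a, 1:]) = [:- 0, 1:] * (\<Prod>a\<in>A. [:- a, 1:])"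
      by (rule prod.insert[OF A]) (simp add: A_def)
    finally have "(\<Prod>a | poly P a = 0. [:- a, 1:]) ^ degree P
        dvd ([:- 0, 1:] * (\<Prod>a\<in>A. [:- a, 1:])) ^ degree P"
      by (rule dvd_power_same)
    with dvd_prod_roots_power[OF P(1)]
    have "P dvd ([:- 0, 1:] * (\<Prod>a\<in>A. [:- a, 1:])) ^ degree P" by (rule dvd_trans)
    also have "\<dots> dvd ([:- 0, 1:] * (\<Prod>a\<in>A. [:- a, 1:])) ^ n"
      by (rule le_imp_power_dvd) (simp add: n_def)
    finally have "P dvd [:- 0, 1:] ^ n * (\<Prod>a\<in>A. [:- a, 1:]) ^ n"
      by (simp only: power_mult_distrib)
    then obtain T where T: "[:- 0, 1:] ^ n * (\<Prod>a\<in>A. [:- a, 1:]) ^ n = P * T" by (auto elim: dvdE)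
    have "pev f ([:- 0, 1:] ^ n * (\<Prod>a\<in>A. [:- a, 1:]) ^ n) v = 0"
      unfolding T by (simp add: pev_mult[OF f] P(2))
    then have *: "((\<lambda>v. f v - 0 \<star> v) ^^ n) (pev f ((\<Prod>a\<in>A. [:- a, 1:]) ^ n) v) = 0"
      by (simp only: pev_mult[OF f] pev_linear_power[OF f])
    have "w = 0" if "((\<lambda>v. f v - 0 \<star> v) ^^ k) w = 0" for k w
      using that by (induction k) (auto dest: inj)
    then show ?thesis using * by blast
  qed
  have ann: "pev f R v = 0" if d: "(\<Prod>a\<in>A. [:- a, 1:]) ^ n dvd R" for R v
  proof -
    obtain T where "R = (\<Prod>a\<in>A. [:- a, 1:]) ^ n * T" using d by (auto elim: dvdE)
    then show ?thesis by (simp only: pev_mult[OF f] n)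
  qed
  obtain S where S: "\<forall>a\<in>A. [:- a, 1:] ^ n dvd S - [:a:]"
    using poly_chinese_remainder[OF A, of n "\<lambda>a. a"] by blast
  define s where "s = pev f S"
  have s: "endo scale s" unfolding s_def by (rule endo_pev[OF f])
  have pevs: "pev s Q v = pev f (Q \<circ>\<^sub>p S) v" for Q v
    by (induction Q)
      (simp_all add: pev_pCons[OF s] pcompose_pCons pev_add pev_mult[OF f] s_def pev_pCons[OF f] lin_zero[OF f]
        pev_pCons[OF s[unfolded s_def]])
  have ann_s: "pev s (\<Prod>a\<in>A. [:- a, 1:]) v = 0" for v
  proof -
    have "(\<Prod>a\<in>A. [:- a, 1:]) ^ n dvd (\<Prod>a\<in>A. [:- a, 1:]) \<circ>\<^sub>p S"
    proof -
      have "[:- a, 1:] ^ n dvd (\<Prod>a\<in>A. S - [:a:])" if "a \<in> A" for a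
        by (rule dvd_trans[OF bspec[OF S that]]) (rule dvd_prodI[OF A that])
      then have "(\<Prod>a\<in>A. [:- a, 1:] ^ n) dvd (\<Prod>a\<in>A. S - [:a:])"
        by (rule prod_linear_power_dvd[OF A])
      moreover have "[:- a, 1:] \<circ>\<^sub>p S = S - [:a:]" for a
        unfolding diff_conv_add_uminus minus_pCons by (simp add: pcompose_pCons add.commute)
      ultimately show ?thesis by (simp only: pcompose_prod prod_power_distrib)
    qed
    then show ?thesis unfolding pevs by (rule ann)
  qed
  then have diag: "diagonalizable s" unfolding diagonalizable_def using s A by blast
  have s0: "v = 0" if "s v = 0" for v
  proof -
    have "s v = 0 \<star> v" using that by simp
    then have "poly (\<Prod>a\<in>A. [:- a, 1:]) 0 \<star> v = 0"
      using pev_eigen[OF s, of v 0] ann_s by metis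
    moreover have "poly (\<Prod>a\<in>A. [:- a, 1:]) 0 \<noteq> 0" using A by (auto simp: poly_prod A_def)
    ultimately show ?thesis by simp
  qed
  have sbij: "bij s" using injective_imp_bij[OF s s0] by blast
  define t where "t = inv_into UNIV s"
  have t: "endo scale t" "\<And>v. t (s v) = v" "\<And>v. s (t v) = v"
    unfolding t_def using sbij lin_inv[OF s] by (auto simp: bij_is_inj bij_is_surj surj_f_inv_f)
  define u where "u v = t (f v)" for v
  have u: "endo scale u" unfolding u_def[abs_def] by (rule lin_comp[OF f t(1)])
  have tQ: "t (pev f Q v) = pev f Q (t v)" for Q v
    using pev_pev_commute[OF f, of S Q "t v"] t(2)[of "pev f Q (t v)"] by (simp add: s_def[symmetric] t(3))
  have "unipotent_map u"
  proof -
    \<comment> \<open>\<open>u - 1\<close> is the inverse of \<open>s\<close> times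
      \<open>x - S\<close> evaluated at \<open>f\<close>, and \<open>x - S\<close> vanishes at all
      points of \<open>A\<close>.\<close>
    define Q where "Q = [:0, 1:] - S"
    define x where "x = (\<lambda>v. u v - v)"
    have xQ: "x v = t (pev f Q v)" for v
    proof -
      have "pev f Q v = f v - s v"
        using pev_linear[OF f, of 0 v] by (simp add: Q_def pev_diff s_def)
      then show ?thesis by (simp add: x_def u_def lin_diff[OF t(1)] t(2))
    qed
    have "[:- a, 1:] dvd Q" if "a \<in> A" for a
    proof -
      have "[:- a, 1:] dvd [:- a, 1:] ^ n" by (simp only: n_def power_Suc dvd_triv_left)
      also have "\<dots> dvd S - [:a:]" using S that by blast
      finally have "[:- a, 1:] dvd S - [:a:]" .
      then have "[:- a, 1:] dvd [:- a, 1:] - (S - [:a:])" by (rule dvd_diff[OF dvd_refl])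
      also have "[:- a, 1:] - (S - [:a:]) = Q" by (simp add: Q_def algebra_simps)
      finally show ?thesis .
    qed
    then have "(\<Prod>a\<in>A. [:- a, 1:]) dvd Q" using prod_linear_power_dvd[OF A, of 1 Q] by simp
    then have "pev f (Q ^ n) v = 0" for v by (intro ann dvd_power_same)
    moreover have "(x ^^ k) v = (t ^^ k) (pev f (Q ^ k) v)" for k v
    proof (induction k)
      case (Suc k)
      have "pev f Q ((t ^^ k) w) = (t ^^ k) (pev f Q w)" for w
        by (rule funpow_commute[symmetric]) (rule tQ)
      then show ?case using xQ[of "(t ^^ k) (pev f (Q ^ k) v)"] by (simp add: Suc pev_mult[OF f])
    qed simp
    ultimately show ?thesis unfolding unipotent_map_def nilpotent_map_def x_def[symmetric]
      by (metis lin_zero[OF endo_funpow[OF t(1)]])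
  qed
  moreover have "s (u v) = f v" "u (s v) = f v" for v
    using tQ[of "[:0, 1:]" "s v"] pev_linear[OF f, of 0] by (simp_all add: u_def t)
  ultimately have "jordan_decomposition f s u"
    unfolding jordan_decomposition_def using u diag by simp
  then show ?thesis by (rule that)
qed

end

section \<open>Groups of operators that are finite modulo scalars\<close>

locale operator_group = alg_fd_space scale
  for scale :: "'a::{alg_closed_field, field_char_0} \<Rightarrow> 'b::ab_group_add \<Rightarrow> 'b" (infixr \<open>\<star>\<close> 75) +
  fixes G :: "('b \<Rightarrow> 'b) set"
  assumes G_endo: "g \<in> G \<Longrightarrow> endo scale g"
    and G_comp: "g \<in> G \<Longrightarrow> h \<in> G \<Longrightarrow> (\<lambda>v. g (h v)) \<in> G"
    and G_id: "(\<lambda>v. v) \<in> G"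
    and G_inverse: "g \<in> G \<Longrightarrow> \<exists>h\<in>G. \<forall>v. h (g v) = v \<and> g (h v) = v"
begin

definition ginv :: "('b \<Rightarrow> 'b) \<Rightarrow> 'b \<Rightarrow> 'b" where
  "ginv g = (SOME h. h \<in> G \<and> (\<forall>v. h (g v) = v \<and> g (h v) = v))"

lemma ginv:
  assumes "g \<in> G"
  shows "ginv g \<in> G" "ginv g (g v) = v" "g (ginv g v) = v"
proof -
  have "\<exists>h. h \<in> G \<and> (\<forall>v. h (g v) = v \<and> g (h v) = v)" using G_inverse[OF assms] by blast
  then have "ginv g \<in> G \<and> (\<forall>v. ginv g (g v) = v \<and> g (ginv g v) = v)"
    unfolding ginv_def by (rule someI_ex)
  then show "ginv g \<in> G" "ginv g (g v) = v" "g (ginv g v) = v" by auto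
qed

lemma G_funpow: "g \<in> G \<Longrightarrow> (g ^^ n) \<in> G"
proof (induction n)
  case (Suc n)
  then show ?case using G_comp[of g "g ^^ n"] by (simp add: comp_def)
qed (use G_id in \<open>simp add: id_def\<close>)

definition equivariant :: "('b \<Rightarrow> 'b) \<Rightarrow> bool" where
  "equivariant X \<longleftrightarrow> endo scale X \<and> (\<forall>g\<in>G. \<forall>v. g (X v) = X (g v))"

lemma equivariantI: "endo scale X \<Longrightarrow> (\<And>g v. g \<in> G \<Longrightarrow> g (X v) = X (g v)) \<Longrightarrow> equivariant X"
  by (simp add: equivariant_def)

lemma equivariant_endo: "equivariant X \<Longrightarrow> endo scale X"
  by (simp add: equivariant_def)

lemma equivariant_commute: "equivariant X \<Longrightarrow> g \<in> G \<Longrightarrow> g (X v) = X (g v)"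
  by (simp add: equivariant_def)

lemma equivariant_comp:
  "equivariant X \<Longrightarrow> equivariant Y \<Longrightarrow> equivariant (\<lambda>v. X (Y v))"
  unfolding equivariant_def by (auto intro: lin_comp)

lemma equivariant_plus:
  "equivariant X \<Longrightarrow> equivariant Y \<Longrightarrow> equivariant (\<lambda>v. X v + Y v)"
  unfolding equivariant_def by (auto intro: lin_plus simp: lin_add[OF G_endo])

lemma equivariant_minus:
  "equivariant X \<Longrightarrow> equivariant Y \<Longrightarrow> equivariant (\<lambda>v. X v - Y v)"
  unfolding equivariant_def by (auto intro: lin_minus simp: lin_diff[OF G_endo])

lemma equivariant_scale: "equivariant X \<Longrightarrow> equivariant (\<lambda>v. c \<star> X v)"
  unfolding equivariant_def by (auto intro: lin_smult simp: lin_scale[OF G_endo])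

end

text \<open>\<open>c\<close> will be the projection to an eigenspace of \<open>z\<close>.
  \<open>G\<close> may be infinite; \<open>T\<close> picks one element from each class of operators
  that agree up to a scalar on the range of \<open>c\<close>, and such scalars cancel in
  conjugations.\<close>

locale averaging = operator_group scale G
  for scale :: "'a::{alg_closed_field, field_char_0} \<Rightarrow> 'b::ab_group_add \<Rightarrow> 'b" (infixr \<open>\<star>\<close> 75)
    and G +
  fixes c :: "'b \<Rightarrow> 'b" and T :: "('b \<Rightarrow> 'b) set"
  assumes c_equivariant: "equivariant c"
    and c_idem: "c (c v) = c v"
    and c_central: "equivariant X \<Longrightarrow> c (X v) = X (c v)"
    and T: "finite T" "T \<subseteq> G"
    and transversal: "g \<in> G \<Longrightarrow> \<exists>!t. t \<in> T \<and> (\<exists>a. a \<noteq> 0 \<and> (\<forall>v. g (c v) = a \<star> t (c v)))"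
begin

lemmas c_endo = equivariant_endo[OF c_equivariant]

lemma c_commute: "g \<in> G \<Longrightarrow> g (c v) = c (g v)"
  by (rule equivariant_commute[OF c_equivariant])

lemmas T_in_G = subsetD[OF T(2)]
lemmas T_endo = G_endo[OF T_in_G]

definition proportional :: "('b \<Rightarrow> 'b) \<Rightarrow> ('b \<Rightarrow> 'b) \<Rightarrow> bool" where
  "proportional g h \<longleftrightarrow> (\<exists>a. a \<noteq> 0 \<and> (\<forall>v. g (c v) = a \<star> h (c v)))"

lemma proportional_sym: "proportional g h \<Longrightarrow> proportional h g"
  unfolding proportional_def
proof (elim exE conjE)
  fix a assume "a \<noteq> 0" "\<forall>v. g (c v) = a \<star> h (c v)"
  then show "\<exists>a. a \<noteq> 0 \<and> (\<forall>v. h (c v) = a \<star> g (c v))"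
    by (intro exI[of _ "inverse a"]) simp
qed

lemma proportional_trans: "proportional g h \<Longrightarrow> proportional h k \<Longrightarrow> proportional g k"
  unfolding proportional_def
  by (elim exE conjE, rename_tac a b) (rule_tac x = "a * b" in exI, simp)

definition representative :: "('b \<Rightarrow> 'b) \<Rightarrow> 'b \<Rightarrow> 'b" where
  "representative g = (THE t. t \<in> T \<and> proportional g t)"

lemma representative:
  assumes "g \<in> G"
  shows "representative g \<in> T" "proportional g (representative g)"
  using theI'[OF transversal[OF assms], folded proportional_def, folded representative_def] by auto

lemma proportional_unique: "t \<in> T \<Longrightarrow> t' \<in> T \<Longrightarrow> proportional t t' \<Longrightarrow> t = t'"
  using transversal[OF T_in_G, of t] proportional_trans proportional_sym
  unfolding proportional_def[symmetric] by metis

text \<open>Inserting \<open>c\<close> on both sides of \<open>X\<close> makes each summand depend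
  only on the class of \<open>t\<close> modulo scalars.\<close>

definition avg :: "('b \<Rightarrow> 'b) \<Rightarrow> 'b \<Rightarrow> 'b" where
  "avg X v = (\<Sum>t\<in>T. t (c (X (c (ginv t v)))))"

lemma card_T: "of_nat (card T) \<noteq> (0 :: 'a)"
  using T(1) representative(1)[OF G_id] by auto

lemma endo_conj: "endo scale X \<Longrightarrow> t \<in> G \<Longrightarrow> endo scale (\<lambda>v. t (c (X (c (ginv t v)))))"
  by (rule lin_comp[OF lin_comp[OF lin_comp[OF lin_comp[OF G_endo[OF ginv(1)] c_endo]] c_endo] G_endo])

lemma avg_endo: "endo scale X \<Longrightarrow> endo scale (avg X)"
  unfolding avg_def[abs_def] by (rule endo_Sum) (rule endo_conj[OF _ T_in_G])

lemma conj_proportional: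
  assumes g: "g \<in> G" and t: "t \<in> G" and X: "endo scale X" and "proportional g t"
  shows "g (c (X (c (ginv g v)))) = t (c (X (c (ginv t v))))"
proof -
  obtain a where a: "a \<noteq> 0" "\<And>v. g (c v) = a \<star> t (c v)"
    using assms(4) unfolding proportional_def by blast
  have "g (c (ginv g v)) = g (inverse a \<star> c (ginv t v))"
    using a(1) by (simp add: lin_scale[OF G_endo[OF g]] a(2)[of "ginv t v"])
      (simp add: c_commute g t ginv)
  then have "c (ginv g v) = inverse a \<star> c (ginv t v)" by (metis ginv(2)[OF g])
  then show ?thesis
    using a by (simp add: lin_scale[OF X] lin_scale[OF c_endo] lin_scale[OF G_endo[OF g]])
qed

text \<open>Left multiplication by \<open>h\<close> permutes the classes represented by
  \<open>T\<close>. The products \<open>h t\<close> need not lie in \<open>T\<close> themselves;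
  \<open>conj_proportional\<close> replaces them by their representatives.\<close>

lemma avg_commute:
  assumes X: "endo scale X" and h: "h \<in> G"
  shows "h (avg X v) = avg X (h v)"
proof -
  define \<sigma> where "\<sigma> t = representative (\<lambda>v. h (t v))" for t
  have hT: "(\<lambda>v. h (t v)) \<in> G" if "t \<in> T" for t using that G_comp[OF h T_in_G] by blast
  have \<sigma>: "\<sigma> t \<in> T" "proportional (\<lambda>v. h (t v)) (\<sigma> t)" if "t \<in> T" for t
    unfolding \<sigma>_def using representative[OF hT[OF that]] by auto
  have "inj_on \<sigma> T"
  proof (rule inj_onI)
    fix t t' assume t: "t \<in> T" "t' \<in> T" and "\<sigma> t = \<sigma> t'"
    then have "proportional (\<lambda>v. h (t v)) (\<lambda>v. h (t' v))"
      using \<sigma> proportional_trans proportional_sym by metis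
    then obtain a where a: "a \<noteq> 0" "\<And>v. h (t (c v)) = h (a \<star> t' (c v))"
      unfolding proportional_def lin_scale[OF G_endo[OF h]] by blast
    then have "proportional t t'" unfolding proportional_def by (metis ginv(2)[OF h])
    then show "t = t'" using t proportional_unique by blast
  qed
  then have bij: "bij_betw \<sigma> T T"
    using \<sigma>(1) endo_inj_surj[OF T(1), of \<sigma>] by (auto simp: bij_betw_def)
  have "h (avg X v) = (\<Sum>t\<in>T. h (t (c (X (c (ginv t v))))))"
    by (simp add: avg_def lin_sum[OF G_endo[OF h]])
  also have "\<dots> = (\<Sum>t\<in>T. \<sigma> t (c (X (c (ginv (\<sigma> t) (h v))))))"
  proof (rule sum.cong[OF refl])
    fix t assume t: "t \<in> T"
    have "ginv (\<lambda>v. h (t v)) (h v) = ginv t v"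
      using ginv(2)[OF hT[OF t], of "ginv t v"] by (simp add: ginv(3)[OF T_in_G[OF t]])
    then show "h (t (c (X (c (ginv t v))))) = \<sigma> t (c (X (c (ginv (\<sigma> t) (h v)))))"
      using conj_proportional[OF hT[OF t] T_in_G[OF \<sigma>(1)[OF t]] X \<sigma>(2)[OF t], of "h v"] by simp
  qed
  also have "\<dots> = avg X (h v)"
    unfolding avg_def by (rule sum.reindex_bij_betw[OF bij])
  finally show ?thesis .
qed

lemma avg_equivariant: "endo scale X \<Longrightarrow> equivariant (avg X)"
  by (simp add: equivariantI avg_endo avg_commute)

lemma c_avg: "c (avg X v) = avg X v"
  by (simp add: avg_def lin_sum[OF c_endo] c_commute[symmetric] T_in_G c_idem)

text \<open>Maschke's argument: average a linear projection onto \<open>S\<close> and divide by the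
  number of classes, which is nonzero in characteristic zero.\<close>

lemma equivariant_projection:
  assumes S: "subspace S" "\<And>g v. g \<in> G \<Longrightarrow> v \<in> S \<Longrightarrow> g v \<in> S" "\<And>v. v \<in> S \<Longrightarrow> c v = v"
  obtains e where "equivariant e" "\<And>v. e v \<in> S" "\<And>v. v \<in> S \<Longrightarrow> e v = v"
proof -
  obtain p where p: "endo scale p" "\<And>v. p v \<in> S" "\<And>v. v \<in> S \<Longrightarrow> p v = v"
    using projection_exists[OF S(1)] by blast
  define e where "e v = inverse (of_nat (card T)) \<star> avg p v" for v
  have "equivariant e" unfolding e_def[abs_def] by (intro equivariant_scale avg_equivariant p(1))
  moreover have "e v \<in> S" for v unfolding e_def avg_def
    by (intro subspace_scale subspace_sum S(1)) (simp add: S(2,3) p(2) T_in_G)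
  moreover have "e v = v" if "v \<in> S" for v
    using card_T that by (simp add: e_def avg_def S(2,3) p(3) ginv T_in_G sum_constant_scale)
  ultimately show ?thesis by (rule that)
qed

lemma trace_conj:
  assumes "t \<in> T" "endo scale Y"
  shows "tr (\<lambda>v. t (Y (ginv t v))) = tr Y"
  using trace_cyclic[OF G_endo[OF ginv(1)[OF T_in_G[OF assms(1)]]] lin_comp[OF assms(2) T_endo[OF assms(1)]]]
  by (simp add: ginv T_in_G assms(1))

lemma endo_rank_one: "endo scale (\<lambda>v. crd b v \<star> x)"
  by (simp add: endo_iff crd_add crd_scale scale_left_distrib)

text \<open>\<open>W\<close> has least dimension among the nonzero stable subspaces of the common
  range of \<open>f\<close> and \<open>c\<close>. Schur's lemma, recorded as the last conclusion,
  stands for irreducibility from here on: an eigenspace of \<open>e C\<close> in \<open>W\<close> is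
  stable, so if nonzero it is all of \<open>W\<close>.\<close>

lemma irreducible_projection:
  assumes f: "equivariant f" "\<And>v. f (f v) = f v" and "f (c v0) \<noteq> 0"
  obtains e w where "equivariant e" "\<And>v. e (e v) = e v" "\<And>v. f (e v) = e v" "\<And>v. e (f v) = e v"
    "\<And>v. c (e v) = e v" "\<And>v. e (c v) = e v" "w \<noteq> 0" "e w = w"
    "\<And>C. equivariant C \<Longrightarrow> \<exists>a. \<forall>v. e (C (e v)) = a \<star> e v"
proof -
  define St where "St S \<longleftrightarrow> subspace S \<and> (\<forall>g\<in>G. \<forall>v\<in>S. g v \<in> S) \<and> (\<forall>v\<in>S. f v = v \<and> c v = v) \<and>
    (\<exists>v\<in>S. v \<noteq> 0)" for S
  note fe = equivariant_endo[OF f(1)]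
  have fc: "c (f v) = f (c v)" for v by (rule c_central[OF f(1)])
  have "St {v. f v = v \<and> c v = v}"
    unfolding St_def subspace_def
    using assms(3) f(2) c_idem fc
    by (auto simp: lin_zero[OF fe] lin_zero[OF c_endo] lin_add[OF fe] lin_add[OF c_endo]
      lin_scale[OF fe] lin_scale[OF c_endo] equivariant_commute[OF f(1), symmetric]
      c_commute[symmetric] intro!: exI[of _ "f (c v0)"])
  then obtain W where W: "St W" and min: "\<And>S. St S \<Longrightarrow> dim W \<le> dim S"
    using arg_min_natI[of St _ dim] arg_min_nat_le[of St _ dim] by metis
  have sW: "subspace W" and GW: "\<And>g v. g \<in> G \<Longrightarrow> v \<in> W \<Longrightarrow> g v \<in> W"
    and fW: "\<And>v. v \<in> W \<Longrightarrow> f v = v" and cW: "\<And>v. v \<in> W \<Longrightarrow> c v = v"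
    using W by (auto simp: St_def)
  obtain w0 where w0: "w0 \<in> W" "w0 \<noteq> 0" using W by (auto simp: St_def)
  obtain e0 where e0: "equivariant e0" "\<And>v. e0 v \<in> W" "\<And>v. v \<in> W \<Longrightarrow> e0 v = v"
    using equivariant_projection[of W] sW GW cW by blast
  \<comment> \<open>\<open>e0\<close> need not absorb \<open>f\<close> and \<open>c\<close> on the
    right; the composite does, and it is still the identity on \<open>W\<close>.\<close>
  define e where "e v = e0 (f (c v))" for v
  have e: "equivariant e" unfolding e_def[abs_def]
    by (rule equivariant_comp[OF e0(1) equivariant_comp[OF f(1) c_equivariant]])
  note ee = equivariant_endo[OF e]
  have eW: "e v \<in> W" for v by (simp add: e_def e0)
  have eid: "e v = v" if "v \<in> W" for v using that by (simp add: e_def cW fW e0)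
  have schur: "\<exists>a. \<forall>v. e (C (e v)) = a \<star> e v" if C: "equivariant C" for C
  proof -
    have eC: "endo scale (\<lambda>v. e (C v))" by (rule lin_comp[OF equivariant_endo[OF C] ee])
    obtain w a where wa: "w \<in> W" "w \<noteq> 0" "e (C w) = a \<star> w"
      by (rule eigenvector_in_subspace[OF eC sW eW w0])
    define K where "K = {v \<in> W. e (C v) = a \<star> v}"
    have "St K"
      unfolding St_def
    proof (intro conjI)
      have "K = W \<inter> {v. e (C v) = a \<star> v}" by (auto simp: K_def)
      then show "subspace K" using subspace_inter[OF sW subspace_eigen[OF eC]] by simp
      show "\<forall>g\<in>G. \<forall>v\<in>K. g v \<in> K"
        by (auto simp: K_def GW equivariant_commute[OF C, symmetric]
            equivariant_commute[OF e, symmetric] lin_scale[OF G_endo])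
    qed (use wa in \<open>auto simp: K_def fW cW\<close>)
    then have "dim W \<le> dim K" "subspace K" by (auto simp: min St_def)
    moreover have "K \<subseteq> W" by (auto simp: K_def)
    ultimately have "K = W" using subspace_dim_equal[OF _ sW, of K] by blast
    then show ?thesis using eW by (auto simp: K_def)
  qed
  show ?thesis
    by (rule that[OF e _ _ _ _ _ w0(2) eid[OF w0(1)] schur])
      (simp_all add: eid eW fW cW, simp_all add: e_def f(2) fc c_idem)
qed

text \<open>This is the orthogonality relation for characters, used in the form that a multiple of
  \<open>\<Sum>\<^sub>t tr(t\<^sup>-\<^sup>1|\<^sub>W) t\<close> is an idempotent which is the identity on the irreducible \<open>W\<close>.\<close>

lemma trace_eq_imp_nonzero_composite:
  assumes f1: "equivariant f1" "\<And>v. f1 (f1 v) = f1 v" and f2: "equivariant f2"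
    and tr_eq: "\<And>g. g \<in> G \<Longrightarrow> tr (\<lambda>v. g (c (f1 v))) = tr (\<lambda>v. g (c (f2 v)))"
    and e: "equivariant e" "\<And>v. e (e v) = e v" "\<And>v. f1 (e v) = e v"
      "\<And>v. c (e v) = e v" "\<And>v. e (c v) = e v"
    and w: "w \<noteq> 0" "e w = w"
    and schur: "\<And>C. equivariant C \<Longrightarrow> \<exists>a. \<forall>v. e (C (e v)) = a \<star> e v"
  shows "\<exists>A B v. equivariant A \<and> equivariant B \<and> e (B (f2 (A (e v)))) \<noteq> 0"
proof (rule ccontr)
  assume *: "\<not> ?thesis"
  note ee = equivariant_endo[OF e(1)]
  define n where "n = (of_nat (card T) :: 'a)"
  \<comment> \<open>The dimension of the irreducible summand, as an element of the field.\<close>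
  define d where "d = tr e"
  have n: "n \<noteq> 0" using card_T by (simp add: n_def)
  have d: "d \<noteq> 0" using trace_idempotent_nonzero[OF ee e(2)] w by (metis d_def)
  have et: "e (t v) = t (e v)" if "t \<in> G" for t v
    using equivariant_commute[OF e(1) that] by simp
  have trace_avg: "tr (\<lambda>v. e (avg Y (Q v))) = n * tr (\<lambda>v. e (Y (c (Q v))))"
    if Y: "endo scale Y" and Q: "equivariant Q" for Y Q
  proof -
    have eq: "e (avg Y (Q v)) = (\<Sum>t\<in>T. t (e (Y (c (Q (ginv t v))))))" for v
      by (simp add: avg_def lin_sum[OF ee] et T_in_G e(5) equivariant_commute[OF Q] ginv(1))
    have eYcQ: "endo scale (\<lambda>v. e (Y (c (Q v))))"
      by (rule lin_comp[OF lin_comp[OF lin_comp[OF equivariant_endo[OF Q] c_endo] Y] ee])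
    have "tr (\<lambda>v. t (e (Y (c (Q (ginv t v)))))) = tr (\<lambda>v. e (Y (c (Q v))))" if "t \<in> T" for t
      using trace_conj[OF that eYcQ] by simp
    then show ?thesis unfolding eq by (simp add: trace_Sum n_def)
  qed
  \<comment> \<open>Schur's lemma makes the composite a scalar multiple of \<open>e\<close>, and
    comparing traces determines the scalar.\<close>
  have avg_schur: "e (avg X (e v)) = (n * tr (\<lambda>v. e (X v)) / d) \<star> e v" if X: "endo scale X" for X v
  proof -
    obtain a where a: "\<And>v. e (avg X (e v)) = a \<star> e v" using schur[OF avg_equivariant[OF X]] by blast
    have "a * d = n * tr (\<lambda>v. e (X (e v)))"
      using trace_avg[OF X e(1)] by (simp add: a trace_scale d_def e(4))
    also have "tr (\<lambda>v. e (X (e v))) = tr (\<lambda>v. e (X v))"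
      using trace_cyclic[OF ee lin_comp[OF X ee]] by (simp add: e(2))
    finally show ?thesis using a d by (simp add: field_simps)
  qed
  \<comment> \<open>By assumption every composite from the irreducible summand through
    \<open>f2\<close> and back vanishes. Testing the trace form against all \<open>Y\<close>
    upgrades this: already the averaged maps into the range of \<open>f2\<close> vanish.\<close>
  have f2avg: "f2 (avg X (e v)) = 0" if X: "endo scale X" for X v
  proof -
    define Q where "Q v = f2 (avg X (e v))" for v
    have Q: "equivariant Q" unfolding Q_def[abs_def]
      by (rule equivariant_comp[OF f2 equivariant_comp[OF avg_equivariant[OF X] e(1)]])
    have Qc: "endo scale (\<lambda>v. c (Q v))" by (rule lin_comp[OF equivariant_endo[OF Q] c_endo])
    have "tr (\<lambda>v. Y (c (Q v))) = 0" if Y: "endo scale Y" for Y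
    proof -
      have "e (avg Y (Q v)) = 0" for v
        using * avg_equivariant[OF X] avg_equivariant[OF Y] unfolding Q_def by blast
      then have "tr (\<lambda>v. e (Y (c (Q v)))) = 0"
        using trace_avg[OF Y Q] n by (simp add: trace_zero)
      also have "tr (\<lambda>v. e (Y (c (Q v)))) = tr (\<lambda>v. Y (c (Q (e v))))"
        by (rule trace_cyclic[OF lin_comp[OF Qc Y] ee])
      finally show ?thesis by (simp add: Q_def e(2))
    qed
    then have "c (Q v) = 0" by (rule trace_nondegenerate[OF _ Qc])
    then show ?thesis using c_central[OF f2] by (simp add: Q_def c_avg)
  qed
  define Z where "Z v = (\<Sum>t\<in>T. tr (\<lambda>x. ginv t (e x)) \<star> t (c v))" for v
  have Z: "endo scale Z" unfolding Z_def[abs_def]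
    by (intro endo_Sum lin_smult) (rule lin_comp[OF c_endo T_endo])
  \<comment> \<open>Resolving the traces in \<open>Z\<close> along the basis turns the character sum
    into averages of rank-one maps, to which \<open>avg_schur\<close> and \<open>f2avg\<close>
    apply.\<close>
  have Z_avg: "Z x = (\<Sum>b\<in>basis. avg (\<lambda>v. crd b v \<star> x) (e b))" for x
  proof -
    have "(\<Sum>b\<in>basis. avg (\<lambda>v. crd b v \<star> x) (e b)) =
        (\<Sum>b\<in>basis. \<Sum>t\<in>T. crd b (ginv t (e b)) \<star> t (c x))"
      by (simp add: avg_def lin_scale[OF c_endo] lin_scale[OF T_endo] ginv T_in_G e(4)
          flip: c_commute)
    also have "\<dots> = Z x"
      unfolding Z_def trace_def scale_sum_left by (rule sum.swap)
    finally show ?thesis by simp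
  qed
  have Z_commute: "Z (Y v) = Y (Z v)" if Y: "equivariant Y" for Y v
    by (simp add: Z_def lin_sum[OF equivariant_endo[OF Y]] lin_scale[OF equivariant_endo[OF Y]]
        c_central[OF Y] equivariant_commute[OF Y] T_in_G)
  have Ze: "Z (e x) = (n / d) \<star> e x" for x
  proof -
    have "avg (\<lambda>v. crd b v \<star> e x) (e b) = (n / d) \<star> crd b (e x) \<star> e b" for b
    proof -
      have "avg (\<lambda>v. crd b v \<star> e x) (e b) = e (avg (\<lambda>v. crd b v \<star> e x) (e b))"
        by (simp add: avg_def lin_sum[OF ee] lin_scale[OF c_endo] lin_scale[OF T_endo] lin_scale[OF ee]
            e(2,4) et T_in_G)
      also have "\<dots> = (n * crd b (e x) / d) \<star> e b"
        using avg_schur[OF endo_rank_one, of b "e x" b]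
        by (simp add: lin_scale[OF ee] e(2) trace_rank_one)
      finally show ?thesis by simp
    qed
    then show ?thesis unfolding Z_avg
      by (simp add: scale_sum_right[symmetric] endo_crd_sum[OF ee] e(2) del: scale_scale)
  qed
  have ZZ: "Z (Z x) = (n / d) \<star> Z x" for x
  proof -
    have "Z (Z x) = (\<Sum>b\<in>basis. avg (\<lambda>v. crd b v \<star> x) (Z (e b)))"
      by (subst (2) Z_avg) (simp add: lin_sum[OF Z] Z_commute[OF avg_equivariant[OF endo_rank_one]])
    then show ?thesis
      by (simp add: Ze lin_scale[OF avg_endo[OF endo_rank_one]] scale_sum_right[symmetric] Z_avg[symmetric])
  qed
  have "f2 (Z x) = 0" for x
    by (subst Z_avg) (simp add: lin_sum[OF equivariant_endo[OF f2]] f2avg[OF endo_rank_one])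
  \<comment> \<open>\<open>Z\<close> is a combination of group elements with the same coefficients
    for \<open>f1\<close> and \<open>f2\<close>, so equality of traces gives \<open>f1 Z\<close>
    trace zero as well. But a multiple of \<open>f1 Z\<close> is an idempotent fixing
    \<open>w\<close>.\<close>
  then have "tr (\<lambda>x. f2 (Z x)) = 0" by (simp add: trace_zero)
  moreover have "tr (\<lambda>x. f (Z x)) = (\<Sum>t\<in>T. tr (\<lambda>x. ginv t (e x)) * tr (\<lambda>v. t (c (f v))))"
    if f: "equivariant f" for f
    by (subst Z_commute[OF f, symmetric]) (simp add: Z_def trace_Sum trace_scale)
  ultimately have "tr (\<lambda>x. f1 (Z x)) = 0"
    using f1(1) f2 tr_eq T_in_G by simp
  then have trE: "tr (\<lambda>x. (d / n) \<star> f1 (Z x)) = 0" by (simp add: trace_scale)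
  have "(d / n) \<star> f1 (Z w) = 0"
  proof (rule trace_idempotent_nonzero[OF _ _ trE])
    show "endo scale (\<lambda>x. (d / n) \<star> f1 (Z x))"
      by (rule lin_smult) (rule lin_comp[OF Z equivariant_endo[OF f1(1)]])
    show "(d / n) \<star> f1 (Z ((d / n) \<star> f1 (Z v))) = (d / n) \<star> f1 (Z v)" for v
      using n d by (simp add: lin_scale[OF Z] lin_scale[OF equivariant_endo[OF f1(1)]]
          Z_commute[OF f1(1)] ZZ f1(2))
  qed
  moreover have "f1 w = w" using e(3)[of w] w by simp
  moreover have "Z w = (n / d) \<star> w" using Ze[of w] w by simp
  ultimately show False using n d w by (simp add: lin_scale[OF equivariant_endo[OF f1(1)]])
qed

text \<open>\<open>A\<close> and \<open>B\<close> are inverse isomorphisms between irreducible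
  summands of the ranges of \<open>f1\<close> and \<open>f2\<close>, both inside the range of
  \<open>c\<close>, extended by zero to complements. Their composite \<open>B A\<close> is the
  projection \<open>e\<close>.\<close>

lemma trace_eq_imp_common_summand:
  assumes f1: "equivariant f1" "\<And>v. f1 (f1 v) = f1 v" and f2: "equivariant f2" "\<And>v. f2 (f2 v) = f2 v"
    and tr_eq: "\<And>g. g \<in> G \<Longrightarrow> tr (\<lambda>v. g (c (f1 v))) = tr (\<lambda>v. g (c (f2 v)))"
    and "f1 (c v0) \<noteq> 0"
  obtains A B w where "equivariant A" "equivariant B"
    "\<And>v. c (A v) = A v" "\<And>v. f2 (A v) = A v" "\<And>v. A (f1 v) = A v"
    "\<And>v. c (B v) = B v" "\<And>v. f1 (B v) = B v" "\<And>v. B (f2 v) = B v"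
    "\<And>v. B (A (B (A v))) = B (A v)" "w \<noteq> 0" "c w = w" "B (A w) = w"
proof -
  obtain e w where e: "equivariant e" "\<And>v. e (e v) = e v" "\<And>v. f1 (e v) = e v" "\<And>v. e (f1 v) = e v"
    "\<And>v. c (e v) = e v" "\<And>v. e (c v) = e v" and w: "w \<noteq> 0" "e w = w"
    and schur: "\<And>C. equivariant C \<Longrightarrow> \<exists>a. \<forall>v. e (C (e v)) = a \<star> e v"
    using irreducible_projection[OF f1 assms(6)] by blast
  obtain A0 B0 x where AB: "equivariant A0" "equivariant B0" "e (B0 (f2 (A0 (e x)))) \<noteq> 0"
    using trace_eq_imp_nonzero_composite[OF f1 f2(1) tr_eq e(1,2,3,5,6) w schur] by blast
  obtain a where a: "\<And>v. e (B0 (f2 (A0 (e v)))) = a \<star> e v"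
    using schur[OF equivariant_comp[OF AB(2) equivariant_comp[OF f2(1) AB(1)]]] by blast
  have "a \<noteq> 0" using AB(3) a[of x] by auto
  \<comment> \<open>Wrapping \<open>A0\<close> and \<open>B0\<close> in \<open>f2\<close> and
    \<open>c\<close> gives the absorption rules; the factor \<open>inverse a\<close> normalizes
    \<open>B A\<close> to \<open>e\<close>.\<close>
  define A where "A v = f2 (c (A0 (e v)))" for v
  define B where "B v = inverse a \<star> e (B0 (c (f2 v)))" for v
  have c2: "c (f2 v) = f2 (c v)" for v by (rule c_central[OF f2(1)])
  have BA: "B (A v) = e v" for v
  proof -
    have "c (f2 (A v)) = f2 (A0 (e v))"
      by (simp add: A_def f2(2) c2 c_idem c_central[OF AB(1)] e(5))
    then show ?thesis using \<open>a \<noteq> 0\<close> by (simp add: B_def a)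
  qed
  show ?thesis
  proof (rule that[of A B w])
    show "equivariant A" unfolding A_def[abs_def]
      by (intro equivariant_comp[OF f2(1)] equivariant_comp[OF c_equivariant] equivariant_comp[OF AB(1)] e(1))
    show "equivariant B" unfolding B_def[abs_def]
      by (intro equivariant_scale equivariant_comp[OF e(1)] equivariant_comp[OF AB(2)]
          equivariant_comp[OF c_equivariant] f2(1))
  qed (use w e(5)[of w] in \<open>simp_all add: BA e\<close>,
      simp_all add: A_def B_def c2 c_idem e f2(2) lin_scale[OF c_endo] lin_scale[OF equivariant_endo[OF f1(1)]])
qed

end

section \<open>Operator groups with a nilpotent operator of Lefschetz type\<close>

context alg_fd_space
begin

lemma finite_eigenvalues:
  assumes "diagonalizable s"
  shows "finite {a. \<exists>v. v \<noteq> 0 \<and> s v = a \<star> v}"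
proof -
  note s = diagonalizable_endo[OF assms]
  obtain A where A: "finite A" "\<And>v. pev s (\<Prod>a\<in>A. [:- a, 1:]) v = 0"
    using assms by (auto simp: diagonalizable_def)
  have "a \<in> A" if "v \<noteq> 0" "s v = a \<star> v" for a v
    using A(2)[of v] pev_eigen[OF s that(2), of "\<Prod>a\<in>A. [:- a, 1:]"] that(1) A(1)
    by (auto simp: poly_prod)
  then show ?thesis using A(1) by (elim rev_finite_subset) auto
qed

end

text \<open>This abstracts the Weil group acting on the direct sum: \<open>z\<close> is a central
  power of Frobenius, \<open>\<kappa>\<close> the factor by which \<open>N\<close> shifts its
  eigenvalues, and \<open>wt\<close> the weight normalized to be symmetric around 0, meaningful at
  eigenvalues of \<open>z\<close>. Finiteness modulo \<open>z\<close> has natural exponents on both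
  sides to avoid inverses of \<open>z\<close>.\<close>

locale lefschetz_system = operator_group scale G
  for scale :: "'a::{alg_closed_field, field_char_0} \<Rightarrow> 'b::ab_group_add \<Rightarrow> 'b" (infixr \<open>\<star>\<close> 75)
    and G +
  fixes N z :: "'b \<Rightarrow> 'b" and \<kappa> :: 'a and wt :: "'a \<Rightarrow> int"
  assumes N_endo: "endo scale N"
    and N_twist: "g \<in> G \<Longrightarrow> \<exists>k. k \<noteq> 0 \<and> (\<forall>v. g (N v) = k \<star> N (g v))"
    and z_in_G: "z \<in> G" and z_diag: "diagonalizable z"
    and z_central: "g \<in> G \<Longrightarrow> z (g v) = g (z v)"
    and finite_mod_z: "\<exists>F. finite F \<and> F \<subseteq> G \<and>
      (\<forall>g\<in>G. \<exists>h\<in>F. \<exists>i j. \<forall>v. g ((z ^^ i) v) = h ((z ^^ j) v))"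
    and z_N: "z (N v) = \<kappa> \<star> N (z v)"
    and \<kappa>_nonzero: "\<kappa> \<noteq> 0" and \<kappa>_not_root_of_unity: "n > 0 \<Longrightarrow> \<kappa> ^ n \<noteq> 1"
    and wt_shift: "v \<noteq> 0 \<Longrightarrow> z v = a \<star> v \<Longrightarrow> wt (\<kappa> ^ n * a) = wt a - 2 * int n"
    and lefschetz_inj: "z v = a \<star> v \<Longrightarrow> wt a = int k \<Longrightarrow> (N ^^ k) v = 0 \<Longrightarrow> v = 0"
    and lefschetz_surj: "v \<noteq> 0 \<Longrightarrow> z v = a \<star> v \<Longrightarrow> wt a = - int k \<Longrightarrow>
      \<exists>u. z u = (a / \<kappa> ^ k) \<star> u \<and> (N ^^ k) u = v"
begin

lemmas z_endo = G_endo[OF z_in_G]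

lemma z_inj: "z v = 0 \<Longrightarrow> v = 0"
  by (metis ginv(2) lin_zero G_endo ginv(1) z_in_G)

lemma eigenvalue_nonzero: "v \<noteq> 0 \<Longrightarrow> z v = a \<star> v \<Longrightarrow> a \<noteq> 0"
  using z_inj by auto

abbreviation eproj :: "'a \<Rightarrow> 'b \<Rightarrow> 'b" where "eproj \<equiv> eigenproj z"

lemmas eproj_endo = endo_eigenproj[OF z_diag]

lemma eproj_equivariant: "equivariant (eproj a)"
proof (rule equivariantI[OF eproj_endo])
  fix g v assume g: "g \<in> G"
  show "g (eproj a v) = eproj a (g v)"
    using eigenproj_commute[OF G_endo[OF g], of z a v] z_central[OF g] by simp
qed

lemma eproj_central: "equivariant X \<Longrightarrow> eproj a (X v) = X (eproj a v)"
  by (rule eigenproj_commute) (auto intro: equivariant_endo equivariant_commute z_in_G)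

text \<open>On the \<open>a\<close>-eigenspace \<open>z\<close> is a scalar, nonzero because
  \<open>z\<close> is invertible, so finiteness modulo powers of \<open>z\<close> becomes finiteness
  modulo scalars.\<close>

lemma averaging_exists:
  assumes "v0 \<noteq> 0" "z v0 = a \<star> v0"
  obtains T where "averaging scale G (eproj a) T"
proof -
  have a: "a \<noteq> 0" by (rule eigenvalue_nonzero[OF assms])
  define pr where "pr g h \<longleftrightarrow> (\<exists>b. b \<noteq> 0 \<and> (\<forall>v. g (eproj a v) = b \<star> h (eproj a v)))" for g h
  have pr_sym: "pr h g" if gh: "pr g h" for g h
  proof -
    obtain b where "b \<noteq> 0" "\<forall>v. g (eproj a v) = b \<star> h (eproj a v)" using gh unfolding pr_def by blast
    then show ?thesis unfolding pr_def by (intro exI[of _ "inverse b"]) simp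
  qed
  have pr_trans: "pr g k" if gh: "pr g h" and hk: "pr h k" for g h k
  proof -
    obtain b b' where "b \<noteq> 0" "\<forall>v. g (eproj a v) = b \<star> h (eproj a v)"
      "b' \<noteq> 0" "\<forall>v. h (eproj a v) = b' \<star> k (eproj a v)" using gh hk unfolding pr_def by blast
    then show ?thesis unfolding pr_def by (intro exI[of _ "b * b'"]) simp
  qed
  obtain F where F: "finite F" "F \<subseteq> G"
    "\<And>g. g \<in> G \<Longrightarrow> \<exists>h\<in>F. \<exists>i j. \<forall>v. g ((z ^^ i) v) = h ((z ^^ j) v)"
    using finite_mod_z by blast
  have zi: "(z ^^ i) (eproj a v) = a ^ i \<star> eproj a v" for i v
    by (induction i) (simp_all add: eigenproj_eigen[OF z_diag] lin_scale[OF z_endo] mult.commute)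
  have F_pr: "\<exists>h\<in>F. pr g h" if g: "g \<in> G" for g
  proof -
    obtain h i j where h: "h \<in> F" "\<And>v. g ((z ^^ i) v) = h ((z ^^ j) v)" using F(3)[OF g] by blast
    have "a ^ i \<star> g (eproj a v) = a ^ j \<star> h (eproj a v)" for v
      using h(2)[of "eproj a v"] h(1) F(2) by (simp add: zi lin_scale[OF G_endo] g subsetD)
    then have "inverse (a ^ i) \<star> a ^ i \<star> g (eproj a v) = inverse (a ^ i) \<star> a ^ j \<star> h (eproj a v)" for v
      by simp
    then have "pr g h" using a unfolding pr_def
      by (intro exI[of _ "inverse (a ^ i) * a ^ j"]) simp
    then show ?thesis using h(1) by blast
  qed
  \<comment> \<open>Choosing by the predicate \<open>pr g\<close> alone makes \<open>rep\<close>
    constant on classes, so that its values form a transversal.\<close>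
  define rep where "rep g = (SOME h. h \<in> F \<and> pr g h)" for g
  have rep: "rep g \<in> F" "pr g (rep g)" if "g \<in> G" for g
    using someI_ex[of "\<lambda>h. h \<in> F \<and> pr g h"] F_pr[OF that] unfolding rep_def by blast+
  have rep_cong: "rep g = rep g'" if "pr g g'" for g g'
  proof -
    have "(\<lambda>h. h \<in> F \<and> pr g h) = (\<lambda>h. h \<in> F \<and> pr g' h)"
      using that pr_sym pr_trans by blast
    then show ?thesis by (simp add: rep_def)
  qed
  have "averaging scale G (eproj a) (rep ` G)"
  proof (unfold_locales)
    show "finite (rep ` G)" using F(1) rep(1) by (auto intro: finite_subset)
    show "rep ` G \<subseteq> G" using F(2) rep(1) by blast
    show "\<exists>!t. t \<in> rep ` G \<and> (\<exists>b. b \<noteq> 0 \<and> (\<forall>v. g (eproj a v) = b \<star> t (eproj a v)))" if g: "g \<in> G" for g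
      unfolding pr_def[symmetric]
    proof (rule ex1I[of _ "rep g"])
      show "rep g \<in> rep ` G \<and> pr g (rep g)" using rep g by blast
      fix t assume t: "t \<in> rep ` G \<and> pr g t"
      then obtain g' where g': "g' \<in> G" "t = rep g'" by blast
      then have "pr g g'" using t rep(2)[OF g'(1)] pr_sym pr_trans by blast
      then show "t = rep g" using g'(2) rep_cong by simp
    qed
  qed (auto simp: eproj_equivariant eigenproj_idem[OF z_diag] eproj_central)
  then show ?thesis by (rule that)
qed

text \<open>These are the endomorphisms of the Weil--Deligne structure; the idempotents among them
  are its direct summands.\<close>

definition compatible :: "('b \<Rightarrow> 'b) \<Rightarrow> bool" where
  "compatible X \<longleftrightarrow> equivariant X \<and> (\<forall>v. N (X v) = X (N v))"

lemma compatible_equivariant: "compatible X \<Longrightarrow> equivariant X"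
  by (simp add: compatible_def)

lemmas compatible_endo = equivariant_endo[OF compatible_equivariant]

lemma compatible_comp: "compatible X \<Longrightarrow> compatible Y \<Longrightarrow> compatible (\<lambda>v. X (Y v))"
  by (simp add: compatible_def equivariant_comp)

lemma compatible_plus: "compatible X \<Longrightarrow> compatible Y \<Longrightarrow> compatible (\<lambda>v. X v + Y v)"
  by (simp add: compatible_def equivariant_plus lin_add[OF N_endo])

lemma compatible_minus: "compatible X \<Longrightarrow> compatible Y \<Longrightarrow> compatible (\<lambda>v. X v - Y v)"
  by (simp add: compatible_def equivariant_minus lin_diff[OF N_endo])

lemma compatible_funpow: "compatible X \<Longrightarrow> (N ^^ n) (X v) = X ((N ^^ n) v)"
  by (rule funpow_commute) (simp add: compatible_def)

lemmas Nn_endo = endo_funpow[OF N_endo]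

lemma z_Nn: "z v = a \<star> v \<Longrightarrow> z ((N ^^ n) v) = (\<kappa> ^ n * a) \<star> (N ^^ n) v"
  by (induction n) (simp_all add: z_N lin_scale[OF N_endo] mult_ac)

lemma eproj_N: "eproj (\<kappa> ^ n * a) ((N ^^ n) v) = (N ^^ n) (eproj a v)"
proof (induction n)
  case (Suc n)
  then show ?case
    using eigenproj_twist[OF z_diag N_endo z_N \<kappa>_nonzero, of "\<kappa> ^ n * a" "(N ^^ n) v"]
    by (simp add: mult_ac)
qed simp

lemma G_Nn: "(\<And>v. g (N v) = k \<star> N (g v)) \<Longrightarrow> endo scale g \<Longrightarrow> g ((N ^^ n) v) = k ^ n \<star> (N ^^ n) (g v)"
  by (induction n) (simp_all add: lin_scale[OF N_endo] mult_ac)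

text \<open>The eigenprojection is a polynomial in \<open>z\<close>, and \<open>z\<close> belongs to
  \<open>G\<close>, so traces on eigenspaces are combinations of traces of group elements.\<close>

lemma trace_eproj:
  assumes tr_eq: "\<And>g. g \<in> G \<Longrightarrow> tr (\<lambda>v. g (f1 v)) = tr (\<lambda>v. g (f2 v))" and g: "g \<in> G"
  shows "tr (\<lambda>v. g (eproj a (f1 v))) = tr (\<lambda>v. g (eproj a (f2 v)))"
proof -
  have "tr (\<lambda>v. g (eproj a (f v))) =
      (\<Sum>i\<le>degree (eigenpoly z a). coeff (eigenpoly z a) i * tr (\<lambda>v. g ((z ^^ i) (f v))))" for f
    unfolding eigenproj_def pev_def
    by (simp add: lin_sum[OF G_endo[OF g]] lin_scale[OF G_endo[OF g]] trace_Sum trace_scale)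
  moreover have "tr (\<lambda>v. g ((z ^^ i) (f1 v))) = tr (\<lambda>v. g ((z ^^ i) (f2 v)))" for i
    by (rule tr_eq[OF G_comp[OF g G_funpow[OF z_in_G]]])
  ultimately show ?thesis by simp
qed

text \<open>\<open>X\<close> inverts \<open>N^k\<close> from the \<open>a\<close>-eigenspace, of
  weight \<open>k\<close>, to an eigenspace of weight \<open>-k\<close>, and is extended by zero via
  \<open>eproj\<close>. The last clause is uniqueness, from which linearity and every commutation
  rule of \<open>X\<close> follow.\<close>

lemma lefschetz_inverse_exists:
  assumes v0: "v0 \<noteq> 0" "z v0 = a \<star> v0" "wt a = int k"
  obtains X where "endo scale X" "\<And>v. z (X v) = a \<star> X v"
    "\<And>v. (N ^^ k) (X v) = eproj (\<kappa> ^ k * a) v"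
    "\<And>v x. z x = a \<star> x \<Longrightarrow> (N ^^ k) x = eproj (\<kappa> ^ k * a) v \<Longrightarrow> X v = x"
proof -
  have "\<exists>x. z x = a \<star> x \<and> (N ^^ k) x = eproj (\<kappa> ^ k * a) v" for v
  proof (cases "eproj (\<kappa> ^ k * a) v = 0")
    case True
    then show ?thesis by (intro exI[of _ 0]) (simp add: lin_zero[OF z_endo] lin_zero[OF Nn_endo])
  next
    case False
    have "wt (\<kappa> ^ k * a) = - int k" using wt_shift[OF v0(1,2), of k] v0(3) by simp
    then show ?thesis using lefschetz_surj[OF False eigenproj_eigen[OF z_diag], of k] \<kappa>_nonzero by simp
  qed
  then obtain X where X: "\<And>v. z (X v) = a \<star> X v" "\<And>v. (N ^^ k) (X v) = eproj (\<kappa> ^ k * a) v"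
    by metis
  have uniq: "X v = x" if "z x = a \<star> x" "(N ^^ k) x = eproj (\<kappa> ^ k * a) v" for v x
  proof -
    have "X v - x = 0"
      by (rule lefschetz_inj[of _ a k])
        (simp_all add: that X lin_diff[OF z_endo] lin_diff[OF Nn_endo] scale_right_diff_distrib v0(3))
    then show ?thesis by simp
  qed
  have "X (v + w) = X v + X w" for v w
    by (rule uniq) (simp_all add: X lin_add[OF z_endo] lin_add[OF Nn_endo] lin_add[OF eproj_endo]
        scale_right_distrib)
  moreover have "X (b \<star> v) = b \<star> X v" for b v
    by (rule uniq) (simp_all add: X lin_scale[OF z_endo] lin_scale[OF Nn_endo] lin_scale[OF eproj_endo]
        mult.commute)
  ultimately have "endo scale X" by (simp add: endo_iff)
  then show ?thesis using that X uniq by blast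
qed

text \<open>An equivariant map on the \<open>a\<close>-eigenspace of \<open>z\<close>, of highest weight \<open>k\<close>, extends to the
  \<open>N\<close>-strings through it by \<open>N\<^sup>j v \<mapsto> N\<^sup>j (C v)\<close>; \<open>X\<close> inverts \<open>N\<^sup>k\<close> on this eigenspace.\<close>

definition extend :: "('b \<Rightarrow> 'b) \<Rightarrow> nat \<Rightarrow> ('b \<Rightarrow> 'b) \<Rightarrow> 'b \<Rightarrow> 'b" where
  "extend X k C v = (\<Sum>j\<le>k. (N ^^ j) (C (X ((N ^^ (k - j)) v))))"

text \<open>An irreducible piece common to both eigenspaces of highest weight \<open>k\<close>
  generates under \<open>N\<close> a string in each of the two summands, and \<open>A\<close> and
  \<open>B\<close> match these strings. Highest weight ensures that \<open>N^(k+1)\<close> kills the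
  strings and that nothing maps onto their top.\<close>

lemma common_summand_step:
  assumes f1: "compatible f1" "\<And>v. f1 (f1 v) = f1 v" and f2: "compatible f2" "\<And>v. f2 (f2 v) = f2 v"
    and tr_eq: "\<And>g. g \<in> G \<Longrightarrow> tr (\<lambda>v. g (f1 v)) = tr (\<lambda>v. g (f2 v))"
    and nz: "f1 v0 \<noteq> 0"
  obtains A B w where "compatible A" "compatible B"
    "\<And>v. f2 (A v) = A v" "\<And>v. A (f1 v) = A v" "\<And>v. f1 (B v) = B v" "\<And>v. B (f2 v) = B v"
    "\<And>v. B (A (B (A v))) = B (A v)" "w \<noteq> 0" "B (A w) = w"
proof -
  note e1 = compatible_equivariant[OF f1(1)] and e2 = compatible_equivariant[OF f2(1)]
  define S where "S = {a. \<exists>v. v \<noteq> 0 \<and> z v = a \<star> v \<and> f1 v = v}"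
  have finS: "finite S"
    by (rule finite_subset[OF _ finite_eigenvalues[OF z_diag]]) (auto simp: S_def)
  have S_intro: "a \<in> S" if "z v = a \<star> v" "f1 v \<noteq> 0" for a v
    unfolding S_def using that f1(2) equivariant_commute[OF e1 z_in_G, of v]
      lin_scale[OF compatible_endo[OF f1(1)]] by (intro CollectI exI[of _ "f1 v"]) simp
  have "S \<noteq> {}"
  proof
    assume "S = {}"
    obtain A where "finite A" "\<And>v. (\<Sum>a\<in>A. eproj a v) = v" using eigenproj_sum[OF z_diag] by blast
    then have "f1 v0 = (\<Sum>a\<in>A. f1 (eproj a v0))" by (metis lin_sum[OF compatible_endo[OF f1(1)]])
    then show False using nz S_intro[OF eigenproj_eigen[OF z_diag]] \<open>S = {}\<close>
      by (auto intro: sum.neutral)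
  qed
  define M where "M = Max (wt ` S)"
  have "M \<in> wt ` S" unfolding M_def using finS \<open>S \<noteq> {}\<close> by (intro Max_in) auto
  then obtain a v1 where a: "wt a = M" "v1 \<noteq> 0" "z v1 = a \<star> v1" "f1 v1 = v1" by (auto simp: S_def)
  have max1: "wt b \<le> M" if "z v = b \<star> v" "f1 v \<noteq> 0" for b v
    unfolding M_def using finS S_intro[OF that] by auto
  \<comment> \<open>If \<open>b\<close> does not occur under \<open>f1\<close>, the idempotent
    \<open>eproj b f2\<close> has trace zero by equality of traces, hence vanishes; so both sides
    share the bound \<open>M\<close>.\<close>
  have max2: "wt b \<le> M" if v: "z v = b \<star> v" "f2 v \<noteq> 0" for b v
  proof (rule ccontr)
    assume "\<not> wt b \<le> M"
    then have "f1 (eproj b x) = 0" for x using max1[OF eigenproj_eigen[OF z_diag]] by blast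
    then have "eproj b (f1 x) = 0" for x by (simp add: eproj_central[OF e1])
    then have "tr (\<lambda>v. eproj b (f2 v)) = 0"
      using trace_eproj[of f1 f2 "\<lambda>v. v" b] tr_eq G_id by (simp add: trace_zero)
    then have "eproj b (f2 v) = 0"
      by (intro trace_idempotent_nonzero lin_comp[OF compatible_endo[OF f2(1)] eproj_endo])
        (simp_all add: eproj_central[OF e2] f2(2) eigenproj_idem[OF z_diag])
    then show False using v by (simp add: eproj_central[OF e2] eigenproj_id[OF z_diag])
  qed
  \<comment> \<open>An eigenvalue \<open>a / \<kappa>\<close> would have weight
    \<open>M + 2\<close>.\<close>
  have no_higher: "f (eproj (a / \<kappa>) x) = 0" if f: "f = f1 \<or> f = f2" for f x
  proof (rule ccontr)
    assume *: "f (eproj (a / \<kappa>) x) \<noteq> 0"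
    let ?u = "eproj (a / \<kappa>) x"
    have u: "z ?u = (a / \<kappa>) \<star> ?u" by (rule eigenproj_eigen[OF z_diag])
    have "?u \<noteq> 0" using * f lin_zero[OF compatible_endo[OF f1(1)]] lin_zero[OF compatible_endo[OF f2(1)]] by auto
    from wt_shift[OF this u, of 1] have "wt (a / \<kappa>) = M + 2" using \<kappa>_nonzero a(1) by simp
    moreover have "wt (a / \<kappa>) \<le> M" using max1[OF u] max2[OF u] * f by blast
    ultimately show False by simp
  qed
  \<comment> \<open>Surjectivity of \<open>N^k\<close> onto weight \<open>-k\<close> produces a
    vector of weight \<open>k\<close>, so a negative weight is never the highest.\<close>
  have "M \<ge> 0"
  proof (rule ccontr)
    assume "\<not> M \<ge> 0"
    then obtain k where k: "wt a = - int k" "k > 0" using a(1)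
      by (metis add.inverse_inverse neg_0_less_iff_less not_le zero_less_imp_eq_int)
    obtain u where u: "z u = (a / \<kappa> ^ k) \<star> u" "(N ^^ k) u = v1"
      using lefschetz_surj[OF a(2,3) k(1)] by blast
    have u0: "f1 u \<noteq> 0"
      using compatible_funpow[OF f1(1), of k u] u(2) a(2,4) lin_zero[OF Nn_endo] by auto
    then have "u \<noteq> 0" using lin_zero[OF compatible_endo[OF f1(1)]] by auto
    from wt_shift[OF this u(1), of k] have "wt (a / \<kappa> ^ k) = wt a + 2 * int k"
      using \<kappa>_nonzero by simp
    then show False using max1[OF u(1) u0] k a(1) by simp
  qed
  then obtain k where k: "wt a = int k" using a(1) nonneg_int_cases by metis
  define c where "c = eproj a"
  obtain T where T: "averaging scale G c T" using averaging_exists[OF a(2,3)] unfolding c_def by blast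
  have c_eigen: "z (c v) = a \<star> c v" for v unfolding c_def by (rule eigenproj_eigen[OF z_diag])
  have c1: "f1 (c v1) \<noteq> 0" using a by (simp add: c_def eigenproj_id[OF z_diag])
  have tr_c: "tr (\<lambda>v. g (c (f1 v))) = tr (\<lambda>v. g (c (f2 v)))" if "g \<in> G" for g
    unfolding c_def using trace_eproj[of f1 f2 g a] tr_eq that by blast
  obtain A0 B0 w where A0: "equivariant A0" and B0: "equivariant B0"
    and cA0: "\<And>v. c (A0 v) = A0 v" and f2A0: "\<And>v. f2 (A0 v) = A0 v" and A0f1: "\<And>v. A0 (f1 v) = A0 v"
    and cB0: "\<And>v. c (B0 v) = B0 v" and f1B0: "\<And>v. f1 (B0 v) = B0 v" and B0f2: "\<And>v. B0 (f2 v) = B0 v"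
    and BA0: "\<And>v. B0 (A0 (B0 (A0 v))) = B0 (A0 v)" and w: "w \<noteq> 0" "c w = w" "B0 (A0 w) = w"
    by (rule averaging.trace_eq_imp_common_summand[OF T e1 f1(2) e2 f2(2) tr_c c1]) (assumption, rule that)
  obtain X where X: "endo scale X" "\<And>v. z (X v) = a \<star> X v"
    "\<And>v. (N ^^ k) (X v) = eproj (\<kappa> ^ k * a) v"
    "\<And>v x. z x = a \<star> x \<Longrightarrow> (N ^^ k) x = eproj (\<kappa> ^ k * a) v \<Longrightarrow> X v = x"
    using lefschetz_inverse_exists[OF a(2,3) k] by blast
  have X_compat: "X (f v) = f (X v)" if f: "compatible f" for f v
  proof (rule X(4))
    show "z (f (X v)) = a \<star> f (X v)"
      using equivariant_commute[OF compatible_equivariant[OF f] z_in_G, of "X v"]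
      by (simp add: X(2) lin_scale[OF compatible_endo[OF f]])
    show "(N ^^ k) (f (X v)) = eproj (\<kappa> ^ k * a) (f v)"
      by (simp add: compatible_funpow[OF f] X(3) eproj_central[OF compatible_equivariant[OF f]])
  qed
  \<comment> \<open>Distinct steps of a string have distinct eigenvalues
    \<open>\<kappa>^m * a\<close>, since \<open>\<kappa>\<close> is not a root of unity; hence
    \<open>X\<close> picks out the bottom step.\<close>
  have XN: "X ((N ^^ m) v) = (if m = k then v else 0)" if v: "z v = a \<star> v" for m v
  proof (rule X(4))
    show "z (if m = k then v else 0) = a \<star> (if m = k then v else 0)"
      using v by (simp add: lin_zero[OF z_endo])
    show "(N ^^ k) (if m = k then v else 0) = eproj (\<kappa> ^ k * a) ((N ^^ m) v)"
    proof (cases "m = k")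
      case True
      then show ?thesis by (simp add: eproj_N eigenproj_id[OF z_diag v])
    next
      case False
      have "\<kappa> ^ m \<noteq> \<kappa> ^ k"
      proof -
        have "\<kappa> ^ i \<noteq> \<kappa> ^ j" if "i < j" for i j
          using \<kappa>_not_root_of_unity[of "j - i"] that power_add[of \<kappa> i "j - i"] \<kappa>_nonzero by auto
        then show ?thesis using False by (metis linorder_neqE_nat)
      qed
      moreover have "a \<noteq> 0" by (rule eigenvalue_nonzero[OF a(2,3)])
      ultimately have "\<kappa> ^ m * a \<noteq> \<kappa> ^ k * a" by simp
      from eigenproj_other[OF z_diag z_Nn[OF v] this] False
      show ?thesis by (simp add: lin_zero[OF Nn_endo])
    qed
  qed
  have ext_endo: "endo scale (extend X k C)" if "endo scale C" for C
    unfolding extend_def[abs_def]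
    by (rule endo_Sum) (rule lin_comp[OF lin_comp[OF lin_comp[OF Nn_endo X(1)] that] Nn_endo])
  have ext_equiv: "equivariant (extend X k C)" if C: "equivariant C" for C
  proof (rule equivariantI[OF ext_endo[OF equivariant_endo[OF C]]])
    fix g v assume g: "g \<in> G"
    obtain b where b: "b \<noteq> 0" "\<And>v. g (N v) = b \<star> N (g v)" using N_twist[OF g] by blast
    note gN = G_Nn[OF b(2) G_endo[OF g]]
    have gX: "g (X v) = inverse (b ^ k) \<star> X (g v)" for v
    proof -
      have "X (inverse (b ^ k) \<star> g v) = g (X v)"
      proof (rule X(4))
        show "z (g (X v)) = a \<star> g (X v)"
          by (simp add: z_central[OF g] X(2) lin_scale[OF G_endo[OF g]])
        have "g ((N ^^ k) (X v)) = b ^ k \<star> (N ^^ k) (g (X v))" by (rule gN)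
        then have "(N ^^ k) (g (X v)) = inverse (b ^ k) \<star> g ((N ^^ k) (X v))" using b(1) by simp
        then show "(N ^^ k) (g (X v)) = eproj (\<kappa> ^ k * a) (inverse (b ^ k) \<star> g v)"
          by (simp add: X(3) lin_scale[OF eproj_endo] equivariant_commute[OF eproj_equivariant g])
      qed
      then show ?thesis by (simp add: lin_scale[OF X(1)])
    qed
    \<comment> \<open>\<open>N^j\<close>, \<open>X\<close> and \<open>N^(k-j)\<close> contribute the
      scalars \<open>b^j\<close>, \<open>b^-k\<close> and \<open>b^(k-j)\<close>, so the twists
      cancel in each summand.\<close>
    have "g ((N ^^ j) (C (X ((N ^^ (k - j)) v)))) = (N ^^ j) (C (X ((N ^^ (k - j)) (g v))))" if "j \<le> k" for j
    proof -
      have "g ((N ^^ j) (C (X ((N ^^ (k - j)) v)))) =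
          (b ^ j * inverse (b ^ k) * b ^ (k - j)) \<star> (N ^^ j) (C (X ((N ^^ (k - j)) (g v))))"
        by (simp add: gN equivariant_commute[OF C g] gX lin_scale[OF X(1)] mult.assoc
            lin_scale[OF equivariant_endo[OF C]] lin_scale[OF Nn_endo])
      also have "b ^ j * inverse (b ^ k) * b ^ (k - j) = 1"
        using that b(1) by (simp add: field_simps flip: power_add)
      finally show ?thesis by simp
    qed
    then show "g (extend X k C v) = extend X k C (g v)"
      by (simp add: extend_def lin_sum[OF G_endo[OF g]])
  qed
  have ext_N: "compatible (extend X k C)"
    if C: "equivariant C" and "\<And>v. (N ^^ Suc k) (C v) = 0" "\<And>v. C (X ((N ^^ Suc k) v)) = 0" for C
    unfolding compatible_def
  proof (intro conjI allI ext_equiv[OF C])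
    fix v
    \<comment> \<open>Commuting with \<open>N\<close> shifts the sum by one index; only the end
      terms \<open>F 0\<close> and \<open>F (Suc k)\<close> could obstruct, and they vanish by the
      two hypotheses on \<open>C\<close>.\<close>
    define F where "F j = (N ^^ j) (C (X ((N ^^ (Suc k - j)) v)))" for j
    have "F 0 + (\<Sum>j\<le>k. F (Suc j)) = (\<Sum>j\<le>k. F j) + F (Suc k)"
      by (simp flip: sum.atMost_Suc sum.atMost_Suc_shift)
    moreover have "F 0 = 0" "F (Suc k) = 0" using that(2,3) by (simp_all add: F_def)
    ultimately have "(\<Sum>j\<le>k. F (Suc j)) = (\<Sum>j\<le>k. F j)" by simp
    moreover have "N (extend X k C v) = (\<Sum>j\<le>k. F (Suc j))"
      by (simp add: extend_def lin_sum[OF N_endo] F_def)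
    moreover have "extend X k C (N v) = (\<Sum>j\<le>k. F j)"
      unfolding extend_def F_def
      by (rule sum.cong) (simp_all add: Suc_diff_le funpow_swap1)
    ultimately show "N (extend X k C v) = extend X k C (N v)" by simp
  qed
  have ext_comp: "extend X k C (extend X k D v) = extend X k (\<lambda>v. C (D v)) v"
    if C: "endo scale C" and D: "\<And>v. c (D v) = D v" for C D v
  proof -
    have "(N ^^ i) (C (X ((N ^^ (k - i)) (extend X k D v)))) =
        (N ^^ i) (C (D (X ((N ^^ (k - i)) v))))" if i: "i \<le> k" for i
    proof -
      have "X ((N ^^ (k - i)) (extend X k D v)) =
          (\<Sum>j\<le>k. X ((N ^^ (k - i)) ((N ^^ j) (D (X ((N ^^ (k - j)) v))))))"
        by (simp add: extend_def lin_sum[OF Nn_endo] lin_sum[OF X(1)])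
      \<comment> \<open>By \<open>XN\<close> only the term with \<open>k - i + j = k\<close>
        survives, so the double sum collapses to its diagonal.\<close>
      also have "\<dots> = (\<Sum>j\<le>k. if j = i then D (X ((N ^^ (k - j)) v)) else 0)"
      proof (rule sum.cong[OF refl])
        fix j assume "j \<in> {..k}"
        have "z (D x) = a \<star> D x" for x using c_eigen[of "D x"] D by simp
        note XN' = XN[OF this, of "k - i + j" "X ((N ^^ (k - j)) v)", unfolded funpow_add o_apply]
        have "k - i + j = k \<longleftrightarrow> j = i" using i by linarith
        then show "X ((N ^^ (k - i)) ((N ^^ j) (D (X ((N ^^ (k - j)) v))))) =
            (if j = i then D (X ((N ^^ (k - j)) v)) else 0)"
          unfolding XN' by simp
      qed
      also have "\<dots> = D (X ((N ^^ (k - i)) v))" using i by simp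
      finally show ?thesis by simp
    qed
    then show ?thesis by (subst extend_def) (simp add: extend_def)
  qed
  \<comment> \<open>\<open>N^(k+1) v\<close> has weight \<open>-k-2\<close>, so it equals
    \<open>N^(k+2) u\<close> for some \<open>u\<close> with eigenvalue \<open>a / \<kappa>\<close>;
    but \<open>f\<close> kills such \<open>u\<close>.\<close>
  have top1: "(N ^^ Suc k) v = 0" if f: "f = f1 \<or> f = f2" and v: "c v = v" "f v = v" for f v
  proof (rule ccontr)
    let ?y = "(N ^^ Suc k) v"
    assume "?y \<noteq> 0"
    have cf: "compatible f" using f f1(1) f2(1) by blast
    have zv: "z v = a \<star> v" using c_eigen[of v] v by simp
    have "v \<noteq> 0" using \<open>?y \<noteq> 0\<close> lin_zero[OF Nn_endo] by metis
    then have "wt (\<kappa> ^ Suc k * a) = - int (Suc (Suc k))"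
      using wt_shift[OF _ zv, of "Suc k"] k by simp
    then obtain u where u: "z u = (\<kappa> ^ Suc k * a / \<kappa> ^ Suc (Suc k)) \<star> u" "(N ^^ Suc (Suc k)) u = ?y"
      using lefschetz_surj[OF \<open>?y \<noteq> 0\<close> z_Nn[OF zv]] by blast
    have "\<kappa> ^ Suc k * a / \<kappa> ^ Suc (Suc k) = a / \<kappa>" using \<kappa>_nonzero by simp
    then have "eproj (a / \<kappa>) u = u" using u(1) by (intro eigenproj_id[OF z_diag]) simp
    then have "f u = 0" using no_higher[OF f, of u] by simp
    moreover have "f ?y = ?y" using compatible_funpow[OF cf, of "Suc k" v] v(2) by simp
    ultimately have "?y = 0"
      using compatible_funpow[OF cf, of "Suc (Suc k)" u] u(2) lin_zero[OF Nn_endo] by metis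
    then show False using \<open>?y \<noteq> 0\<close> by simp
  qed
  \<comment> \<open>The component of \<open>N^(k+1) (f v)\<close> seen by \<open>X\<close> has
    eigenvalue \<open>\<kappa>^k * a\<close> and thus comes from the component of \<open>f v\<close>
    for \<open>a / \<kappa>\<close>, which is zero.\<close>
  have top2: "X ((N ^^ Suc k) (f v)) = 0" if f: "f = f1 \<or> f = f2" for f v
  proof (rule X(4))
    have cf: "compatible f" using f f1(1) f2(1) by blast
    have "eproj (\<kappa> ^ Suc k * (a / \<kappa>)) ((N ^^ Suc k) (f v)) = 0"
      unfolding eproj_N
      by (simp only: eproj_central[OF compatible_equivariant[OF cf]] no_higher[OF f] lin_zero[OF Nn_endo])
    then show "(N ^^ k) 0 = eproj (\<kappa> ^ k * a) ((N ^^ Suc k) (f v))"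
      using \<kappa>_nonzero by (simp add: lin_zero[OF Nn_endo])
  qed (simp add: lin_zero[OF z_endo])
  have A0X: "A0 (X ((N ^^ Suc k) v)) = 0" for v
  proof -
    have "A0 (X ((N ^^ Suc k) v)) = A0 (f1 (X ((N ^^ Suc k) v)))" by (simp only: A0f1)
    also have "f1 (X ((N ^^ Suc k) v)) = X ((N ^^ Suc k) (f1 v))"
      by (simp only: X_compat[OF f1(1)] compatible_funpow[OF f1(1)])
    finally show ?thesis using top2[of f1 v] by (simp add: lin_zero[OF equivariant_endo[OF A0]])
  qed
  have B0X: "B0 (X ((N ^^ Suc k) v)) = 0" for v
  proof -
    have "B0 (X ((N ^^ Suc k) v)) = B0 (f2 (X ((N ^^ Suc k) v)))" by (simp only: B0f2)
    also have "f2 (X ((N ^^ Suc k) v)) = X ((N ^^ Suc k) (f2 v))"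
      by (simp only: X_compat[OF f2(1)] compatible_funpow[OF f2(1)])
    finally show ?thesis using top2[of f2 v] by (simp add: lin_zero[OF equivariant_endo[OF B0]])
  qed
  define A where "A = extend X k A0"
  define B where "B = extend X k B0"
  have ext_left: "f (extend X k C v) = extend X k C v" if "compatible f" "\<And>v. f (C v) = C v" for f C v
    by (simp add: extend_def lin_sum[OF compatible_endo[OF that(1)]]
        compatible_funpow[OF that(1), symmetric] that(2))
  have ext_right: "extend X k C (f v) = extend X k C v" if "compatible f" "\<And>v. C (f v) = C v" for f C v
    by (simp add: extend_def compatible_funpow[OF that(1)] X_compat[OF that(1)] that(2))
  have BA: "B (A v) = extend X k (\<lambda>v. B0 (A0 v)) v" for v
    unfolding A_def B_def by (rule ext_comp[OF equivariant_endo[OF B0] cA0])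
  show ?thesis
  proof (rule that[of A B w])
    show "compatible A" unfolding A_def using top1[of f2 "A0 _"] cA0 f2A0
      by (intro ext_N A0 A0X) blast
    show "compatible B" unfolding B_def using top1[of f1 "B0 _"] cB0 f1B0
      by (intro ext_N B0 B0X) blast
    show "f2 (A v) = A v" "A (f1 v) = A v" "f1 (B v) = B v" "B (f2 v) = B v" for v
      unfolding A_def B_def using f2A0 A0f1 f1B0 B0f2 f1(1) f2(1) by (auto intro: ext_left ext_right)
    show "B (A (B (A v))) = B (A v)" for v
      unfolding BA using ext_comp[of "\<lambda>v. B0 (A0 v)" "\<lambda>v. B0 (A0 v)" v] BA0 cB0
        equivariant_endo[OF equivariant_comp[OF B0 A0]] by simp
    show "w \<noteq> 0" by (rule w(1))
    have zw: "z w = a \<star> w" using c_eigen[of w] w(2) by simp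
    have "B (A w) = (\<Sum>j\<le>k. if j = 0 then w else 0)"
      unfolding BA extend_def
      by (rule sum.cong[OF refl])
        (auto simp: XN[OF zw] w(3) lin_zero[OF Nn_endo] lin_zero[OF equivariant_endo[OF B0]]
          lin_zero[OF equivariant_endo[OF A0]])
    then show "B (A w) = w" by simp
  qed
qed

text \<open>Induction on the rank of \<open>f1\<close>. Removing the matched summands
  \<open>B A\<close> and \<open>A B\<close> leaves complementary idempotents whose traces still
  agree, because cyclicity exchanges \<open>g B A\<close> with \<open>A g B\<close>.\<close>

theorem trace_eq_imp_equivalent:
  assumes "compatible f1" "\<And>v. f1 (f1 v) = f1 v" and "compatible f2" "\<And>v. f2 (f2 v) = f2 v"
    and "\<And>g. g \<in> G \<Longrightarrow> tr (\<lambda>v. g (f1 v)) = tr (\<lambda>v. g (f2 v))"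
  shows "\<exists>A B. compatible A \<and> compatible B \<and> (\<forall>v. f2 (A v) = A v \<and> A (f1 v) = A v \<and>
    f1 (B v) = B v \<and> B (f2 v) = B v \<and> B (A v) = f1 v \<and> A (B v) = f2 v)"
  using assms
proof (induction "dim (range f1)" arbitrary: f1 f2 rule: less_induct)
  case less
  note f1 = less.prems(1,2) and f2 = less.prems(3,4) and tr_eq = less.prems(5)
  note l1 = compatible_endo[OF f1(1)] and l2 = compatible_endo[OF f2(1)]
  show ?case
  proof (cases "\<forall>v. f1 v = 0")
    case True
    then have "tr f2 = 0" using tr_eq[OF G_id] by (simp add: trace_zero)
    then have "f2 v = 0" for v by (rule trace_idempotent_nonzero[OF l2 f2(2)])
    moreover have "compatible (\<lambda>v. 0)"
      by (simp add: compatible_def equivariant_def endo_zero lin_zero[OF N_endo] lin_zero[OF G_endo])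
    ultimately show ?thesis using True by (intro exI[of _ "\<lambda>v. 0"]) simp
  next
    case False
    then obtain v0 where v0: "f1 v0 \<noteq> 0" by blast
    obtain A0 B0 w where A0: "compatible A0" and B0: "compatible B0"
      and rel0: "\<And>v. f2 (A0 v) = A0 v" "\<And>v. A0 (f1 v) = A0 v" "\<And>v. f1 (B0 v) = B0 v"
        "\<And>v. B0 (f2 v) = B0 v" "\<And>v. B0 (A0 (B0 (A0 v))) = B0 (A0 v)"
      and w: "w \<noteq> 0" "B0 (A0 w) = w"
      by (rule common_summand_step[OF f1 f2 tr_eq v0]) (assumption, rule that)
    \<comment> \<open>So far only \<open>B0 A0\<close> is known to be idempotent. After this
      replacement \<open>A B A = A\<close> and \<open>B A B = B\<close>, so \<open>A B\<close> is
      idempotent too.\<close>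
    define A where "A v = A0 (B0 (A0 v))" for v
    define B where "B v = B0 (A0 (B0 v))" for v
    have A: "compatible A" unfolding A_def[abs_def]
      by (intro compatible_comp[OF A0] compatible_comp[OF B0] A0)
    have B: "compatible B" unfolding B_def[abs_def]
      by (intro compatible_comp[OF B0] compatible_comp[OF A0] B0)
    note lA = compatible_endo[OF A] and lB = compatible_endo[OF B]
    have rel: "f2 (A v) = A v" "A (f1 v) = A v" "f1 (B v) = B v" "B (f2 v) = B v"
      "A (B (A v)) = A v" "B (A (B v)) = B v" for v
      by (simp_all add: A_def B_def rel0)
    define g1 where "g1 v = f1 v - B (A v)" for v
    define g2 where "g2 v = f2 v - A (B v)" for v
    have BA_0: "A 0 = 0" "B 0 = 0" by (simp_all add: lin_zero[OF lA] lin_zero[OF lB])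
    have g1: "compatible g1" "g1 (g1 v) = g1 v" for v
      unfolding g1_def[abs_def] using f1(1) A B
      by (auto intro: compatible_minus compatible_comp
          simp: lin_diff[OF l1] lin_diff[OF lA] lin_diff[OF lB] f1(2) rel BA_0)
    have g2: "compatible g2" "g2 (g2 v) = g2 v" for v
      unfolding g2_def[abs_def] using f2(1) A B
      by (auto intro: compatible_minus compatible_comp
          simp: lin_diff[OF l2] lin_diff[OF lA] lin_diff[OF lB] f2(2) rel BA_0)
    have tr_g: "tr (\<lambda>v. g (g1 v)) = tr (\<lambda>v. g (g2 v))" if g: "g \<in> G" for g
    proof -
      have "tr (\<lambda>v. g (B (A v))) = tr (\<lambda>v. A (g (B v)))"
        by (rule trace_cyclic[OF lA lin_comp[OF lB G_endo[OF g]]])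
      then show ?thesis
        unfolding g1_def g2_def
        by (simp add: lin_diff[OF G_endo[OF g]] trace_minus tr_eq[OF g]
            equivariant_commute[OF compatible_equivariant[OF A] g, symmetric])
    qed
    \<comment> \<open>The vector \<open>w\<close> lies in the range of \<open>f1\<close>, but
      \<open>g1\<close> kills it.\<close>
    have "dim (range g1) < dim (range f1)"
    proof -
      have sub: "subspace (range g1)" "subspace (range f1)"
        by (rule subspace_range[OF compatible_endo[OF g1(1)]], rule subspace_range[OF l1])
      have "f1 (g1 v) = g1 v" for v by (simp add: g1_def lin_diff[OF l1] f1(2) rel)
      then have "range g1 \<subseteq> range f1" by (metis image_subsetI rangeI)
      moreover have "w \<in> range f1" 
        using rel0(3)[of "A0 w"] w(2) by (metis rangeI)
      moreover have "w \<notin> range g1"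
      proof
        assume "w \<in> range g1"
        then have "g1 w = w" using g1(2) by auto
        moreover have "g1 w = 0" using rel0(3)[of "A0 w"] w(2) by (simp add: g1_def A_def B_def)
        ultimately show False using w(1) by simp
      qed
      ultimately have "range g1 \<subset> range f1" by blast
      then show ?thesis using sub by (intro dim_psubset) (simp add: span_eq_iff[THEN iffD2])
    qed
    from less.hyps[OF this g1 g2 tr_g] obtain A' B' where A': "compatible A'" and B': "compatible B'"
      and rel': "\<And>v. g2 (A' v) = A' v" "\<And>v. A' (g1 v) = A' v" "\<And>v. g1 (B' v) = B' v"
        "\<And>v. B' (g2 v) = B' v" "\<And>v. B' (A' v) = g1 v" "\<And>v. A' (B' v) = g2 v"
      by blast
    note lA' = compatible_endo[OF A'] and lB' = compatible_endo[OF B']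
    have ortho: "B (g2 v) = 0" "A (g1 v) = 0" "g1 (B v) = 0" "g2 (A v) = 0" for v
      by (simp_all add: g1_def g2_def lin_diff[OF lA] lin_diff[OF lB] rel)
    have f_g: "f2 (g2 v) = g2 v" "g2 (f2 v) = g2 v" "f1 (g1 v) = g1 v" "g1 (f1 v) = g1 v" for v
      by (simp_all add: g1_def g2_def lin_diff[OF l1] lin_diff[OF l2] f1(2) f2(2) rel)
    have cross: "B (A' v) = 0" "B' (A v) = 0" "A (B' v) = 0" "A' (B v) = 0" for v
      using ortho(1)[of "A' v"] rel'(1,3) rel'(4)[of "A v"] ortho(4) ortho(2)[of "B' v"]
        rel'(2)[of "B v"] ortho(3) by (simp_all add: lin_zero[OF lA'] lin_zero[OF lB'])
    have abs: "f2 (A' v) = A' v" "A' (f1 v) = A' v" "f1 (B' v) = B' v" "B' (f2 v) = B' v" for v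
      using f_g(1)[of "A' v"] rel'(1)[of v] f_g(4)[of v] rel'(2)[of "f1 v"] rel'(2)[of v]
        f_g(3)[of "B' v"] rel'(3)[of v] f_g(2)[of v] rel'(4)[of "f2 v"] rel'(4)[of v] by simp_all
    show ?thesis
    proof (intro exI conjI allI)
      show "compatible (\<lambda>v. A v + A' v)" "compatible (\<lambda>v. B v + B' v)"
        by (rule compatible_plus[OF A A'], rule compatible_plus[OF B B'])
    qed (simp_all add: lin_add[OF l1] lin_add[OF l2] lin_add[OF lA] lin_add[OF lB] lin_add[OF lA']
        lin_add[OF lB'] rel abs cross rel'(5,6), simp_all add: g1_def g2_def)
  qed
qed

end

section \<open>Weights of algebraic numbers\<close>

text \<open>A relaxation of \<open>weil_number\<close>: any nonzero polynomial and any radius are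
  allowed. It still determines the radius, and it passes to powers and rational multiples without
  recourse to minimal polynomials.\<close>

definition conjugates_abs :: "real \<Rightarrow> 'a::field_char_0 \<Rightarrow> bool" where
  "conjugates_abs c a \<longleftrightarrow> (\<exists>P :: rat poly. P \<noteq> 0 \<and> poly (map_poly of_rat P) a = 0 \<and>
     (\<forall>z::complex. poly (map_poly of_rat P) z = 0 \<longrightarrow> cmod z = c))"

lemma map_poly_of_rat_add: "map_poly of_rat (P + Q) = map_poly of_rat P + (map_poly of_rat Q :: 'a::field_char_0 poly)"
  by (rule poly_eqI) (simp add: coeff_map_poly of_rat_add)

lemma map_poly_of_rat_mult: "map_poly of_rat (P * Q) = map_poly of_rat P * (map_poly of_rat Q :: 'a::field_char_0 poly)"
  by (rule poly_eqI) (simp add: coeff_map_poly coeff_mult of_rat_sum of_rat_mult)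

lemma map_poly_of_rat_pCons:
  "map_poly of_rat (pCons a P) = pCons (of_rat a) (map_poly of_rat P :: 'a::field_char_0 poly)"
  by (rule map_poly_pCons) simp

lemma map_poly_of_rat_pcompose:
  "map_poly of_rat (P \<circ>\<^sub>p Q) = map_poly of_rat P \<circ>\<^sub>p (map_poly of_rat Q :: 'a::field_char_0 poly)"
  by (induction P) (simp_all add: pcompose_pCons map_poly_of_rat_add map_poly_of_rat_mult map_poly_of_rat_pCons)

lemma map_poly_of_rat_monom: "map_poly of_rat (monom c n) = (monom (of_rat c) n :: 'a::field_char_0 poly)"
  by (rule poly_eqI) (simp add: coeff_map_poly coeff_monom)

lemma map_poly_of_rat_eq_0: "map_poly of_rat P = (0 :: 'a::field_char_0 poly) \<longleftrightarrow> P = 0"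
  by (simp add: poly_eq_iff coeff_map_poly)

lemma degree_map_poly_of_rat: "degree (map_poly of_rat P :: 'a::field_char_0 poly) = degree P"
  by (rule degree_map_poly) simp

lemma poly_of_rat_scale:
  "poly (map_poly of_rat (P \<circ>\<^sub>p [:0, r:])) x = poly (map_poly of_rat P) (of_rat r * x :: 'a::field_char_0)"
  by (simp add: map_poly_of_rat_pcompose map_poly_of_rat_pCons poly_pcompose mult.commute)

text \<open>A common root in any extension prevents \<open>P\<close> and \<open>Q\<close> from being
  coprime over the rationals: an element \<open>D\<close> of least degree in the ideal they generate
  vanishes at \<open>a\<close>, hence is not constant, and each of its complex roots is shared. This
  links the two fields without an embedding.\<close>

lemma common_root_transfer:
  fixes a :: "'a::field_char_0"
  assumes "P \<noteq> 0" "Q \<noteq> 0" and a: "poly (map_poly of_rat P) a = 0" "poly (map_poly of_rat Q) a = 0"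
  obtains z :: complex where "poly (map_poly of_rat P) z = 0" "poly (map_poly of_rat Q) z = 0"
proof -
  define I where "I D \<longleftrightarrow> D \<noteq> 0 \<and> (\<exists>u v. D = u * P + v * Q)" for D
  have "I P" unfolding I_def using assms(1) by (metis add.right_neutral mult_1 mult_zero_left)
  define D where "D = (ARG_MIN degree D. I D)"
  have ID: "I D" and min: "\<And>R. I R \<Longrightarrow> degree D \<le> degree R"
    using arg_min_natI[of I P degree] arg_min_nat_le[of I _ degree] \<open>I P\<close> unfolding D_def by auto
  obtain u v where bez: "D = u * P + v * Q" using ID by (auto simp: I_def)
  have dvd: "D dvd R" if "R = s * P + t * Q" for R s t
  proof (rule ccontr)
    assume "\<not> D dvd R"
    then have nz: "R mod D \<noteq> 0" by (simp add: dvd_eq_mod_eq_0)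
    have "R mod D = R - (R div D) * D" by (rule minus_div_mult_eq_mod[symmetric])
    also have "\<dots> = (s - (R div D) * u) * P + (t - (R div D) * v) * Q"
      by (simp only: that bez algebra_simps)
    finally have "I (R mod D)" using nz unfolding I_def by blast
    then show False using min[of "R mod D"] degree_mod_less[of D R] ID nz by (auto simp: I_def)
  qed
  have D: "poly (map_poly of_rat D) a = 0"
    by (simp add: bez map_poly_of_rat_add map_poly_of_rat_mult a)
  have "degree D \<noteq> 0"
  proof
    assume "degree D = 0"
    then obtain c where c: "D = [:c:]" using degree_eq_zeroE by blast
    then show False using D ID by (auto simp: map_poly_of_rat_pCons I_def)
  qed
  then obtain z :: complex where z: "poly (map_poly of_rat D) z = 0"
    using alg_closed_imp_poly_has_root[of "map_poly of_rat D :: complex poly"]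
    by (auto simp: degree_map_poly_of_rat)
  have "D dvd P" "D dvd Q" using dvd[of P 1 0] dvd[of Q 0 1] by simp_all
  then have "poly (map_poly of_rat P) z = 0" "poly (map_poly of_rat Q) z = 0"
    using z by (auto simp: map_poly_of_rat_mult elim!: dvdE)
  then show ?thesis by (rule that)
qed

lemma conjugates_abs_unique:
  assumes "conjugates_abs c a" "conjugates_abs d a"
  shows "c = d"
proof -
  obtain P Q where "P \<noteq> 0" "poly (map_poly of_rat P) a = 0" "Q \<noteq> 0" "poly (map_poly of_rat Q) a = 0"
    and *: "\<forall>z::complex. poly (map_poly of_rat P) z = 0 \<longrightarrow> cmod z = c"
      "\<forall>z::complex. poly (map_poly of_rat Q) z = 0 \<longrightarrow> cmod z = d"
    using assms unfolding conjugates_abs_def by blast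
  then obtain z :: complex where "poly (map_poly of_rat P) z = 0" "poly (map_poly of_rat Q) z = 0"
    using common_root_transfer by metis
  then show ?thesis using * by auto
qed

lemma conjugates_abs_weight_unique:
  assumes "conjugates_abs (real q powr (real m * real_of_int (w + i) / 2)) a"
    "conjugates_abs (real q powr (real m * real_of_int (w + j) / 2)) a" and "q > 1" "m > 0"
  shows "i = j"
proof -
  have "real q powr (real m * real_of_int (w + i) / 2) = real q powr (real m * real_of_int (w + j) / 2)"
    using conjugates_abs_unique assms(1,2) by blast
  then have "real m * real_of_int (w + i) / 2 = real m * real_of_int (w + j) / 2"
    using assms(3) by (subst (asm) powr_inj) auto
  then show ?thesis using assms(4) by simp
qed

text \<open>Substituting \<open>x / r\<close> in the polynomial multiplies all its roots by
  \<open>r\<close>; an irrational factor would call for the polynomial of a product of two algebraic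
  numbers.\<close>

lemma conjugates_abs_scale:
  fixes a :: "'a::field_char_0"
  assumes "conjugates_abs c a" "r > 0"
  shows "conjugates_abs (real_of_rat r * c) (of_rat r * a)"
proof -
  obtain P where P: "P \<noteq> 0" "poly (map_poly of_rat P) a = 0"
    "\<And>z::complex. poly (map_poly of_rat P) z = 0 \<Longrightarrow> cmod z = c"
    using assms(1) unfolding conjugates_abs_def by blast
  define Q where "Q = P \<circ>\<^sub>p [:0, inverse r:]"
  have "Q \<noteq> 0" using P(1) assms(2) by (simp add: Q_def pcompose_eq_0_iff)
  moreover have "cmod z = real_of_rat r * c" if "poly (map_poly of_rat Q) z = 0" for z :: complex
  proof -
    have "cmod (z / of_rat r) = c"
      using P(3) that by (simp add: Q_def poly_of_rat_scale of_rat_inverse divide_inverse mult.commute)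
    moreover have "cmod (of_rat r) = real_of_rat r"
    proof -
      have "(of_rat r :: complex) = of_real (of_rat r)" by (cases r) (simp add: of_rat_rat)
      then show ?thesis using assms(2) by simp
    qed
    ultimately show ?thesis using assms(2) by (simp add: norm_divide field_simps)
  qed
  moreover have "poly (map_poly of_rat Q) (of_rat r * a) = 0"
  proof -
    have "of_rat (inverse r) * of_rat r = (1 :: 'a)"
      using assms(2) by (simp flip: of_rat_mult)
    then show ?thesis by (simp only: Q_def poly_of_rat_scale mult.assoc[symmetric] mult_1 P(2))
  qed
  ultimately show ?thesis unfolding conjugates_abs_def by blast
qed

text \<open>A nonzero \<open>c\<close> is part of a basis of \<complex> over the rationals.\<close>

lemma rat_linear_functional:
  fixes c :: complex
  assumes "c \<noteq> 0"
  obtains l :: "complex \<Rightarrow> rat" where "\<And>x y. l (x + y) = l x + l y" "\<And>r x. l (of_rat r * x) = r * l x"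
    "l c \<noteq> 0"
proof -
  interpret c: vector_space "\<lambda>r x. of_rat r * x :: complex"
    by (rule vector_space.intro) (simp_all add: distrib_left distrib_right of_rat_add of_rat_mult)
  interpret p: vector_space_pair "\<lambda>r x. of_rat r * x :: complex" "(*) :: rat \<Rightarrow> rat \<Rightarrow> rat"
    by (rule vector_space_pair.intro) (rule c.vector_space_axioms, rule vector_space_mult)
  obtain l where l: "Vector_Spaces.linear (\<lambda>r x. of_rat r * x :: complex) (*) l" "\<forall>x\<in>{c}. l x = 1"
    using p.linear_independent_extend[of "{c}" "\<lambda>_. 1"] assms by (auto simp: c.dependent_single)
  show ?thesis by (rule that[of l]) (simp_all add: lin_add[OF l(1)] lin_scale[OF l(1)] l(2))
qed

text \<open>For \<open>Q\<close> of minimal degree with \<open>P\<close> dividing \<open>Q(x\<^sup>m)\<close>, a root \<open>y\<close> of \<open>Q\<close> that is no \<open>m\<close>-th power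
  of a root of \<open>P\<close> could be removed over \<open>\<complex>\<close>; a \<open>\<rat>\<close>-linear functional \<open>\<complex> \<rightarrow> \<rat>\<close> applied to the
  coefficients then yields a rational polynomial of smaller degree.\<close>

lemma power_roots_poly:
  fixes P :: "rat poly"
  assumes P: "P \<noteq> 0" and m: "m > 0"
  obtains Q where "Q \<noteq> 0" "P dvd Q \<circ>\<^sub>p monom 1 m"
    "\<And>y::complex. poly (map_poly of_rat Q) y = 0 \<Longrightarrow> \<exists>z. poly (map_poly of_rat P) z = 0 \<and> y = z ^ m"
proof -
  let ?c = "map_poly of_rat :: rat poly \<Rightarrow> complex poly"
  let ?x = "monom 1 m :: complex poly"
  \<comment> \<open>Applied to coefficients, \<open>l\<close> commutes with multiplication by the
    rational polynomial \<open>P\<close>, so divisibility by \<open>P\<close> survives;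
    \<open>l\<close> is nonzero at the leading coefficient of \<open>R\<close> to keep
    \<open>Q\<close> nonzero.\<close>
  have descend: "\<exists>Q. Q \<noteq> 0 \<and> degree Q \<le> degree R \<and> P dvd Q \<circ>\<^sub>p monom 1 m"
    if R: "R \<noteq> 0" "?c P dvd R \<circ>\<^sub>p ?x" for R
  proof -
    obtain S where S: "R \<circ>\<^sub>p ?x = ?c P * S" using R(2) by (rule dvdE)
    obtain l where l: "\<And>x y. l (x + y) = l x + l y" "\<And>r x. l (of_rat r * x) = r * l x"
      "l (lead_coeff R) \<noteq> (0::rat)"
      by (rule rat_linear_functional[of "lead_coeff R"]) (use R(1) in simp, rule that)
    have l0: "l 0 = 0" using l(1)[of 0 0] by simp
    have lsum: "l (\<Sum>i\<in>I. g i) = (\<Sum>i\<in>I. l (g i))" for g and I :: "nat set"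
      by (induction I rule: infinite_finite_induct) (auto simp: l0 l(1))
    define Q where "Q = map_poly l R"
    have "coeff Q (degree R) \<noteq> 0" using l(3) by (simp add: Q_def coeff_map_poly l0)
    then have "Q \<noteq> 0" by auto
    moreover have "degree Q \<le> degree R" unfolding Q_def by (intro degree_le) (simp add: coeff_map_poly l0 coeff_eq_0)
    moreover have "Q \<circ>\<^sub>p monom 1 m = P * map_poly l S"
    proof -
      have add: "map_poly l (A + B) = map_poly l A + map_poly l B" for A B
        by (rule poly_eqI) (simp add: coeff_map_poly l0 l(1))
      have mon: "map_poly l (?x * A) = monom 1 m * map_poly l A" for A
        by (rule poly_eqI) (simp add: coeff_map_poly l0 coeff_monom_mult)
      have "map_poly l R' \<circ>\<^sub>p monom 1 m = map_poly l (R' \<circ>\<^sub>p ?x)" for R'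
        by (induction R') (simp_all add: pcompose_pCons map_poly_pCons l0 add mon)
      then have "Q \<circ>\<^sub>p monom 1 m = map_poly l (?c P * S)" by (simp add: Q_def S)
      also have "\<dots> = P * map_poly l S"
        by (rule poly_eqI) (simp add: coeff_mult coeff_map_poly l0 lsum l(2))
      finally show ?thesis .
    qed
    ultimately show ?thesis by (intro exI[of _ Q]) simp
  qed
  have lin_dvd: "[:- z, 1:] dvd [:- (z ^ m), 1:] \<circ>\<^sub>p ?x" for z
    by (simp add: poly_eq_0_iff_dvd[symmetric] poly_pcompose poly_monom)
  have "\<exists>R. R \<noteq> 0 \<and> ?c P dvd R \<circ>\<^sub>p ?x"
  proof -
    \<comment> \<open>Each factor \<open>x - z\<close> divides \<open>x^m - z^m\<close>, so the
      product of the \<open>y - z^m\<close> over the roots \<open>z\<close> with multiplicity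
      works.\<close>
    have "\<exists>R. R \<noteq> 0 \<and> A dvd R \<circ>\<^sub>p ?x" if "A \<noteq> 0" for A :: "complex poly"
      using that
    proof (induction "degree A" arbitrary: A)
      case 0
      then obtain c where "A = [:c:]" "c \<noteq> 0" by (metis degree_eq_zeroE pCons_0_0)
      then have "A dvd 1" by (simp add: is_unit_triv)
      then show ?case by (intro exI[of _ 1]) (simp add: pcompose_1)
    next
      case (Suc n)
      then obtain z where z: "poly A z = 0" using alg_closed_imp_poly_has_root[of A] by auto
      then obtain B where B: "A = [:- z, 1:] * B" by (auto simp: poly_eq_0_iff_dvd elim: dvdE)
      then have "B \<noteq> 0" using Suc.prems by auto
      then have "degree B = n" using Suc(2) unfolding B by (subst (asm) degree_mult_eq) auto
      then obtain R where R: "R \<noteq> 0" "B dvd R \<circ>\<^sub>p ?x" using Suc(1)[of B] \<open>B \<noteq> 0\<close> by blast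
      have "A dvd ([:- (z ^ m), 1:] * R) \<circ>\<^sub>p ?x"
        unfolding B pcompose_mult by (rule mult_dvd_mono[OF lin_dvd R(2)])
      moreover have "[:- (z ^ m), 1:] * R \<noteq> 0" unfolding mult_eq_0_iff using R(1) by simp
      ultimately show ?case by blast
    qed
    then show ?thesis using P by (simp add: map_poly_of_rat_eq_0)
  qed
  then obtain Q0 where Q0: "Q0 \<noteq> 0 \<and> P dvd Q0 \<circ>\<^sub>p monom 1 m" using descend by blast
  define Q where "Q = (ARG_MIN degree Q. Q \<noteq> 0 \<and> P dvd Q \<circ>\<^sub>p monom 1 m)"
  have Q: "Q \<noteq> 0" "P dvd Q \<circ>\<^sub>p monom 1 m"
    and min: "\<And>R. R \<noteq> 0 \<Longrightarrow> P dvd R \<circ>\<^sub>p monom 1 m \<Longrightarrow> degree Q \<le> degree R"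
    using arg_min_natI[of "\<lambda>Q. Q \<noteq> 0 \<and> P dvd Q \<circ>\<^sub>p monom 1 m", OF Q0, where m = degree]
      arg_min_nat_le[of "\<lambda>Q. Q \<noteq> 0 \<and> P dvd Q \<circ>\<^sub>p monom 1 m" _ degree]
    unfolding Q_def by blast+
  have "\<exists>z. poly (?c P) z = 0 \<and> y = z ^ m" if y: "poly (?c Q) y = 0" for y
  proof (rule ccontr)
    assume no: "\<not> ?thesis"
    obtain R where R: "?c Q = [:- y, 1:] * R" using y by (auto simp: poly_eq_0_iff_dvd elim: dvdE)
    have "?c Q \<noteq> 0" using Q(1) by (simp add: map_poly_of_rat_eq_0)
    then have "R \<noteq> 0" using R by auto
    then have "degree (?c Q) = Suc (degree R)" unfolding R by (subst degree_mult_eq) auto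
    then have deg: "degree R < degree Q" by (simp add: degree_map_poly_of_rat)
    have "?c P dvd ?c (Q \<circ>\<^sub>p monom 1 m)" using Q(2) by (auto simp: map_poly_of_rat_mult elim!: dvdE)
    then have dv: "?c P dvd ([:- y, 1:] \<circ>\<^sub>p ?x) * (R \<circ>\<^sub>p ?x)"
      by (simp only: map_poly_of_rat_pcompose map_poly_of_rat_monom of_rat_1 R pcompose_mult)
    \<comment> \<open>As \<open>y\<close> is no \<open>m\<close>-th power of a root of
      \<open>P\<close>, the polynomials \<open>P\<close> and \<open>x^m - y\<close> have no common
      complex root, so \<open>x^m - y\<close> may be cancelled.\<close>
    have "comaximal (?c P) ([:- y, 1:] \<circ>\<^sub>p ?x)"
    proof -
      have "comaximal A B" if "A \<noteq> 0" "\<And>z. poly A z = 0 \<Longrightarrow> poly B z \<noteq> 0" for A B :: "complex poly"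
        using that
      proof (induction "degree A" arbitrary: A)
        case 0
        then obtain c where "A = [:c:]" "c \<noteq> 0" by (metis degree_eq_zeroE pCons_0_0)
        then show ?case unfolding comaximal_def
          by (intro exI[of _ "[:inverse c:]"] exI[of _ 0]) (simp add: one_pCons)
      next
        case (Suc n)
        then obtain z where z: "poly A z = 0" using alg_closed_imp_poly_has_root[of A] by auto
        then obtain A' where A': "A = [:- z, 1:] * A'" by (auto simp: poly_eq_0_iff_dvd elim: dvdE)
        then have "A' \<noteq> 0" using Suc.prems by auto
        then have "degree A' = n" using Suc(2) unfolding A' by (subst (asm) degree_mult_eq) auto
        then have 1: "comaximal A' B" using Suc(1)[of A'] Suc.prems(2) \<open>A' \<noteq> 0\<close> by (auto simp: A')
        have "comaximal [:- z, 1:] B"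
        proof -
          have ring_id: "(- (K * C)) * L + K * B = K * (B - L * C)" for K C L B :: "complex poly"
            by (simp add: algebra_simps)
          have "poly B z \<noteq> 0" using Suc.prems(2) z by blast
          have "[:- z, 1:] dvd B - [:poly B z:]" by (simp add: poly_eq_0_iff_dvd[symmetric])
          then obtain C where "B - [:poly B z:] = [:- z, 1:] * C" by (rule dvdE)
          then have "B - [:- z, 1:] * C = [:poly B z:]" by (simp add: algebra_simps)
          then have "[:inverse (poly B z):] * (B - [:- z, 1:] * C) = 1"
            using \<open>poly B z \<noteq> 0\<close> by (simp add: one_pCons)
          then have "(- ([:inverse (poly B z):] * C)) * [:- z, 1:] + [:inverse (poly B z):] * B = 1"
            using ring_id by (simp only:)
          then show ?thesis unfolding comaximal_def by blast
        qed
        then show ?case unfolding A' using 1 by (meson comaximal_mult comaximal_sym)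
      qed
      moreover have "?c P \<noteq> 0" using P by (simp add: map_poly_of_rat_eq_0)
      moreover have "poly ([:- y, 1:] \<circ>\<^sub>p ?x) z \<noteq> 0" if "poly (?c P) z = 0" for z
        using no that by (auto simp: poly_pcompose poly_monom)
      ultimately show ?thesis by blast
    qed
    then obtain u v where uv: "u * ?c P + v * ([:- y, 1:] \<circ>\<^sub>p ?x) = 1" unfolding comaximal_def by blast
    have "R \<circ>\<^sub>p ?x = (u * ?c P + v * ([:- y, 1:] \<circ>\<^sub>p ?x)) * (R \<circ>\<^sub>p ?x)" by (simp only: uv mult_1)
    also have "\<dots> = ?c P * (u * (R \<circ>\<^sub>p ?x)) + v * (([:- y, 1:] \<circ>\<^sub>p ?x) * (R \<circ>\<^sub>p ?x))"
      by (simp only: algebra_simps)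
    finally have "?c P dvd R \<circ>\<^sub>p ?x" using dv by (metis dvd_add dvd_mult dvd_triv_left)
    then obtain Q' where "Q' \<noteq> 0" "degree Q' \<le> degree R" "P dvd Q' \<circ>\<^sub>p monom 1 m"
      using descend \<open>R \<noteq> 0\<close> by blast
    then show False using min deg by fastforce
  qed
  then show ?thesis using that Q by blast
qed

lemma conjugates_abs_power:
  fixes a :: "'a::field_char_0"
  assumes "conjugates_abs c a" "m > 0"
  shows "conjugates_abs (c ^ m) (a ^ m)"
proof -
  obtain P where P: "P \<noteq> 0" "poly (map_poly of_rat P) a = 0"
    "\<And>z::complex. poly (map_poly of_rat P) z = 0 \<Longrightarrow> cmod z = c"
    using assms(1) unfolding conjugates_abs_def by blast
  obtain Q where Q: "Q \<noteq> 0" "P dvd Q \<circ>\<^sub>p monom 1 m"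
    "\<And>y::complex. poly (map_poly of_rat Q) y = 0 \<Longrightarrow> \<exists>z. poly (map_poly of_rat P) z = 0 \<and> y = z ^ m"
    using power_roots_poly[OF P(1) assms(2)] by blast
  have "poly (map_poly of_rat (Q \<circ>\<^sub>p monom 1 m)) a = 0"
    using Q(2) P(2) by (auto simp: map_poly_of_rat_mult elim!: dvdE)
  then have "poly (map_poly of_rat Q) (a ^ m) = 0"
    by (simp add: map_poly_of_rat_pcompose map_poly_of_rat_monom poly_pcompose poly_monom)
  moreover have "cmod y = c ^ m" if "poly (map_poly of_rat Q) y = 0" for y :: complex
    using Q(3)[OF that] P(3) by (auto simp: norm_power)
  ultimately show ?thesis unfolding conjugates_abs_def using Q(1) by blast
qed

lemma weil_number_imp_conjugates_abs:
  "weil_number q m a \<Longrightarrow> conjugates_abs (real q powr (real_of_int m / 2)) a"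
  unfolding weil_number_def conjugates_abs_def by (metis not_irreducible_zero)

section \<open>The monodromy filtration and purity\<close>

context alg_fd_space
begin

lemma filtrationD:
  assumes "monodromy_filtration scale N M"
  shows "subspace (M k)" "i \<le> j \<Longrightarrow> v \<in> M i \<Longrightarrow> v \<in> M j"
    "v \<in> M k \<Longrightarrow> N v \<in> M (k - 2)"
    "v \<in> M (int n) \<Longrightarrow> (N ^^ n) v \<in> M (- int n - 1) \<Longrightarrow> v \<in> M (int n - 1)"
    "w \<in> M (- int n) \<Longrightarrow> \<exists>v\<in>M (int n). w - (N ^^ n) v \<in> M (- int n - 1)"
    "\<exists>a. M a = {0}" "\<exists>b. M b = UNIV"
  using assms unfolding monodromy_filtration_def
  by (simp_all add: monoD[THEN subsetD] image_subset_iff)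

lemma filtration_funpow:
  assumes "monodromy_filtration scale N M" "v \<in> M k"
  shows "(N ^^ n) v \<in> M (k - 2 * int n)"
proof (induction n)
  case (Suc n)
  then show ?case using filtrationD(3)[OF assms(1), of "(N ^^ n) v" "k - 2 * int n"]
    by (simp add: algebra_simps)
qed (simp add: assms)

lemma endo_twisted_funpow:
  assumes "endo scale f" "\<And>v. f (N v) = c \<star> N (f v)" "endo scale N"
  shows "f ((N ^^ n) v) = c ^ n \<star> (N ^^ n) (f v)"
  by (induction n) (simp_all add: assms(2) lin_scale[OF assms(3)] mult_ac)

text \<open>If \<open>f\<close> raises the filtration by at most \<open>d + 1\<close>, it raises it by at most \<open>d\<close>. The proof goes
  downwards in the index, since the graded piece of index \<open>k \<ge> 0\<close> is the image of \<open>N\<close> plus the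
  kernel of \<open>N\<^sup>k\<^sup>+\<^sup>1\<close>.\<close>

lemma monodromy_filtration_stable:
  assumes M: "monodromy_filtration scale N M" and N: "endo scale N"
    and f: "endo scale f" "\<And>v. f (N v) = c \<star> N (f v)" "c \<noteq> 0" and v: "v \<in> M k"
  shows "f v \<in> M k"
proof -
  note D = filtrationD[OF M]
  note fN = endo_twisted_funpow[OF f(1,2) N]
  obtain a where a: "M a = {0}" using D(6) ..
  obtain b where b: "M b = UNIV" using D(7) ..
  note ab = a b
  have top: "x \<in> M i" if "i \<ge> b" for x i using D(2)[OF that, of x] ab by simp
  define Sh where "Sh d \<longleftrightarrow> (\<forall>k. \<forall>v\<in>M k. f v \<in> M (k + int d))" for d
  \<comment> \<open>The filtration is zero up to \<open>a\<close> and everything from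
    \<open>b\<close> on, so a shift by \<open>b - a\<close> is harmless.\<close>
  have "Sh (nat (b - a))"
    unfolding Sh_def
  proof (intro allI ballI)
    fix k v assume v: "v \<in> M k"
    show "f v \<in> M (k + int (nat (b - a)))"
    proof (cases "k \<le> a")
      case True
      then have "v = 0" using D(2)[OF True v] ab by blast
      then show ?thesis by (simp add: lin_zero[OF f(1)] subspace_0 D(1))
    qed (intro top, simp)
  qed
  moreover have "Sh d" if Sh: "Sh (Suc d)" for d
  proof -
    have "f v \<in> M (k + int d)" if "v \<in> M k" for v k
      using that
    proof (induction "nat (b - k)" arbitrary: k v rule: less_induct)
      case less
      show ?case
      proof (cases "k \<ge> b")
        case True
        then show ?thesis by (intro top) simp
      next
        case False
        then have IH: "f x \<in> M (i + int d)" if "i > k" "x \<in> M i" for i x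
          using less.hyps[of i x] that by simp
        show ?thesis
        proof (cases "k \<ge> 0")
          case True
          \<comment> \<open>\<open>N^(n+1) v\<close> lies in index \<open>-n-2\<close>, so it agrees
            with \<open>N^(n+2) u\<close> up to index \<open>-n-3\<close>. Then
            \<open>v' = v - N u\<close> is primitive modulo lower terms, while \<open>u\<close> has
            index \<open>k + 2\<close> and is covered by the induction.\<close>
          define n where "n = nat k"
          have k: "k = int n" using True by (simp add: n_def)
          have "(N ^^ Suc n) v \<in> M (- int (n + 2))"
            using filtration_funpow[OF M less.prems, of "Suc n"] by (simp add: k algebra_simps)
          from D(5)[OF this] obtain u where u: "u \<in> M (int (n + 2))"
            "(N ^^ Suc n) v - (N ^^ (n + 2)) u \<in> M (- int (n + 2) - 1)" by blast
          define v' where "v' = v - N u"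
          have "N u \<in> M k" using D(3)[OF u(1)] by (simp add: k)
          then have v': "v' \<in> M k" unfolding v'_def by (intro subspace_diff D(1) less.prems)
          have "(N ^^ Suc n) v' = (N ^^ Suc n) v - (N ^^ (n + 2)) u"
            by (simp add: v'_def lin_diff[OF endo_funpow[OF N]] lin_diff[OF N] funpow_swap1)
          moreover have "- int (n + 2) - 1 = - int n - 3" by simp
          ultimately have "(N ^^ Suc n) v' \<in> M (- int n - 3)" using u(2) by metis
          then have "f ((N ^^ Suc n) v') \<in> M (- int n - 3 + int (Suc d))"
            using Sh unfolding Sh_def by blast
          then have "inverse (c ^ Suc n) \<star> f ((N ^^ Suc n) v') \<in> M (- int n - 3 + int (Suc d))"
            by (intro subspace_scale D(1))
          then have "(N ^^ Suc n) (f v') \<in> M (- int n - 3 + int (Suc d))"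
            using f(3) unfolding fN by (simp del: power_Suc funpow.simps)
          \<comment> \<open>A further \<open>N^d\<close> brings the image down to index
            \<open>-(d+n+1)-1\<close>, exactly where injectivity of \<open>N^(d+n+1)\<close> on the
            graded piece \<open>d+n+1\<close> lowers \<open>f v'\<close> by one step.\<close>
          from filtration_funpow[OF M this, of d]
          have "(N ^^ (d + Suc n)) (f v') \<in> M (- int (d + Suc n) - 1)"
            unfolding funpow_add o_apply by (simp add: algebra_simps)
          moreover have "f v' \<in> M (int (d + Suc n))"
          proof -
            have "f v' \<in> M (k + int (Suc d))" using Sh v' unfolding Sh_def by blast
            then show ?thesis by (simp add: k algebra_simps)
          qed
          ultimately have "f v' \<in> M (k + int d)"
            using D(4)[of "f v'" "d + Suc n"] by (simp add: k algebra_simps)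
          moreover have "f (N u) \<in> M (k + int d)"
          proof -
            have "f u \<in> M (k + 2 + int d)" using IH[of "k + 2" u] u(1) by (simp add: k add.commute)
            from D(3)[OF this] show ?thesis unfolding f(2) by (intro subspace_scale D(1)) (simp add: algebra_simps)
          qed
          ultimately have "f v' + f (N u) \<in> M (k + int d)" by (intro subspace_add D(1))
          then show ?thesis by (simp add: v'_def lin_diff[OF f(1)])
        next
          case False
          \<comment> \<open>For negative \<open>k\<close> the graded piece is the image of
            \<open>N^n\<close> from index \<open>n\<close>, to which the induction applies; the
            error of index \<open>k - 1\<close> can afford the weaker shift
            \<open>Suc d\<close>.\<close>
          define n where "n = nat (- k)"
          have k: "k = - int n" "n > 0" using False by (simp_all add: n_def)
          obtain u where u: "u \<in> M (int n)" "v - (N ^^ n) u \<in> M (- int n - 1)"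
            using D(5)[of v n] less.prems k by blast
          have "f (v - (N ^^ n) u) \<in> M (- int n - 1 + int (Suc d))"
            using Sh u(2) unfolding Sh_def by blast
          then have 1: "f (v - (N ^^ n) u) \<in> M (k + int d)" by (simp add: k algebra_simps)
          have "f u \<in> M (int n + int d)" using IH[OF _ u(1)] k by simp
          from filtration_funpow[OF M this, of n]
          have "(N ^^ n) (f u) \<in> M (k + int d)" by (simp add: k algebra_simps)
          then have "f ((N ^^ n) u) \<in> M (k + int d)" unfolding fN by (intro subspace_scale D(1))
          with 1 have "f (v - (N ^^ n) u) + f ((N ^^ n) u) \<in> M (k + int d)"
            by (intro subspace_add D(1))
          then show ?thesis by (simp add: lin_diff[OF f(1)])
        qed
      qed
    qed
    then show ?thesis unfolding Sh_def by blast
  qed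
  moreover have "Sh 0" if "Sh d" "\<And>d. Sh (Suc d) \<Longrightarrow> Sh d" for d
    using that by (induction d) auto
  ultimately have "Sh 0" by blast
  then show ?thesis using v unfolding Sh_def by simp
qed

lemma diagonalizable_funpow:
  assumes "diagonalizable s"
  shows "diagonalizable (s ^^ m)"
proof -
  note s = diagonalizable_endo[OF assms]
  obtain A where A: "finite A" "\<And>v. (\<Sum>a\<in>A. eigenproj s a v) = v"
    using eigenproj_sum[OF assms] by blast
  have "(s ^^ m) (eigenproj s a v) = a ^ m \<star> eigenproj s a v" for a v
    by (induction m) (simp_all add: eigenproj_eigen[OF assms] lin_scale[OF s] mult.commute)
  then have "(\<Sum>a\<in>A. eigenproj s a v) \<in> span {w. \<exists>b\<in>(\<lambda>a. a ^ m) ` A. (s ^^ m) w = b \<star> w}" for v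
    by (intro span_sum span_base) blast
  then show ?thesis
    by (intro diagonalizableI[of _ "(\<lambda>a. a ^ m) ` A"] endo_funpow s) (auto simp: A)
qed

lemma jordan_funpow:
  assumes "jordan_decomposition f s u"
  shows "jordan_decomposition (f ^^ m) (s ^^ m) (u ^^ m)"
proof -
  note J = jordan_decompositionD[OF assms]
  have su: "(s ^^ i) ((u ^^ j) v) = (u ^^ j) ((s ^^ i) v)" for i j v
    by (rule funpow_funpow_commute) (rule J(5))
  have "(f ^^ m) v = (s ^^ m) ((u ^^ m) v)" for v
  proof (induction m)
    case (Suc m)
    then show ?case using su[of m 1] by (simp add: J(4) su[of m 1, simplified, symmetric])
  qed simp
  then show ?thesis
    unfolding jordan_decomposition_def
    using su by (simp add: endo_funpow J(1) unipotent_funpow[OF J(1,2)] diagonalizable_funpow[OF J(3)])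
qed

lemma eigenvalue_mod_subspace_funpow:
  assumes g: "endo scale g" "\<And>v. v \<in> S \<Longrightarrow> g v \<in> S" and S: "subspace S" and y: "g y - a \<star> y \<in> S"
  shows "(g ^^ n) y - a ^ n \<star> y \<in> S"
proof (induction n)
  case (Suc n)
  have "g ((g ^^ n) y - a ^ n \<star> y) + a ^ n \<star> (g y - a \<star> y) \<in> S"
    by (intro subspace_add subspace_scale S g(2) Suc y)
  then show ?case
    by (simp add: lin_diff[OF g(1)] lin_scale[OF g(1)] scale_right_diff_distrib mult.commute)
qed (simp add: subspace_0[OF S])

end

text \<open>\<open>f\<close> is Frobenius, \<open>c\<close> the inverse of q, and \<open>W i\<close>
  the weight condition on \<open>m\<close>-th powers of eigenvalues on the graded piece
  \<open>i\<close>. Keeping \<open>W\<close> abstract separates the filtration from the arithmetic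
  of Weil numbers.\<close>

locale pure_filtration = alg_fd_space scale
  for scale :: "'a::{alg_closed_field, field_char_0} \<Rightarrow> 'b::ab_group_add \<Rightarrow> 'b" (infixr \<open>\<star>\<close> 75) +
  fixes N f s u :: "'b \<Rightarrow> 'b" and M :: "int \<Rightarrow> 'b set" and c :: 'a and m :: nat
    and W :: "int \<Rightarrow> 'a \<Rightarrow> bool"
  assumes N: "endo scale N" and M: "monodromy_filtration scale N M"
    and J: "jordan_decomposition f s u"
    and fN: "f (N v) = c \<star> N (f v)" and c: "c \<noteq> 0"
    and pure: "v \<in> M i \<Longrightarrow> v \<notin> M (i - 1) \<Longrightarrow> f v - a \<star> v \<in> M (i - 1) \<Longrightarrow> W i (a ^ m)"
    and W_unique: "W i a \<Longrightarrow> W j a \<Longrightarrow> i = j"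
begin

text \<open>With \<open>i\<close> the least index such that \<open>v\<close> is in
  \<open>M i\<close>, a polynomial in \<open>f\<close> turns \<open>v\<close> into some
  \<open>y\<close> that is an eigenvector of \<open>f\<close> modulo \<open>M (i - 1)\<close> and
  still an eigenvector of \<open>s ^^ m\<close> for \<open>a\<close>. Purity applies to the
  eigenvalue \<open>l\<close> of \<open>y\<close>.\<close>

lemma eigenvector_weight:
  assumes v: "(s ^^ m) v = a \<star> v" "v \<noteq> 0"
  obtains i where "W i a" "v \<in> M i" "v \<notin> M (i - 1)"
proof -
  note JD = jordan_decompositionD[OF J]
  note D = filtrationD[OF M]
  obtain lo where lo: "M lo = {0}" using D(6) ..
  obtain hi where hi: "M hi = UNIV" using D(7) ..
  note lohi = lo hi
  have ex: "\<exists>n. v \<in> M (lo + int n)"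
    by (rule exI[of _ "nat (hi - lo)"], rule D(2)[of hi]) (simp_all add: hi)
  define n where "n = (LEAST n. v \<in> M (lo + int n))"
  have n: "v \<in> M (lo + int n)" unfolding n_def using LeastI_ex[OF ex] .
  obtain j where j: "n = Suc j" using n v(2) lohi by (cases n) auto
  have "v \<notin> M (lo + int j)" using not_less_Least[of j "\<lambda>n. v \<in> M (lo + int n)"] j by (simp add: n_def)
  define i where "i = lo + int n"
  have i: "v \<in> M i" "v \<notin> M (i - 1)" using n \<open>v \<notin> M (lo + int j)\<close> by (simp_all add: i_def j)
  have stable: "f x \<in> M k" if "x \<in> M k" for x k
    by (rule monodromy_filtration_stable[OF M N JD(7) fN c that])
  have sf: "s (f x) = f (s x)" for x using JD(4,5) by simp
  have smf: "(s ^^ m) (f x) = f ((s ^^ m) x)" for x by (rule funpow_commute) (rule sf)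
  obtain Q l where Q: "pev f Q v \<notin> M (i - 1)" "f (pev f Q v) - l \<star> pev f Q v \<in> M (i - 1)"
    using eigenvector_mod_subspace[OF JD(7) D(1) i(2)] by blast
  define y where "y = pev f Q v"
  have yi: "y \<in> M i" unfolding y_def by (rule pev_mem[OF D(1) stable i(1)])
  have zy: "(s ^^ m) y = a \<star> y" unfolding y_def
    using pev_commute[OF endo_funpow[OF JD(6)], of f m Q v] smf v(1)
    by (simp add: lin_scale[OF endo_pev[OF JD(7)]])
  have y: "y \<notin> M (i - 1)" "f y - l \<star> y \<in> M (i - 1)" using Q by (simp_all add: y_def)
  have "W i (l ^ m)" by (rule pure[OF yi y])
  \<comment> \<open>\<open>f ^^ m - a\<close> acts on \<open>y\<close> modulo
    \<open>M (i - 1)\<close> as the scalar \<open>l ^ m - a\<close>, but some power of it kills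
    \<open>y\<close>, because eigenvectors of \<open>s ^^ m\<close> are generalized eigenvectors of
    \<open>f ^^ m\<close>.\<close>
  moreover have "l ^ m = a"
  proof (rule ccontr)
    assume "l ^ m \<noteq> a"
    define h where "h = (\<lambda>x. (f ^^ m) x - a \<star> x)"
    have h: "endo scale h" unfolding h_def
      by (rule lin_minus[OF endo_funpow[OF JD(7)]], rule lin_smult, rule endo_id)
    have fm: "(f ^^ k) x \<in> M (i - 1)" if "x \<in> M (i - 1)" for x k
      by (induction k) (use that stable in auto)
    have hS: "h x \<in> M (i - 1)" if "x \<in> M (i - 1)" for x
      unfolding h_def using that by (intro subspace_diff subspace_scale D(1) fm)
    have "(f ^^ m) y - l ^ m \<star> y \<in> M (i - 1)"
      by (rule eigenvalue_mod_subspace_funpow[OF JD(7) stable D(1) y(2)])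
    then have hy: "h y - (l ^ m - a) \<star> y \<in> M (i - 1)"
      by (simp add: h_def scale_left_diff_distrib)
    have hk: "(h ^^ k) y - (l ^ m - a) ^ k \<star> y \<in> M (i - 1)" for k
      by (rule eigenvalue_mod_subspace_funpow[OF h hS D(1) hy])
    obtain k where "(h ^^ k) y = 0"
      using jordan_eigen_imp_generalized[OF jordan_funpow[OF J] zy] unfolding h_def by blast
    then have "- ((l ^ m - a) ^ k \<star> y) \<in> M (i - 1)" using hk[of k] by simp
    then have "(l ^ m - a) ^ k \<star> y \<in> M (i - 1)" using subspace_neg[OF D(1)] by force
    then have "inverse ((l ^ m - a) ^ k) \<star> (l ^ m - a) ^ k \<star> y \<in> M (i - 1)"
      by (rule subspace_scale[OF D(1)])
    then show False using y(1) \<open>l ^ m \<noteq> a\<close> by simp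
  qed
  ultimately show ?thesis using that i by blast
qed

lemma pure_lefschetz_inj:
  assumes "(s ^^ m) v = a \<star> v" "W (int k) a" "(N ^^ k) v = 0"
  shows "v = 0"
proof (rule ccontr)
  assume "v \<noteq> 0"
  then obtain i where "W i a" and i: "v \<in> M i" "v \<notin> M (i - 1)" using eigenvector_weight assms(1) by blast
  then have "i = int k" using W_unique assms(2) by blast
  then show False
    using i filtrationD(4)[OF M, of v k] assms(3) by (simp add: subspace_0 filtrationD(1)[OF M])
qed

lemma funpow_twist: "(s ^^ m) (N v) = c ^ m \<star> N ((s ^^ m) v)"
proof -
  note sN = jordan_twisted_commute[OF J N fN]
  show ?thesis
    by (induction m)
      (simp_all add: sN lin_scale[OF jordan_decompositionD(6)[OF J]])
qed

text \<open>The filtration provides some \<open>u\<close> with \<open>N^k u\<close> equal to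
  \<open>v\<close> up to \<open>M (- k - 1)\<close>. Projecting \<open>u\<close> to the right
  eigenspace leaves an error with eigenvalue \<open>a\<close>, of weight \<open>-k\<close>, inside a
  step of the filtration that only admits smaller weights; so the error is zero.\<close>

lemma pure_lefschetz_surj:
  assumes v: "(s ^^ m) v = a \<star> v" "v \<noteq> 0" and "W (- int k) a"
  shows "\<exists>u. (s ^^ m) u = (a / (c ^ m) ^ k) \<star> u \<and> (N ^^ k) u = v"
proof -
  note JD = jordan_decompositionD[OF J]
  note D = filtrationD[OF M]
  note z = diagonalizable_funpow[OF JD(3), of m]
  obtain i where "W i a" "v \<in> M i" using eigenvector_weight[OF v] by blast
  then have "v \<in> M (- int k)" using W_unique[OF _ assms(3)] by blast
  then obtain u where u: "u \<in> M (int k)" "v - (N ^^ k) u \<in> M (- int k - 1)" using D(5) by blast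
  define u' where "u' = eigenproj (s ^^ m) (a / (c ^ m) ^ k) u"
  have "s x \<in> M j" if "x \<in> M j" for x j
    by (rule monodromy_filtration_stable[OF M N JD(6) jordan_twisted_commute[OF J N fN] c that])
  then have smM: "(s ^^ n) x \<in> M j" if "x \<in> M j" for x j n by (induction n) (use that in auto)
  have "eigenproj (s ^^ m) (((c ^ m) ^ n) * b) ((N ^^ n) x) = (N ^^ n) (eigenproj (s ^^ m) b x)" for n b x
  proof (induction n)
    case (Suc n)
    then show ?case
      using eigenproj_twist[OF z N funpow_twist, of "(c ^ m) ^ n * b" "(N ^^ n) x"] c by (simp add: mult_ac)
  qed simp
  from this[of k "a / (c ^ m) ^ k" u] have "eigenproj (s ^^ m) a ((N ^^ k) u) = (N ^^ k) u'"
    using c by (simp add: u'_def)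
  then have w: "eigenproj (s ^^ m) a (v - (N ^^ k) u) = v - (N ^^ k) u'"
    by (simp add: lin_diff[OF endo_eigenproj[OF z]] eigenproj_id[OF z v(1)])
  have "v - (N ^^ k) u' = 0"
  proof (rule ccontr)
    assume nz: "v - (N ^^ k) u' \<noteq> 0"
    have "(s ^^ m) (v - (N ^^ k) u') = a \<star> (v - (N ^^ k) u')"
      unfolding w[symmetric] by (rule eigenproj_eigen[OF z])
    then obtain i where i: "W i a" "v - (N ^^ k) u' \<notin> M (i - 1)" using eigenvector_weight nz by blast
    then have "i = - int k" using W_unique[OF _ assms(3)] by blast
    moreover have "v - (N ^^ k) u' \<in> M (- int k - 1)"
      unfolding w[symmetric] by (rule eigenproj_mem[OF D(1) smM u(2)])
    ultimately show False using i(2) by simp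
  qed
  then show ?thesis
    using eigenproj_eigen[OF z, of "a / (c ^ m) ^ k" u] by (intro exI[of _ u']) (simp add: u'_def)
qed

end

section \<open>The Weil group\<close>

locale local_galois =
  fixes absK :: "'k::{alg_closed_field, field_char_0} \<Rightarrow> real" and K :: "'k set" and \<phi> :: "'k \<Rightarrow> 'k"
  assumes absK: "nonarch_absolute_value absK"
    and q_pos: "residue_card absK K > 0"
    and \<phi>: "\<phi> \<in> geom_frobenius absK K"
begin

abbreviation "\<Gamma> \<equiv> gal_group K"
abbreviation "I \<equiv> inertia absK K"
abbreviation "q \<equiv> residue_card absK K"
abbreviation "W \<equiv> carrier (weil_group absK K)"

lemma abs_nonneg: "0 \<le> absK x" and abs_eq_0: "absK x = 0 \<longleftrightarrow> x = 0"
  and abs_mult: "absK (x * y) = absK x * absK y"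
  and abs_add: "absK (x + y) \<le> max (absK x) (absK y)"
  using absK unfolding nonarch_absolute_value_def by auto

lemma abs_1: "absK 1 = 1"
  using abs_mult[of 1 1] abs_eq_0[of 1] by simp

lemma abs_minus: "absK (- x) = absK x"
proof -
  have "absK (- 1) * absK (- 1) = 1" using abs_mult[of "- 1" "- 1"] abs_1 by simp
  then have "absK (- 1) = 1" using abs_nonneg[of "- 1"]
    by (metis abs_of_nonneg abs_square_eq_1 power2_eq_square)
  then show ?thesis using abs_mult[of "- 1" x] by simp
qed

lemma abs_diff_commute: "absK (x - y) = absK (y - x)"
  using abs_minus[of "x - y"] by simp

lemma abs_add_less: "absK x < r \<Longrightarrow> absK y < r \<Longrightarrow> absK (x + y) < r"
  using abs_add[of x y] by auto

lemma abs_inverse: "absK (inverse x) = inverse (absK x)"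
proof (cases "x = 0")
  case False
  then have "absK (inverse x) * absK x = 1" by (simp add: abs_1 flip: abs_mult)
  then show ?thesis by (metis inverse_unique mult.commute)
qed (simp add: abs_eq_0[THEN iffD2])

lemma abs_power: "absK (x ^ n) = absK x ^ n"
  by (induction n) (simp_all add: abs_1 abs_mult)

lemma galD:
  assumes "\<sigma> \<in> carrier \<Gamma>"
  shows "bij \<sigma>" "\<sigma> (x + y) = \<sigma> x + \<sigma> y" "\<sigma> (x * y) = \<sigma> x * \<sigma> y" "\<And>x. x \<in> K \<Longrightarrow> \<sigma> x = x"
    "\<sigma> 0 = 0" "\<sigma> 1 = 1" "\<sigma> (x - y) = \<sigma> x - \<sigma> y" "\<sigma> (inverse x) = inverse (\<sigma> x)"
    "\<sigma> x = 0 \<longleftrightarrow> x = 0"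
proof -
  show b: "bij \<sigma>" and add: "\<sigma> (x + y) = \<sigma> x + \<sigma> y" and mult: "\<sigma> (x * y) = \<sigma> x * \<sigma> y"
    and "\<And>x. x \<in> K \<Longrightarrow> \<sigma> x = x" for x y
    using assms by (auto simp: gal_group_def)
  show z: "\<sigma> 0 = 0" using add[of 0 0] by simp
  show zero: "\<sigma> x = 0 \<longleftrightarrow> x = 0" for x using b z by (metis bij_pointE)
  show one: "\<sigma> 1 = 1" using mult[of 1 1] zero[of 1] by simp
  show "\<sigma> (x - y) = \<sigma> x - \<sigma> y" using add[of "x - y" y] by simp
  show "\<sigma> (inverse x) = inverse (\<sigma> x)"
    by (cases "x = 0") (simp_all add: z, metis inverse_unique mult one right_inverse)
qed

lemma gal_simps: "one \<Gamma> = id" "mult \<Gamma> = (\<circ>)"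
  by (simp_all add: gal_group_def)

lemma gal_comp: "\<sigma> \<in> carrier \<Gamma> \<Longrightarrow> \<tau> \<in> carrier \<Gamma> \<Longrightarrow> \<sigma> \<circ> \<tau> \<in> carrier \<Gamma>"
  by (simp add: gal_group_def bij_comp)

lemma gal_id: "id \<in> carrier \<Gamma>"
  by (simp add: gal_group_def)

lemma gal_inv: "\<sigma> \<in> carrier \<Gamma> \<Longrightarrow> inv_into UNIV \<sigma> \<in> carrier \<Gamma>"
proof -
  assume s: "\<sigma> \<in> carrier \<Gamma>"
  note D = galD[OF s]
  have r: "\<sigma> (inv_into UNIV \<sigma> x) = x" and l: "inv_into UNIV \<sigma> (\<sigma> x) = x" for x
    using D(1) by (simp_all add: bij_is_surj surj_f_inv_f bij_is_inj)
  have "inv_into UNIV \<sigma> (x + y) = inv_into UNIV \<sigma> x + inv_into UNIV \<sigma> y" for x y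
    using l[of "inv_into UNIV \<sigma> x + inv_into UNIV \<sigma> y"] by (simp add: D(2) r)
  moreover have "inv_into UNIV \<sigma> (x * y) = inv_into UNIV \<sigma> x * inv_into UNIV \<sigma> y" for x y
    using l[of "inv_into UNIV \<sigma> x * inv_into UNIV \<sigma> y"] by (simp add: D(3) r)
  moreover have "inv_into UNIV \<sigma> x = x" if "x \<in> K" for x using l[of x] D(4)[OF that] by simp
  ultimately show ?thesis using bij_imp_bij_inv[OF D(1)] by (simp add: gal_group_def)
qed

lemma gal_is_group: "Group.group \<Gamma>"
proof (rule groupI)
  show "x \<otimes>\<^bsub>\<Gamma>\<^esub> y \<in> carrier \<Gamma>" if "x \<in> carrier \<Gamma>" "y \<in> carrier \<Gamma>" for x y
    using gal_comp that by (simp add: gal_simps)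
  show "\<exists>y\<in>carrier \<Gamma>. y \<otimes>\<^bsub>\<Gamma>\<^esub> x = \<one>\<^bsub>\<Gamma>\<^esub>" if "x \<in> carrier \<Gamma>" for x
    using gal_inv[OF that] galD(1)[OF that]
    by (intro bexI[of _ "inv_into UNIV x"]) (auto simp: gal_simps fun_eq_iff bij_is_inj)
qed (simp_all add: gal_simps gal_id comp_assoc)

sublocale gal: Group.group "gal_group K"
  by (rule gal_is_group)

text \<open>All of \<open>\<Gamma>\<close> is isometric because absolute values extend uniquely, but for inertia and
  Frobenius, which generate the Weil group, this is elementary.\<close>

definition isometric :: "('k \<Rightarrow> 'k) \<Rightarrow> bool" where
  "isometric \<sigma> \<longleftrightarrow> (\<forall>x. (absK (\<sigma> x) \<le> 1 \<longleftrightarrow> absK x \<le> 1) \<and> (absK (\<sigma> x) < 1 \<longleftrightarrow> absK x < 1))"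

text \<open>The reverse implications come from the forward ones at \<open>inverse x\<close>, since
  \<sigma> and the absolute value both commute with inverses.\<close>

lemma isometricI:
  assumes s: "\<sigma> \<in> carrier \<Gamma>" and 1: "\<And>x. absK x \<le> 1 \<Longrightarrow> absK (\<sigma> x) \<le> 1"
    and 2: "\<And>x. absK x < 1 \<Longrightarrow> absK (\<sigma> x) < 1"
  shows "isometric \<sigma>"
proof -
  have inv: "absK (\<sigma> (inverse x)) = inverse (absK (\<sigma> x))" for x
    by (simp add: galD(8)[OF s] abs_inverse)
  have "absK x \<le> 1" if "absK (\<sigma> x) \<le> 1" for x
  proof (rule ccontr)
    assume "\<not> absK x \<le> 1"
    then have "absK (inverse x) < 1" by (simp add: abs_inverse inverse_less_1_iff)
    then have l: "inverse (absK (\<sigma> x)) < 1" using 2 inv by metis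
    have "x \<noteq> 0" using \<open>\<not> absK x \<le> 1\<close> abs_eq_0[of x] by auto
    then have "absK (\<sigma> x) > 0" using abs_nonneg[of "\<sigma> x"] abs_eq_0[of "\<sigma> x"] galD(9)[OF s] by force
    then show False using l that by (simp add: inverse_less_1_iff)
  qed
  moreover have "absK x < 1" if "absK (\<sigma> x) < 1" for x
  proof (rule ccontr)
    assume "\<not> absK x < 1"
    then have "absK (inverse x) \<le> 1" by (simp add: abs_inverse inverse_le_1_iff)
    then have l: "inverse (absK (\<sigma> x)) \<le> 1" using 1 inv by metis
    have "x \<noteq> 0" using \<open>\<not> absK x < 1\<close> abs_eq_0[of x] by auto
    then have "absK (\<sigma> x) > 0" using abs_nonneg[of "\<sigma> x"] abs_eq_0[of "\<sigma> x"] galD(9)[OF s] by force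
    then show False using l that by (simp add: inverse_le_1_iff)
  qed
  ultimately show ?thesis unfolding isometric_def using 1 2 by blast
qed

lemma inertiaD: "\<sigma> \<in> I \<Longrightarrow> \<sigma> \<in> carrier \<Gamma>" "\<sigma> \<in> I \<Longrightarrow> absK x \<le> 1 \<Longrightarrow> absK (\<sigma> x - x) < 1"
  by (auto simp: inertia_def)

lemma inertia_isometric:
  assumes "\<sigma> \<in> I"
  shows "isometric \<sigma>"
proof (rule isometricI[OF inertiaD(1)[OF assms]])
  show "absK (\<sigma> x) \<le> 1" if "absK x \<le> 1" for x
    using abs_add[of "\<sigma> x - x" x] inertiaD(2)[OF assms that] that by simp
  show "absK (\<sigma> x) < 1" if "absK x < 1" for x
    using abs_add_less[of "\<sigma> x - x" 1 x] inertiaD(2)[OF assms, of x] that by simp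
qed

lemma nth_root_exists:
  assumes "n > 0"
  obtains y where "y ^ n = (x::'k)"
proof -
  have "degree [:- x:] < degree (monom (1::'k) n)" using assms by (simp add: degree_monom_eq)
  then have "degree (monom 1 n + [:- x:]) = n" by (simp add: degree_add_eq_left degree_monom_eq)
  then obtain y where "poly (monom 1 n + [:- x:]) y = 0"
    using alg_closed_imp_poly_has_root[of "monom 1 n + [:- x:]"] assms by auto
  then show ?thesis using that[of y] by (simp add: poly_monom)
qed

text \<open>The definition of geometric Frobenius only speaks of q-th powers. As every integral
  element is the q-th power of an integral element, it controls \<phi> on all of them.\<close>

lemma integral_root:
  assumes "absK x \<le> 1"
  obtains y where "x = y ^ q" "absK y \<le> 1" "absK x < 1 \<Longrightarrow> absK y < 1"
proof -
  obtain y where y: "y ^ q = x" using nth_root_exists q_pos by blast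
  have p: "absK y ^ q = absK x" using abs_power[of y q] y by simp
  have "absK y \<le> 1"
  proof (rule ccontr)
    assume "\<not> absK y \<le> 1"
    then have "1 < absK y ^ q" using q_pos by (intro one_less_power) auto
    then show False using p assms by simp
  qed
  moreover have "absK y < 1" if "absK x < 1"
  proof (rule ccontr)
    assume "\<not> absK y < 1"
    then have "1 \<le> absK y ^ q" by (intro one_le_power) auto
    then show False using p that by simp
  qed
  ultimately show ?thesis using that y by blast
qed

lemma frobD: "\<sigma> \<in> geom_frobenius absK K \<Longrightarrow> \<sigma> \<in> carrier \<Gamma>"
  "\<sigma> \<in> geom_frobenius absK K \<Longrightarrow> absK x \<le> 1 \<Longrightarrow> absK (\<sigma> (x ^ q) - x) < 1"
  by (auto simp: geom_frobenius_def)

lemmas \<phi>_gal = frobD(1)[OF \<phi>]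

lemma \<phi>_isometric: "isometric \<phi>"
proof (rule isometricI[OF \<phi>_gal])
  show "absK (\<phi> x) \<le> 1" if x: "absK x \<le> 1" for x
  proof -
    obtain y where y: "x = y ^ q" "absK y \<le> 1" using integral_root[OF x] by blast
    then show ?thesis using frobD(2)[OF \<phi> y(2)] abs_add[of "\<phi> (y ^ q) - y" y] by simp
  qed
  show "absK (\<phi> x) < 1" if x: "absK x < 1" for x
  proof -
    obtain y where y: "x = y ^ q" "absK y < 1" using integral_root[of x] x by force
    then show ?thesis using frobD(2)[OF \<phi>, of y] abs_add_less[of "\<phi> (y ^ q) - y" 1 y] by simp
  qed
qed

lemma gal_inv_eq: "\<sigma> \<in> carrier \<Gamma> \<Longrightarrow> inv\<^bsub>\<Gamma>\<^esub> \<sigma> = inv_into UNIV \<sigma>"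
  by (rule gal.inv_equality) (auto simp: gal_simps gal_inv fun_eq_iff bij_is_inj galD(1))

lemma gal_cancel: "\<sigma> \<in> carrier \<Gamma> \<Longrightarrow> \<sigma> ((inv\<^bsub>\<Gamma>\<^esub> \<sigma>) x) = x" "\<sigma> \<in> carrier \<Gamma> \<Longrightarrow> (inv\<^bsub>\<Gamma>\<^esub> \<sigma>) (\<sigma> x) = x"
  by (simp_all add: gal_inv_eq galD(1) bij_is_surj surj_f_inv_f bij_is_inj)

lemma isometric_inv: "\<sigma> \<in> carrier \<Gamma> \<Longrightarrow> isometric \<sigma> \<Longrightarrow> isometric (inv\<^bsub>\<Gamma>\<^esub> \<sigma>)"
  unfolding isometric_def by (metis gal_cancel(1))

lemma inertia_subgroup: "subgroup I \<Gamma>"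
proof (rule gal.subgroupI)
  show "I \<subseteq> carrier \<Gamma>" using inertiaD(1) by blast
  have "id \<in> I" by (simp add: inertia_def gal_id abs_eq_0[THEN iffD2])
  then show "I \<noteq> {}" by blast
  show "inv\<^bsub>\<Gamma>\<^esub> \<sigma> \<in> I" if s: "\<sigma> \<in> I" for \<sigma>
    unfolding inertia_def
  proof (intro CollectI conjI allI impI)
    show "inv\<^bsub>\<Gamma>\<^esub> \<sigma> \<in> carrier \<Gamma>" using inertiaD(1)[OF s] by simp
    fix x assume "absK x \<le> 1"
    then have "absK ((inv\<^bsub>\<Gamma>\<^esub> \<sigma>) x) \<le> 1"
      using isometric_inv[OF inertiaD(1)[OF s] inertia_isometric[OF s]] by (simp add: isometric_def)
    from inertiaD(2)[OF s this] show "absK ((inv\<^bsub>\<Gamma>\<^esub> \<sigma>) x - x) < 1"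
      by (simp add: gal_cancel(1)[OF inertiaD(1)[OF s]] abs_diff_commute)
  qed
  show "\<sigma> \<otimes>\<^bsub>\<Gamma>\<^esub> \<tau> \<in> I" if s: "\<sigma> \<in> I" and t: "\<tau> \<in> I" for \<sigma> \<tau>
    unfolding inertia_def gal_simps
  proof (intro CollectI conjI allI impI)
    show "\<sigma> \<circ> \<tau> \<in> carrier \<Gamma>" by (rule gal_comp[OF inertiaD(1)[OF s] inertiaD(1)[OF t]])
    fix x assume x: "absK x \<le> 1"
    then have "absK (\<tau> x) \<le> 1" using inertia_isometric[OF t] by (simp add: isometric_def)
    from abs_add_less[OF inertiaD(2)[OF s this] inertiaD(2)[OF t x]]
    show "absK ((\<sigma> \<circ> \<tau>) x - x) < 1" by simp
  qed
qed

lemma inertia_conj: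
  assumes s: "\<sigma> \<in> carrier \<Gamma>" "isometric \<sigma>" and i: "i \<in> I"
  shows "\<sigma> \<circ> i \<circ> inv\<^bsub>\<Gamma>\<^esub> \<sigma> \<in> I"
  unfolding inertia_def
proof (intro CollectI conjI allI impI)
  show "\<sigma> \<circ> i \<circ> inv\<^bsub>\<Gamma>\<^esub> \<sigma> \<in> carrier \<Gamma>"
    using s(1) inertiaD(1)[OF i] by (intro gal_comp) auto
  fix x assume "absK x \<le> 1"
  then have "absK ((inv\<^bsub>\<Gamma>\<^esub> \<sigma>) x) \<le> 1" using isometric_inv[OF s] by (simp add: isometric_def)
  from inertiaD(2)[OF i this] have "absK (\<sigma> (i ((inv\<^bsub>\<Gamma>\<^esub> \<sigma>) x) - (inv\<^bsub>\<Gamma>\<^esub> \<sigma>) x)) < 1"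
    using s(2) by (simp add: isometric_def)
  then show "absK ((\<sigma> \<circ> i \<circ> inv\<^bsub>\<Gamma>\<^esub> \<sigma>) x - x) < 1"
    by (simp add: galD(7)[OF s(1)] gal_cancel(1)[OF s(1)])
qed

section \<open>Powers of Frobenius and the cosets of inertia\<close>

definition fr :: "int \<Rightarrow> 'k \<Rightarrow> 'k" where "fr n = \<phi> [^]\<^bsub>\<Gamma>\<^esub> n"

lemma fr_gal: "fr n \<in> carrier \<Gamma>"
  by (simp add: fr_def \<phi>_gal gal.int_pow_closed)

lemma fr_0: "fr 0 = id" and fr_1: "fr 1 = \<phi>"
  by (simp_all add: fr_def gal_simps(1) \<phi>_gal gal.int_pow_1)

lemma fr_add: "fr (m + n) = fr m \<circ> fr n"
  using gal.int_pow_mult[OF \<phi>_gal, of m n] by (simp add: fr_def gal_simps)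

lemma fr_minus: "fr (- n) = inv\<^bsub>\<Gamma>\<^esub> (fr n)"
  by (simp add: fr_def gal.int_pow_neg[OF \<phi>_gal])

lemma fr_nat: "fr (int n) = \<phi> ^^ n"
  by (induction n) (simp_all add: fr_0 add.commute[of 1] fr_add fr_1, metis fr_0 fr_1 fr_add add.commute comp_apply)

lemma fr_isometric: "isometric (fr n)"
proof -
  have "isometric (fr (int n))" for n
    by (induction n) (simp_all add: fr_0 isometric_def fr_add fr_1 \<phi>_isometric[unfolded isometric_def])
  then show ?thesis
    by (metis fr_gal fr_minus int_cases2 isometric_inv)
qed

lemma fr_inertia:
  assumes "i \<in> I"
  obtains j where "j \<in> I" "fr n \<circ> i = j \<circ> fr n"
proof -
  have "fr n \<circ> i = (fr n \<circ> i \<circ> inv\<^bsub>\<Gamma>\<^esub> (fr n)) \<circ> fr n"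
    using gal_cancel(2)[OF fr_gal] by (simp add: fun_eq_iff)
  then show ?thesis using that inertia_conj[OF fr_gal fr_isometric assms] by blast
qed

lemma inertia_comp: "i \<in> I \<Longrightarrow> j \<in> I \<Longrightarrow> i \<circ> j \<in> I"
  using subgroup.m_closed[OF inertia_subgroup] by (simp add: gal_simps)

lemma inertia_id: "id \<in> I"
  using subgroup.one_closed[OF inertia_subgroup] by (simp add: gal_simps)

lemma inertia_inv: "i \<in> I \<Longrightarrow> inv\<^bsub>\<Gamma>\<^esub> i \<in> I"
  using subgroup.m_inv_closed[OF inertia_subgroup] by simp

lemma mem_coset: "g \<in> I #>\<^bsub>\<Gamma>\<^esub> h \<longleftrightarrow> (\<exists>i\<in>I. g = i \<circ> h)"
  by (auto simp: r_coset_def gal_simps)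

lemma coset_eq: "h \<in> carrier \<Gamma> \<Longrightarrow> i \<in> I \<Longrightarrow> I #>\<^bsub>\<Gamma>\<^esub> (i \<circ> h) = I #>\<^bsub>\<Gamma>\<^esub> h"
  using gal.coset_mult_assoc[of I i h] gal.coset_join2[OF _ inertia_subgroup, of i] inertiaD(1)
  by (simp add: gal_simps subset_iff)

text \<open>Powers of Frobenius are isometric and therefore normalize \<open>I\<close>. The
  operations of the quotient are verified on the cosets that occur, so that normality of
  \<open>I\<close> in all of \<open>\<Gamma>\<close> is never invoked.\<close>

lemma coset_mult_fr: "h \<in> carrier \<Gamma> \<Longrightarrow>
  (I #>\<^bsub>\<Gamma>\<^esub> fr n) <#>\<^bsub>\<Gamma>\<^esub> (I #>\<^bsub>\<Gamma>\<^esub> h) = I #>\<^bsub>\<Gamma>\<^esub> (fr n \<circ> h)"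
proof -
  assume h: "h \<in> carrier \<Gamma>"
  have "x \<in> (I #>\<^bsub>\<Gamma>\<^esub> fr n) <#>\<^bsub>\<Gamma>\<^esub> (I #>\<^bsub>\<Gamma>\<^esub> h) \<longleftrightarrow> x \<in> I #>\<^bsub>\<Gamma>\<^esub> (fr n \<circ> h)" for x
  proof
    assume "x \<in> (I #>\<^bsub>\<Gamma>\<^esub> fr n) <#>\<^bsub>\<Gamma>\<^esub> (I #>\<^bsub>\<Gamma>\<^esub> h)"
    then obtain i j where ij: "i \<in> I" "j \<in> I" "x = (i \<circ> fr n) \<circ> (j \<circ> h)"
      by (auto simp: set_mult_def mem_coset gal_simps)
    obtain k where k: "k \<in> I" "fr n \<circ> j = k \<circ> fr n" using fr_inertia[OF ij(2)] by blast
    have "x = (i \<circ> k) \<circ> (fr n \<circ> h)" using ij(3) k(2) by (metis comp_assoc)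
    then show "x \<in> I #>\<^bsub>\<Gamma>\<^esub> (fr n \<circ> h)" using inertia_comp[OF ij(1) k(1)] mem_coset by blast
  next
    assume "x \<in> I #>\<^bsub>\<Gamma>\<^esub> (fr n \<circ> h)"
    then obtain i where "i \<in> I" "x = (i \<circ> fr n) \<circ> (id \<circ> h)" by (auto simp: mem_coset comp_assoc)
    then show "x \<in> (I #>\<^bsub>\<Gamma>\<^esub> fr n) <#>\<^bsub>\<Gamma>\<^esub> (I #>\<^bsub>\<Gamma>\<^esub> h)"
      unfolding set_mult_def gal_simps using inertia_id mem_coset by blast
  qed
  then show ?thesis by blast
qed

lemma coset_mult_fr_fr: "(I #>\<^bsub>\<Gamma>\<^esub> fr m) <#>\<^bsub>\<Gamma>\<^esub> (I #>\<^bsub>\<Gamma>\<^esub> fr n) = I #>\<^bsub>\<Gamma>\<^esub> fr (m + n)"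
  unfolding fr_add by (rule coset_mult_fr[OF fr_gal])

lemma coset_fr_0: "I #>\<^bsub>\<Gamma>\<^esub> fr 0 = I"
  by (auto simp: mem_coset fr_0)

lemma coset_fr_inv: "inv\<^bsub>\<Gamma> Mod I\<^esub> (I #>\<^bsub>\<Gamma>\<^esub> fr n) = I #>\<^bsub>\<Gamma>\<^esub> fr (- n)"
  unfolding m_inv_def
proof (rule the_equality)
  have "I #>\<^bsub>\<Gamma>\<^esub> fr (- n) \<in> carrier (\<Gamma> Mod I)"
    using fr_gal by (auto simp: FactGroup_def RCOSETS_def)
  then show "I #>\<^bsub>\<Gamma>\<^esub> fr (- n) \<in> carrier (\<Gamma> Mod I) \<and>
    (I #>\<^bsub>\<Gamma>\<^esub> fr n) \<otimes>\<^bsub>\<Gamma> Mod I\<^esub> (I #>\<^bsub>\<Gamma>\<^esub> fr (- n)) = \<one>\<^bsub>\<Gamma> Mod I\<^esub> \<and>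
    (I #>\<^bsub>\<Gamma>\<^esub> fr (- n)) \<otimes>\<^bsub>\<Gamma> Mod I\<^esub> (I #>\<^bsub>\<Gamma>\<^esub> fr n) = \<one>\<^bsub>\<Gamma> Mod I\<^esub>"
    by (simp add: coset_mult_fr_fr coset_fr_0)
  \<comment> \<open>The inverse is a definite description over all cosets, so uniqueness has to be
    tested against an arbitrary one.\<close>
  fix y assume y: "y \<in> carrier (\<Gamma> Mod I) \<and> (I #>\<^bsub>\<Gamma>\<^esub> fr n) \<otimes>\<^bsub>\<Gamma> Mod I\<^esub> y = \<one>\<^bsub>\<Gamma> Mod I\<^esub> \<and>
    y \<otimes>\<^bsub>\<Gamma> Mod I\<^esub> (I #>\<^bsub>\<Gamma>\<^esub> fr n) = \<one>\<^bsub>\<Gamma> Mod I\<^esub>"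
  then obtain h where h: "h \<in> carrier \<Gamma>" "y = I #>\<^bsub>\<Gamma>\<^esub> h" by (auto simp: FactGroup_def RCOSETS_def)
  then have "I #>\<^bsub>\<Gamma>\<^esub> (fr n \<circ> h) = I #>\<^bsub>\<Gamma>\<^esub> fr 0" using y by (simp add: coset_mult_fr coset_fr_0)
  moreover have "fr n \<circ> h \<in> I #>\<^bsub>\<Gamma>\<^esub> (fr n \<circ> h)" unfolding mem_coset by (intro bexI[of _ id] inertia_id) simp
  ultimately have "fr n \<circ> h \<in> I" by (auto simp: mem_coset fr_0)
  then obtain j where j: "j \<in> I" "(fr n \<circ> h) = j" by blast
  have "h = fr (- n) \<circ> j" using fr_add[of "- n" n] by (simp add: j(2)[symmetric] fr_0 comp_assoc[symmetric])
  then obtain i where "i \<in> I" "h = i \<circ> fr (- n)" using fr_inertia[OF j(1), of "- n"] by metis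
  then show "y = I #>\<^bsub>\<Gamma>\<^esub> fr (- n)" using h(2) coset_eq[OF fr_gal] by simp
qed

lemma geom_frobenius_eq: "geom_frobenius absK K = I #>\<^bsub>\<Gamma>\<^esub> fr 1"
proof (rule Set.set_eqI)
  fix \<sigma>
  show "\<sigma> \<in> geom_frobenius absK K \<longleftrightarrow> \<sigma> \<in> I #>\<^bsub>\<Gamma>\<^esub> fr 1"
  proof
    assume s: "\<sigma> \<in> geom_frobenius absK K"
    have "\<sigma> \<circ> inv\<^bsub>\<Gamma>\<^esub> \<phi> \<in> I"
      unfolding inertia_def
    proof (intro CollectI conjI allI impI)
      show "\<sigma> \<circ> inv\<^bsub>\<Gamma>\<^esub> \<phi> \<in> carrier \<Gamma>" using frobD(1)[OF s] \<phi>_gal by (intro gal_comp) auto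
      fix y assume "absK y \<le> 1"
      then have "absK ((inv\<^bsub>\<Gamma>\<^esub> \<phi>) y) \<le> 1"
        using isometric_inv[OF \<phi>_gal \<phi>_isometric] by (simp add: isometric_def)
      \<comment> \<open>In the form \<open>y = \<phi> (x ^ q)\<close> both maps are known: \<sigma>
        and \<phi> each send \<open>x ^ q\<close> to \<open>x\<close> up to the maximal
        ideal.\<close>
      then obtain x where x: "(inv\<^bsub>\<Gamma>\<^esub> \<phi>) y = x ^ q" "absK x \<le> 1" using integral_root by blast
      have y: "y = \<phi> (x ^ q)" by (simp add: gal_cancel(1)[OF \<phi>_gal] flip: x(1))
      have "absK (x - \<phi> (x ^ q)) < 1" using frobD(2)[OF \<phi> x(2)] by (simp add: abs_diff_commute)
      from abs_add_less[OF frobD(2)[OF s x(2)] this]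
      show "absK ((\<sigma> \<circ> inv\<^bsub>\<Gamma>\<^esub> \<phi>) y - y) < 1" by (simp add: x(1)) (simp add: y)
    qed
    moreover have "\<sigma> = (\<sigma> \<circ> inv\<^bsub>\<Gamma>\<^esub> \<phi>) \<circ> fr 1" by (simp add: fr_1 fun_eq_iff gal_cancel(2)[OF \<phi>_gal])
    ultimately show "\<sigma> \<in> I #>\<^bsub>\<Gamma>\<^esub> fr 1" unfolding mem_coset by blast
  next
    assume "\<sigma> \<in> I #>\<^bsub>\<Gamma>\<^esub> fr 1"
    then obtain i where i: "i \<in> I" "\<sigma> = i \<circ> \<phi>" by (auto simp: mem_coset fr_1)
    show "\<sigma> \<in> geom_frobenius absK K"
      unfolding geom_frobenius_def
    proof (intro CollectI conjI allI impI)
      show "\<sigma> \<in> carrier \<Gamma>" unfolding i(2) by (rule gal_comp[OF inertiaD(1)[OF i(1)] \<phi>_gal])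
      fix x assume x: "absK x \<le> 1"
      then have "absK (\<phi> (x ^ q)) \<le> 1"
        using \<phi>_isometric by (simp add: isometric_def abs_power power_le_one abs_nonneg)
      from abs_add_less[OF inertiaD(2)[OF i(1) this] frobD(2)[OF \<phi> x]]
      show "absK (\<sigma> (x ^ q) - x) < 1" by (simp add: i(2))
    qed
  qed
qed

lemma coset_fr_int_pow: "geom_frobenius absK K [^]\<^bsub>\<Gamma> Mod I\<^esub> (n::int) = I #>\<^bsub>\<Gamma>\<^esub> fr n"
proof -
  have nat: "geom_frobenius absK K [^]\<^bsub>\<Gamma> Mod I\<^esub> (n::nat) = I #>\<^bsub>\<Gamma>\<^esub> fr (int n)" for n
    by (induction n) (simp_all add: nat_pow_def coset_fr_0 geom_frobenius_eq coset_mult_fr_fr add.commute)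
  show ?thesis
    by (simp add: int_pow_def2 nat coset_fr_inv)
qed

lemma coset_fr_generate: "I #>\<^bsub>\<Gamma>\<^esub> fr n \<in> generate (\<Gamma> Mod I) {geom_frobenius absK K}"
proof -
  have 1: "I #>\<^bsub>\<Gamma>\<^esub> fr 1 \<in> generate (\<Gamma> Mod I) {geom_frobenius absK K}"
    using generate.incl[of "geom_frobenius absK K" "{geom_frobenius absK K}" "\<Gamma> Mod I"] by (simp add: geom_frobenius_eq)
  have 2: "I #>\<^bsub>\<Gamma>\<^esub> fr (- 1) \<in> generate (\<Gamma> Mod I) {geom_frobenius absK K}"
    using generate.inv[of "geom_frobenius absK K" "{geom_frobenius absK K}" "\<Gamma> Mod I"] by (simp add: geom_frobenius_eq coset_fr_inv)
  have 0: "I #>\<^bsub>\<Gamma>\<^esub> fr 0 \<in> generate (\<Gamma> Mod I) {geom_frobenius absK K}"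
    using generate.one[of "\<Gamma> Mod I"] by (simp add: coset_fr_0)
  show ?thesis
  proof (induction n rule: int_induct[of _ 0])
    case (step1 i)
    then show ?case using generate.eng[OF step1(2) 1] by (simp add: coset_mult_fr_fr)
  next
    case (step2 i)
    then show ?case using generate.eng[OF step2(2) 2] by (simp add: coset_mult_fr_fr)
  qed (rule 0)
qed

lemma weil_iff: "g \<in> W \<longleftrightarrow> (\<exists>i\<in>I. \<exists>n. g = i \<circ> fr n)"
proof
  assume g: "g \<in> W"
  then have gG: "g \<in> carrier \<Gamma>" and
    gen: "I #>\<^bsub>\<Gamma>\<^esub> g \<in> generate (\<Gamma> Mod I) {geom_frobenius absK K}" by (auto simp: weil_group_def)
  have "\<exists>n. x = I #>\<^bsub>\<Gamma>\<^esub> fr n" if "x \<in> generate (\<Gamma> Mod I) {geom_frobenius absK K}" for x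
    using that
  proof induction
    case one
    show ?case by (rule exI[of _ 0]) (simp add: coset_fr_0)
  qed (auto simp: geom_frobenius_eq coset_fr_inv coset_mult_fr_fr)
  then obtain n where n: "I #>\<^bsub>\<Gamma>\<^esub> g = I #>\<^bsub>\<Gamma>\<^esub> fr n" using gen by blast
  have "g \<in> I #>\<^bsub>\<Gamma>\<^esub> g" unfolding mem_coset by (intro bexI[of _ id] inertia_id) simp
  then show "\<exists>i\<in>I. \<exists>n. g = i \<circ> fr n" unfolding n mem_coset by blast
next
  assume "\<exists>i\<in>I. \<exists>n. g = i \<circ> fr n"
  then obtain i n where i: "i \<in> I" "g = i \<circ> fr n" by blast
  then show "g \<in> W"
    using coset_fr_generate[of n] by (simp add: weil_group_def coset_eq fr_gal gal_comp inertiaD(1))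
qed

lemma weil_gal: "g \<in> W \<Longrightarrow> g \<in> carrier \<Gamma>"
  by (simp add: weil_group_def)

lemma weil_inertia: "i \<in> I \<Longrightarrow> i \<in> W" and weil_fr: "fr n \<in> W" and weil_\<phi>: "\<phi> \<in> W" and weil_id: "id \<in> W"
proof -
  show i: "i \<in> I \<Longrightarrow> i \<in> W" for i unfolding weil_iff by (metis comp_id fr_0)
  show f: "fr n \<in> W" for n unfolding weil_iff by (metis id_comp inertia_id)
  show "\<phi> \<in> W" using f[of 1] by (simp add: fr_1)
  show "id \<in> W" using i[OF inertia_id] .
qed

lemma weil_comp: 
  assumes "g \<in> W" "h \<in> W"
  shows "g \<circ> h \<in> W"
proof -
  obtain i m j n where "i \<in> I" "g = i \<circ> fr m" "j \<in> I" "h = j \<circ> fr n" using assms weil_iff by auto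
  moreover obtain k where "k \<in> I" "fr m \<circ> j = k \<circ> fr m" using fr_inertia[OF \<open>j \<in> I\<close>] by blast
  ultimately have "g \<circ> h = (i \<circ> k) \<circ> fr (m + n)" "i \<circ> k \<in> I"
    by (metis comp_assoc fr_add, simp add: inertia_comp)
  then show ?thesis using weil_iff by blast
qed

lemma weil_inv:
  assumes "g \<in> W"
  shows "inv\<^bsub>\<Gamma>\<^esub> g \<in> W"
proof -
  obtain i n where i: "i \<in> I" "g = i \<circ> fr n" using assms weil_iff by auto
  have "inv\<^bsub>\<Gamma>\<^esub> g = fr (- n) \<circ> inv\<^bsub>\<Gamma>\<^esub> i"
    using gal.inv_mult_group[OF inertiaD(1)[OF i(1)] fr_gal, of n] by (simp add: i(2) gal_simps fr_minus)
  then show ?thesis using weil_comp[OF weil_fr weil_inertia[OF inertia_inv[OF i(1)]]] by simp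
qed

lemma weil_simps: "mult (weil_group absK K) = (\<circ>)" "one (weil_group absK K) = id"
  by (simp_all add: weil_group_def gal_group_def)

end

locale local_galois_val = local_galois +
  assumes fr_infinite: "\<phi> [^]\<^bsub>gal_group K\<^esub> (n::int) \<in> inertia absK K \<Longrightarrow> n = 0"
begin

abbreviation "val \<equiv> weil_val absK K"

lemma weil_val_eq:
  assumes "i \<in> I"
  shows "val (i \<circ> fr n) = n"
  unfolding weil_val_def coset_fr_int_pow coset_eq[OF fr_gal assms]
proof (rule the_equality)
  fix m assume eq: "I #>\<^bsub>\<Gamma>\<^esub> fr n = I #>\<^bsub>\<Gamma>\<^esub> fr m"
  have "fr n \<in> I #>\<^bsub>\<Gamma>\<^esub> fr n" unfolding mem_coset by (intro bexI[of _ id] inertia_id) simp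
  then obtain j where j: "j \<in> I" "fr n = j \<circ> fr m" unfolding eq mem_coset by blast
  have "fr (n - m) = j"
    using fr_add[of n "- m"] fr_add[of m "- m"] by (simp add: j(2) comp_assoc fr_0)
  then show "m = n" using fr_infinite[of "n - m"] j(1) by (simp add: fr_def)
qed simp

lemma weil_val_fr: "val (fr n) = n" and weil_val_\<phi>: "val \<phi> = 1"
  using weil_val_eq[OF inertia_id, of n] weil_val_eq[OF inertia_id, of 1] by (simp_all add: fr_1)

lemma weil_val_inertia: "i \<in> I \<Longrightarrow> val i = 0"
  using weil_val_eq[of i 0] by (simp add: fr_0)

lemma weil_val_comp:
  assumes "g \<in> W" "h \<in> W"
  shows "val (g \<circ> h) = val g + val h"
proof -
  obtain i m j n where ij: "i \<in> I" "g = i \<circ> fr m" "j \<in> I" "h = j \<circ> fr n" using assms weil_iff by auto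
  moreover obtain k where k: "k \<in> I" "fr m \<circ> j = k \<circ> fr m" using fr_inertia[OF \<open>j \<in> I\<close>] by blast
  ultimately have "g \<circ> h = (i \<circ> k) \<circ> fr (m + n)" "i \<circ> k \<in> I"
    by (metis comp_assoc fr_add, simp add: inertia_comp)
  then show ?thesis using ij by (simp add: weil_val_eq)
qed

end

section \<open>Open subgroups of inertia\<close>

context local_galois
begin

lemma gal_sum: "\<sigma> \<in> carrier \<Gamma> \<Longrightarrow> \<sigma> (\<Sum>x\<in>A. g x) = (\<Sum>x\<in>A. \<sigma> (g x))"
  by (induction A rule: infinite_finite_induct) (simp_all add: galD)

text \<open>A finite extension enters only through a finite spanning set: a
  \<open>K\<close>-automorphism fixing this set fixes the extension pointwise. The translated form
  \<open>u \<circ> \<tau>\<close> passes through the finite intersections and unions that generate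
  the topology.\<close>

lemma krull_neighbourhood:
  assumes "openin (krull_topology K) U" "u \<in> U"
  shows "\<exists>A. finite A \<and> (\<forall>\<tau>\<in>carrier \<Gamma>. (\<forall>x\<in>A. \<tau> x = x) \<longrightarrow> u \<circ> \<tau> \<in> U)"
  using assms unfolding krull_topology_def openin_topology_generated_by_iff
proof (induction arbitrary: u)
  case (Int U V)
  have u: "u \<in> U" "u \<in> V" using Int.prems by auto
  obtain A where "finite A" "\<forall>\<tau>\<in>carrier \<Gamma>. (\<forall>x\<in>A. \<tau> x = x) \<longrightarrow> u \<circ> \<tau> \<in> U"
    using Int.IH(1)[OF u(1)] by blast
  moreover obtain B where "finite B" "\<forall>\<tau>\<in>carrier \<Gamma>. (\<forall>x\<in>B. \<tau> x = x) \<longrightarrow> u \<circ> \<tau> \<in> V"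
    using Int.IH(2)[OF u(2)] by blast
  ultimately show ?case
    by (intro exI[of _ "A \<union> B"] conjI ballI impI IntI finite_UnI) blast+
next
  case (UN X)
  then obtain U where U: "U \<in> X" "u \<in> U" by blast
  from UN.IH[OF this] show ?case using U(1) by blast
next
  case (Basis U)
  then obtain \<sigma> L where L: "U = {\<tau> \<in> carrier \<Gamma>. \<forall>x\<in>L. \<tau> x = \<sigma> x}" "finite_extension K L" by blast
  obtain B where B: "finite B" "L = {\<Sum>b\<in>B. c b * b | c. \<forall>b\<in>B. c b \<in> K}"
    using L(2) unfolding finite_extension_def by blast
  have "u \<circ> \<tau> \<in> U" if \<tau>: "\<tau> \<in> carrier \<Gamma>" "\<forall>x\<in>B. \<tau> x = x" for \<tau>
  proof -
    have "\<tau> x = x" if "x \<in> L" for x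
      using that \<tau>(2) unfolding B(2) by (auto simp: gal_sum[OF \<tau>(1)] galD(3,4)[OF \<tau>(1)])
    then show ?thesis using Basis(2) gal_comp[OF _ \<tau>(1)] unfolding L(1) by auto
  qed
  then show ?case using B(1) by blast
qed simp

lemma weil_neighbourhood_id:
  assumes "openin (weil_topology absK K) U" "id \<in> U"
  shows "\<exists>A. finite A \<and> (\<forall>\<tau>\<in>I. (\<forall>x\<in>A. \<tau> x = x) \<longrightarrow> \<tau> \<in> U)"
  using assms unfolding weil_topology_def openin_topology_generated_by_iff
proof induction
  case (Int U V)
  have id: "id \<in> U" "id \<in> V" by (rule IntD1[OF Int.prems], rule IntD2[OF Int.prems])
  obtain A where "finite A" "\<forall>\<tau>\<in>I. (\<forall>x\<in>A. \<tau> x = x) \<longrightarrow> \<tau> \<in> U"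
    using Int.IH(1)[OF id(1)] by blast
  moreover obtain B where "finite B" "\<forall>\<tau>\<in>I. (\<forall>x\<in>B. \<tau> x = x) \<longrightarrow> \<tau> \<in> V"
    using Int.IH(2)[OF id(2)] by blast
  ultimately show ?case
    by (intro exI[of _ "A \<union> B"] conjI ballI impI IntI finite_UnI) blast+
next
  case (UN X)
  then obtain U where U: "U \<in> X" "id \<in> U" by blast
  from UN.IH[OF this] show ?case using U(1) by blast
next
  case (Basis U)
  then obtain g V where V: "U = (\<lambda>u. g \<circ> u) ` V" "openin (inertia_topology absK K) V" by blast
  obtain V' where V': "openin (krull_topology K) V'" "V = V' \<inter> I"
    using V(2) unfolding inertia_topology_def openin_subtopology by blast
  obtain u where u': "id = g \<circ> u" "u \<in> V" using Basis(2)[unfolded V(1)] by (rule imageE)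
  then have u: "u \<in> V" "g \<circ> u = id" by simp_all
  obtain A where A: "finite A" "\<forall>\<tau>\<in>carrier \<Gamma>. (\<forall>x\<in>A. \<tau> x = x) \<longrightarrow> u \<circ> \<tau> \<in> V'"
    using krull_neighbourhood[OF V'(1)] u(1) V'(2) by blast
  have "\<tau> \<in> U" if "\<tau> \<in> I" "\<forall>x\<in>A. \<tau> x = x" for \<tau>
  proof -
    have "u \<circ> \<tau> \<in> V" using A(2) that inertiaD(1) u(1) inertia_comp V'(2) by blast
    moreover have "\<tau> = g \<circ> (u \<circ> \<tau>)" by (metis comp_assoc id_comp u(2))
    ultimately show ?thesis unfolding V(1) by blast
  qed
  then show ?case using A(1) by blast
qed simp

text \<open>Compactness in elementary form: modulo the open kernel an element of inertia is
  determined by its values on a finite set \<open>A\<close>, and each element of \<open>A\<close>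
  has finitely many possible images, the roots of a polynomial over \<open>K\<close>.\<close>

lemma finite_inertia_image:
  assumes op: "openin (weil_topology absK K) {g \<in> W. r g = id}"
    and hom: "\<And>g h. g \<in> W \<Longrightarrow> h \<in> W \<Longrightarrow> r (g \<circ> h) = r g \<circ> (r h :: 'c \<Rightarrow> 'c)" "r id = id"
    and algebraic: "\<And>x. \<exists>P. P \<noteq> 0 \<and> (\<forall>i. coeff P i \<in> K) \<and> poly P x = 0"
  shows "finite (r ` I)"
proof -
  obtain A where A: "finite A" "\<forall>\<tau>\<in>I. (\<forall>x\<in>A. \<tau> x = x) \<longrightarrow> r \<tau> = id"
    using weil_neighbourhood_id[OF op] hom(2) weil_id by auto
  obtain P where P: "\<And>x. P x \<noteq> 0" "\<And>x i. coeff (P x) i \<in> K" "\<And>x. poly (P x) x = 0"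
    using algebraic by metis
  define F where "F = PiE A (\<lambda>x. {y. poly (P x) y = 0})"
  have finF: "finite F" unfolding F_def using A(1) poly_roots_finite P(1) by (intro finite_PiE) auto
  have root: "poly (P x) (\<sigma> x) = 0" if "\<sigma> \<in> carrier \<Gamma>" for \<sigma> x
  proof -
    have pow: "\<sigma> (x ^ i) = \<sigma> x ^ i" for i by (induction i) (simp_all add: galD[OF that])
    have "\<sigma> (poly (P x) x) = poly (P x) (\<sigma> x)"
      unfolding poly_altdef by (simp add: gal_sum[OF that] galD(3)[OF that] galD(4)[OF that P(2)] pow)
    then show ?thesis using P(3) galD(5)[OF that] by simp
  qed
  have eq: "r \<sigma> = r \<tau>" if s: "\<sigma> \<in> I" "\<tau> \<in> I" and eqA: "restrict \<sigma> A = restrict \<tau> A" for \<sigma> \<tau>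
  proof -
    let ?d = "inv\<^bsub>\<Gamma>\<^esub> \<tau> \<circ> \<sigma>"
    have d: "?d \<in> I" by (intro inertia_comp inertia_inv s)
    have "?d x = x" if "x \<in> A" for x
    proof -
      have "\<sigma> x = \<tau> x" using fun_cong[OF eqA, of x] that by simp
      then show ?thesis by (simp add: gal_cancel(2) inertiaD(1) s(2))
    qed
    then have "r ?d = id" using A(2) d by blast
    moreover have "\<sigma> = \<tau> \<circ> ?d" using gal_cancel(1)[OF inertiaD(1)[OF s(2)]] by (simp add: fun_eq_iff)
    ultimately show ?thesis using hom(1)[OF weil_inertia[OF s(2)] weil_inertia[OF d]] by simp
  qed
  have "(\<lambda>\<sigma>. restrict \<sigma> A) ` I \<subseteq> F"
    using root inertiaD(1) by (auto simp: F_def)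
  then have fin: "finite ((\<lambda>\<sigma>. restrict \<sigma> A) ` I)" using finF finite_subset by blast
  have "r ` I \<subseteq> (\<lambda>\<alpha>. r (SOME \<sigma>. \<sigma> \<in> I \<and> restrict \<sigma> A = \<alpha>)) ` (\<lambda>\<sigma>. restrict \<sigma> A) ` I"
  proof
    fix y assume "y \<in> r ` I"
    then obtain \<sigma> where s: "\<sigma> \<in> I" "y = r \<sigma>" by blast
    let ?\<tau> = "SOME \<tau>. \<tau> \<in> I \<and> restrict \<tau> A = restrict \<sigma> A"
    have "?\<tau> \<in> I \<and> restrict ?\<tau> A = restrict \<sigma> A"
      by (rule someI[of _ \<sigma>]) (simp add: s(1))
    then have "y = r ?\<tau>" using eq s by metis
    then show "y \<in> (\<lambda>\<alpha>. r (SOME \<sigma>. \<sigma> \<in> I \<and> restrict \<sigma> A = \<alpha>)) ` (\<lambda>\<sigma>. restrict \<sigma> A) ` I"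
      using s(1) by blast
  qed
  then show ?thesis using fin finite_surj by blast
qed

end

section \<open>Weil--Deligne representations\<close>

text \<open>By pigeonhole two powers of \<open>c\<close> agree on \<open>S\<close>; injectivity
  cancels the smaller one.\<close>

lemma finite_order_on:
  assumes "finite S" "c ` S \<subseteq> S" "inj_on c S"
  obtains m where "m > 0" "\<And>x. x \<in> S \<Longrightarrow> (c ^^ m) x = x"
proof -
  have mem: "(c ^^ a) x \<in> S" if "x \<in> S" for a x
    by (induction a) (use that assms(2) in auto)
  have inj: "x = y" if "(c ^^ a) x = (c ^^ a) y" "x \<in> S" "y \<in> S" for a x y
    using that(1)
    by (induction a) (use that mem assms(3) in \<open>auto dest: inj_onD\<close>)
  have "(\<lambda>a. restrict (c ^^ a) S) ` UNIV \<subseteq> PiE S (\<lambda>_. S)" using mem by auto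
  then have "finite (range (\<lambda>a::nat. restrict (c ^^ a) S))"
    using assms(1) finite_PiE[of S "\<lambda>_. S"] finite_subset by blast
  then have "\<not> inj (\<lambda>a::nat. restrict (c ^^ a) S)"
    using finite_imageD infinite_UNIV_nat by blast
  then obtain a b where ab: "a < b" "restrict (c ^^ a) S = restrict (c ^^ b) S"
    unfolding inj_def by (metis linorder_neqE_nat)
  have "(c ^^ (b - a)) x = x" if x: "x \<in> S" for x
  proof (rule inj[OF _ mem[OF x] x])
    have "(c ^^ a) ((c ^^ (b - a)) x) = (c ^^ b) x"
      using ab(1) by (simp flip: funpow_add[THEN fun_cong, unfolded o_apply])
    also have "\<dots> = (c ^^ a) x" using fun_cong[OF ab(2), of x] x by simp
    finally show "(c ^^ a) ((c ^^ (b - a)) x) = (c ^^ a) x" .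
  qed
  then show ?thesis using that[of "b - a"] ab(1) by simp
qed

context fd_space
begin

lemma GL_simps: "f \<in> carrier (GL scale) \<longleftrightarrow> endo scale f \<and> bij f"
  "mult (GL scale) = (\<circ>)" "one (GL scale) = id"
  by (simp_all add: GL_def)

lemma GL_inverse: "f \<in> carrier (GL scale) \<Longrightarrow> inv_into UNIV f \<in> carrier (GL scale)"
  by (simp add: GL_simps lin_inv bij_imp_bij_inv)

lemma GL_is_group: "Group.group (GL scale)"
proof (rule groupI)
  show "f \<otimes>\<^bsub>GL scale\<^esub> g \<in> carrier (GL scale)" if "f \<in> carrier (GL scale)" "g \<in> carrier (GL scale)" for f g
    using that lin_comp[of scale scale g scale f] bij_comp[of g f] by (simp add: GL_simps comp_def)
  show "\<exists>g\<in>carrier (GL scale). g \<otimes>\<^bsub>GL scale\<^esub> f = \<one>\<^bsub>GL scale\<^esub>" if "f \<in> carrier (GL scale)" for f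
    using GL_inverse[OF that] that
    by (intro bexI[of _ "inv_into UNIV f"]) (auto simp: GL_simps bij_is_inj)
qed (simp_all add: GL_simps endo_id' comp_assoc)

sublocale GL: Group.group "GL scale"
  by (rule GL_is_group)

lemma GL_inv_apply:
  assumes "f \<in> carrier (GL scale)"
  shows "(inv\<^bsub>GL scale\<^esub> f) (f v) = v" "f ((inv\<^bsub>GL scale\<^esub> f) v) = v"
  using GL.l_inv[OF assms] GL.r_inv[OF assms] by (simp_all add: GL_simps fun_eq_iff)

lemma GL_endo: "f \<in> carrier (GL scale) \<Longrightarrow> endo scale f"
  by (simp add: GL_simps)

lemma GL_inv_commute:
  assumes f: "f \<in> carrier (GL scale)" and X: "\<And>v. X (f v) = f (X v)"
  shows "X ((inv\<^bsub>GL scale\<^esub> f) v) = (inv\<^bsub>GL scale\<^esub> f) (X v)"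
  by (metis GL_inv_apply[OF f] X)

lemma GL_nat_pow: "f [^]\<^bsub>GL scale\<^esub> (n::nat) = f ^^ n"
  by (induction n) (simp_all add: GL_simps funpow_swap1 fun_eq_iff)

lemma GL_int_pow_commute:
  assumes f: "f \<in> carrier (GL scale)" and X: "\<And>v. X (f v) = f (X v)"
  shows "X ((f [^]\<^bsub>GL scale\<^esub> (n::int)) v) = (f [^]\<^bsub>GL scale\<^esub> n) (X v)"
proof -
  have 1: "X ((f ^^ k) v) = (f ^^ k) (X v)" for k v
    by (rule funpow_commute[symmetric]) (rule X[symmetric])
  have "f ^^ k \<in> carrier (GL scale)" for k using GL.nat_pow_closed[OF f, of k] by (simp add: GL_nat_pow)
  then have "X ((inv\<^bsub>GL scale\<^esub> (f ^^ k)) v) = (inv\<^bsub>GL scale\<^esub> (f ^^ k)) (X v)" for k v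
    using GL_inv_commute[of "f ^^ k" X] 1 by blast
  then show ?thesis by (simp add: int_pow_def2 GL_nat_pow 1)
qed

text \<open>When \<open>Y\<close> commutes with \<open>u\<close>, the map \<open>Y (u - 1)\<close>
  is nilpotent and has trace zero, so the factors \<open>u\<close> can be removed one by
  one.\<close>

lemma trace_unipotent_funpow:
  assumes u: "endo scale u" "unipotent_map u" and X: "endo scale X" "\<And>v. X (u v) = u (X v)"
  shows "tr (\<lambda>v. X ((u ^^ n) v)) = tr X"
proof -
  have step: "tr (\<lambda>v. Y (u v)) = tr Y" if Y: "endo scale Y" "\<And>v. Y (u v) = u (Y v)" for Y
  proof -
    define x where "x = (\<lambda>v. u v - v)"
    have x: "endo scale x" unfolding x_def by (rule lin_minus[OF u(1) endo_id])
    obtain n where n: "\<And>v. (x ^^ n) v = 0"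
      using u(2) unfolding unipotent_map_def nilpotent_map_def x_def by blast
    have Yx: "Y (x v) = x (Y v)" for v by (simp add: x_def lin_diff[OF Y(1)] Y(2))
    have "((\<lambda>v. Y (x v)) ^^ k) v = (Y ^^ k) ((x ^^ k) v)" for k v
    proof (induction k)
      case (Suc k)
      have "x ((Y ^^ k) w) = (Y ^^ k) (x w)" for w
        by (rule funpow_commute[symmetric]) (rule Yx)
      then show ?case by (simp add: Suc)
    qed simp
    then have "nilpotent_map (\<lambda>v. Y (x v))"
      unfolding nilpotent_map_def by (metis n lin_zero[OF endo_funpow[OF Y(1)]])
    then have "tr (\<lambda>v. Y (x v)) = 0" by (intro trace_nilpotent lin_comp[OF x Y(1)])
    then show ?thesis using trace_minus[of "\<lambda>v. Y (u v)" Y] by (simp add: x_def lin_diff[OF Y(1)])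
  qed
  have comm: "X ((u ^^ k) v) = (u ^^ k) (X v)" for k v
    by (rule funpow_commute[symmetric]) (rule X(2)[symmetric])
  show ?thesis
  proof (induction n)
    case (Suc n)
    have "tr (\<lambda>v. X ((u ^^ n) (u v))) = tr (\<lambda>v. X ((u ^^ n) v))"
      by (rule step[OF lin_comp[OF endo_funpow[OF u(1)] X(1)]])
        (simp add: comm funpow_swap1 X(2))
    then show ?case using Suc by (simp add: funpow_swap1)
  qed simp
qed

text \<open>The index set in \<open>nilp_exp\<close> depends on \<open>c\<close>, shrinking for
  instance when \<open>c = 0\<close>; a bound \<open>n\<close> depending on \<open>N\<close> alone
  allows uniform computations.\<close>

lemma nilp_exp_eq:
  assumes N: "endo scale N" and n: "\<And>v. (N ^^ n) v = 0"
  shows "nilp_exp scale (\<lambda>v. c \<star> N v) v = (\<Sum>k<n. (inverse (fact k) * c ^ k) \<star> (N ^^ k) v)"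
proof -
  have pw: "((\<lambda>v. c \<star> N v) ^^ k) v = c ^ k \<star> (N ^^ k) v" for k v
    by (induction k) (simp_all add: lin_scale[OF N] mult.commute)
  have z: "(N ^^ k) v = 0" if "k \<ge> n" for k v
    using that n[of "(N ^^ (k - n)) v"]
    by (simp flip: funpow_add[THEN fun_cong, unfolded o_apply])
  have sub: "{k. \<exists>x. ((\<lambda>v. c \<star> N v) ^^ k) x \<noteq> 0} \<subseteq> {..<n}"
    unfolding pw using z by (force simp: not_less[symmetric])
  show ?thesis
    unfolding nilp_exp_def
    by (rule trans[OF sum.mono_neutral_left[OF _ sub]]) (auto simp: pw)
qed

end

context alg_fd_space
begin

text \<open>With respect to the flag of the \<open>ker N\<^sup>j\<close>, which \<open>X\<close> preserves, the exponential is
  unipotent; hence \<open>X\<close> and \<open>Y\<close> induce the same maps on the graded pieces.\<close>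

lemma trace_eq_of_nilp_exp:
  assumes N: "endo scale N" "nilpotent_map N"
    and X: "endo scale X" "\<And>v. X (N v) = b \<star> N (X v)" "b \<noteq> 0" and Y: "endo scale Y" "bij Y" and "bij X"
    and XY: "\<And>v. X v = Y (nilp_exp scale (\<lambda>v. c \<star> N v) v)"
  shows "tr X = tr Y"
proof -
  define E where "E = nilp_exp scale (\<lambda>v. c \<star> N v)"
  obtain n where n: "\<And>v. (N ^^ n) v = 0" using N(2) by (auto simp: nilpotent_map_def)
  have N0: "(N ^^ Suc n) v = 0" for v by (simp add: n lin_zero[OF N(1)])
  have E: "E v = (\<Sum>k<Suc n. (inverse (fact k) * c ^ k) \<star> (N ^^ k) v)" for v
    unfolding E_def by (rule nilp_exp_eq[OF N(1) N0])
  have E1: "E v - v = (\<Sum>k<n. (inverse (fact (Suc k)) * c ^ Suc k) \<star> (N ^^ Suc k) v)" for v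
    unfolding E sum.lessThan_Suc_shift by simp
  have EK: "(N ^^ j) (E v - v) = 0" if "(N ^^ Suc j) v = 0" for j v
  proof -
    have "(N ^^ j) ((N ^^ Suc k) v) = (N ^^ k) ((N ^^ Suc j) v)" for k
      by (simp only: funpow_add[THEN fun_cong, unfolded o_apply, symmetric]) (simp add: add.commute)
    then show ?thesis using that
      by (simp only: E1 lin_sum[OF endo_funpow[OF N(1)]] lin_scale[OF endo_funpow[OF N(1)]]
          lin_zero[OF endo_funpow[OF N(1)]] scale_zero_right sum.neutral_const)
  qed
  have mono: "(N ^^ i) v = 0" if "(N ^^ j) v = 0" "j \<le> i" for i j v
  proof -
    have "(N ^^ i) v = (N ^^ (i - j)) ((N ^^ j) v)"
      using that(2) by (simp flip: funpow_add[THEN fun_cong, unfolded o_apply])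
    then show ?thesis using that(1) by (simp add: lin_zero[OF endo_funpow[OF N(1)]])
  qed
  have EinvK: "(N ^^ j) y = 0" if "(N ^^ j) (E y) = 0" for j y
  proof -
    \<comment> \<open>\<open>E - 1\<close> lowers the flag, so \<open>y\<close> and
      \<open>E y\<close> differ by something already smaller; this lets the exponent descend to
      \<open>j\<close>.\<close>
    have "(N ^^ (j + i)) y = 0 \<Longrightarrow> (N ^^ j) y = 0" for i
    proof (induction i)
      case (Suc i)
      have "(N ^^ (j + i)) (E y - y) = 0" using EK[of "j + i" y] Suc.prems by simp
      moreover have "(N ^^ (j + i)) (E y) = 0" using mono[OF that, of "j + i"] by simp
      ultimately have "(N ^^ (j + i)) y = 0" by (simp add: lin_diff[OF endo_funpow[OF N(1)]])
      then show ?case by (rule Suc.IH)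
    qed simp
    from this[of n] show ?thesis using mono[OF n, of "j + n" y] by simp
  qed
  define D where "D = (\<lambda>v. X v - Y v)"
  have D: "endo scale D" unfolding D_def by (rule lin_minus[OF X(1) Y(1)])
  have "E = inv_into UNIV Y \<circ> X" using XY Y(2) by (auto simp: E_def fun_eq_iff bij_is_inj)
  then have "surj E" using Y(2) \<open>bij X\<close> by (metis bij_comp bij_imp_bij_inv bij_is_surj)
  have NX: "(N ^^ j) (X v) = 0" if "(N ^^ j) v = 0" for j v
    using endo_twisted_funpow[OF X(1,2) N(1), of j v] that X(3) by (simp add: lin_zero[OF X(1)])
  \<comment> \<open>\<open>Y\<close> is only accessible through \<open>X = Y E\<close>: writing
    \<open>w = E y\<close> gives \<open>D w = X (E y - y)\<close>, where \<open>E - 1\<close> lowers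
    the flag and \<open>X\<close> preserves it.\<close>
  have DK: "(N ^^ j) (D w) = 0" if "(N ^^ Suc j) w = 0" for j w
  proof -
    obtain y where y: "w = E y" using \<open>surj E\<close> by blast
    have "(N ^^ Suc j) y = 0" using EinvK that y by blast
    then have "(N ^^ j) (E y - y) = 0" by (rule EK)
    moreover have "D w = X (E y - y)"
      using XY[of y] by (simp add: D_def y lin_diff[OF X(1)] E_def)
    ultimately show ?thesis using NX by simp
  qed
  have "(N ^^ (n - k)) ((D ^^ k) v) = 0" if "k \<le> n" for k v
    using that
  proof (induction k)
    case (Suc k)
    then have "(N ^^ Suc (n - Suc k)) ((D ^^ k) v) = 0" by (simp add: Suc_diff_Suc)
    then show ?case using DK by simp
  qed (simp add: n)
  from this[of n] have "nilpotent_map D" unfolding nilpotent_map_def by auto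
  then have "tr D = 0" by (rule trace_nilpotent[OF D])
  then show ?thesis by (simp add: D_def trace_minus)
qed

lemma jordan_unipotent_part:
  assumes f: "f \<in> carrier (GL scale)"
  obtains s where "jordan_decomposition f s (unipotent_part scale f)"
proof -
  have f': "endo scale f" "bij f" using f by (simp_all add: GL_simps)
  have inj: "v = 0" if "f v = 0" for v
    using that f'(2) lin_zero[OF f'(1)] by (metis bij_pointE)
  obtain s u where su: "jordan_decomposition f s u" using jordan_exists[OF f'(1) inj] by blast
  have "unipotent_part scale f = u"
    unfolding unipotent_part_def
  proof (rule the_equality)
    note J = jordan_decompositionD[OF su]
    show "endo scale u \<and> unipotent_map u \<and>
      (\<exists>s. endo scale s \<and> semisimple_map scale s \<and> f = s \<circ> u \<and> s \<circ> u = u \<circ> s)"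
      using J diagonalizable_imp_semisimple by (auto simp: fun_eq_iff)
    fix u' assume "endo scale u' \<and> unipotent_map u' \<and>
      (\<exists>s. endo scale s \<and> semisimple_map scale s \<and> f = s \<circ> u' \<and> s \<circ> u' = u' \<circ> s)"
    then obtain s' where s': "endo scale u'" "unipotent_map u'" "endo scale s'"
      "semisimple_map scale s'" "f = s' \<circ> u'" "s' \<circ> u' = u' \<circ> s'" by blast
    have "s' (u' v) = u' (s' v)" for v using fun_cong[OF s'(6), of v] by simp
    then have "jordan_decomposition f s' u'"
      unfolding jordan_decomposition_def
      using s' semisimple_imp_diagonalizable by simp
    then show "u' = u" using jordan_unique(2)[OF su _ inj] by metis
  qed
  then show ?thesis using su that by blast
qed

end

section \<open>A single pure Weil--Deligne representation and its
  Frobenius-semisimplification\<close>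

locale pure_weil_deligne = local_galois_val absK K \<phi> + alg_fd_space scale
  for absK :: "'k::{alg_closed_field, field_char_0} \<Rightarrow> real" and K :: "'k set" and \<phi> :: "'k \<Rightarrow> 'k"
    and scale :: "'e::{alg_closed_field, field_char_0} \<Rightarrow> 'v::ab_group_add \<Rightarrow> 'v" (infixr \<open>\<star>\<close> 75) +
  fixes r :: "('k \<Rightarrow> 'k) \<Rightarrow> 'v \<Rightarrow> 'v" and N :: "'v \<Rightarrow> 'v" and w :: int
  assumes wd_pure: "wd_pure absK K \<phi> scale w (r, N)"
    and algebraic: "\<And>x. \<exists>P. P \<noteq> 0 \<and> (\<forall>i. coeff P i \<in> K) \<and> poly P x = 0"
    and q_gt_1: "residue_card absK K > 1"
begin

lemma wd: "r \<in> hom (weil_group absK K) (GL scale)"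
    "openin (weil_topology absK K) {g \<in> W. r g = id}"
    "endo scale N" "nilpotent_map N"
    "\<And>g. g \<in> W \<Longrightarrow> r g \<circ> N \<circ> inv\<^bsub>GL scale\<^esub> (r g) = (\<lambda>v. (of_nat q powi (- val g)) \<star> N v)"
  using wd_pure unfolding wd_pure_def weil_deligne_rep_def by auto

lemma r_GL: "g \<in> W \<Longrightarrow> r g \<in> carrier (GL scale)"
  using wd(1) by (auto simp: hom_def)

lemmas r_endo = GL_endo[OF r_GL]

lemma r_comp: "g \<in> W \<Longrightarrow> h \<in> W \<Longrightarrow> r (g \<circ> h) = r g \<circ> r h"
  using wd(1) by (simp add: hom_def weil_simps GL_simps)

lemma r_id: "r id = id"
proof -
  have "r id \<circ> r id = r id" using r_comp[OF weil_id weil_id] by simp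
  then have "r id v = v" for v
    using GL_inv_apply(1)[OF r_GL[OF weil_id]] by (metis comp_apply)
  then show ?thesis by auto
qed

lemma q_nonzero: "(of_nat q :: 'e) \<noteq> 0"
  using q_pos by simp

lemma r_N: "g \<in> W \<Longrightarrow> r g (N v) = (of_nat q powi (- val g)) \<star> N (r g v)"
  using fun_cong[OF wd(5), of g "r g v"] GL_inv_apply(1)[OF r_GL] by simp

lemma r_inertia_finite: "finite (r ` I)"
  by (rule finite_inertia_image[OF wd(2) r_comp r_id algebraic])

definition u where "u = unipotent_part scale (r \<phi>)"
definition s where "s = (SOME s. jordan_decomposition (r \<phi>) s u)"

lemma jordan: "jordan_decomposition (r \<phi>) s u"
  unfolding s_def using jordan_unipotent_part[OF r_GL[OF weil_\<phi>]] someI_ex[of "\<lambda>s. jordan_decomposition (r \<phi>) s u"]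
  unfolding u_def by metis

lemmas J = jordan_decompositionD[OF jordan]

lemma r_fr_nat: "r (fr (int n)) = r \<phi> ^^ n"
proof (induction n)
  case (Suc n)
  have "fr (int (Suc n)) = \<phi> \<circ> fr (int n)" unfolding fr_nat by simp
  then show ?case by (simp only: r_comp[OF weil_\<phi> weil_fr] Suc funpow.simps)
qed (simp only: of_nat_0 fr_0 r_id funpow.simps)

text \<open>Conjugation by \<open>r \<phi>\<close> permutes the finite image of inertia, so some
  power of it is trivial there. This is how a power of Frobenius becomes central.\<close>

lemma finite_order_conj:
  obtains m where "m > 0" "\<And>i v. i \<in> I \<Longrightarrow> (r \<phi> ^^ m) (r i v) = r i ((r \<phi> ^^ m) v)"
proof -
  define c where "c X = r \<phi> \<circ> X \<circ> inv\<^bsub>GL scale\<^esub> (r \<phi>)" for X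
  note g = GL_inv_apply[OF r_GL[OF weil_\<phi>]]
  have "c ` r ` I \<subseteq> r ` I"
  proof clarify
    fix i assume i: "i \<in> I"
    obtain j where j: "j \<in> I" "fr 1 \<circ> i = j \<circ> fr 1" using fr_inertia[OF i] by blast
    then have "r \<phi> \<circ> r i = r j \<circ> r \<phi>"
      by (metis fr_1 i r_comp weil_\<phi> weil_inertia)
    then have "c (r i) = r j" by (simp add: c_def fun_eq_iff g)
    then show "c (r i) \<in> r ` I" using j(1) by simp
  qed
  moreover have "inj_on c (r ` I)"
  proof (rule inj_onI)
    fix X Y assume "c X = c Y"
    have "r \<phi> (X v) = r \<phi> (Y v)" for v
    proof -
      have "c X (r \<phi> v) = c Y (r \<phi> v)" by (simp only: \<open>c X = c Y\<close>)
      then show ?thesis by (simp add: c_def g)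
    qed
    then show "X = Y" using g(1) by (metis ext)
  qed
  ultimately obtain m where m: "m > 0" "\<And>X. X \<in> r ` I \<Longrightarrow> (c ^^ m) X = X"
    using finite_order_on[OF r_inertia_finite] by blast
  have "(r \<phi> ^^ n) (X v) = (c ^^ n) X ((r \<phi> ^^ n) v)" for n X v
    by (induction n) (simp_all add: c_def g)
  then show ?thesis using that m by (metis image_eqI)
qed

lemma r_\<phi>_inj: "r \<phi> v = 0 \<Longrightarrow> v = 0"
  by (metis GL_inv_apply(1) lin_zero GL_endo GL.inv_closed r_GL weil_\<phi>)

lemma r_\<phi>_funpow_inj: "(r \<phi> ^^ m) v = 0 \<Longrightarrow> v = 0"
  by (induction m) (auto dest: r_\<phi>_inj)

text \<open>Inertia commutes with \<open>r \<phi> ^^ m\<close>, hence with its unipotent part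
  \<open>u ^^ m\<close>, and \<open>unipotent_commute_root\<close> removes the exponent. This makes
  \<open>u\<close> commute with the whole Weil group and \<open>rss\<close> a homomorphism.\<close>

lemma u_inertia:
  assumes "i \<in> I"
  shows "u (r i v) = r i (u v)"
proof -
  obtain m where m: "m > 0" "\<And>v. (r \<phi> ^^ m) (r i v) = r i ((r \<phi> ^^ m) v)"
    using finite_order_conj assms by metis
  have "(u ^^ m) (r i v) = r i ((u ^^ m) v)" for v
    by (rule jordan_twisted_commute_unipotent[OF jordan_funpow[OF jordan] r_\<phi>_funpow_inj one_neq_zero
          r_endo[OF weil_inertia[OF assms]]]) (simp_all add: m(2))
  then show ?thesis by (rule unipotent_commute_root[OF J(1,2) r_endo[OF weil_inertia[OF assms]] m(1)])
qed

lemma s_funpow_inertia: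
  assumes "\<And>v. (r \<phi> ^^ m) (r i v) = r i ((r \<phi> ^^ m) v)" "i \<in> I"
  shows "(s ^^ m) (r i v) = r i ((s ^^ m) v)"
  using jordan_twisted_commute[OF jordan_funpow[OF jordan] r_endo[OF weil_inertia[OF assms(2)]], of m 1 v]
    assms(1) by simp

lemma commute_weil:
  assumes X: "\<And>v. X (r \<phi> v) = r \<phi> (X v)" "\<And>i v. i \<in> I \<Longrightarrow> X (r i v) = r i (X v)" and g: "g \<in> W"
  shows "X (r g v) = r g (X v)"
proof -
  have nat: "X (r (fr (int n)) v) = r (fr (int n)) (X v)" for n v
    unfolding r_fr_nat by (rule funpow_commute[symmetric]) (rule X(1)[symmetric])
  have inv: "r (fr (- int n)) (r (fr (int n)) v) = v" "r (fr (int n)) (r (fr (- int n)) v) = v" for n v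
    using r_comp[OF weil_fr weil_fr, of "- int n" "int n"] r_comp[OF weil_fr weil_fr, of "int n" "- int n"]
    by (simp_all add: fr_add[symmetric] fr_0 r_id fun_eq_iff)
  have "X (r (fr n) v) = r (fr n) (X v)" for n v
    by (cases n rule: int_cases2) (metis nat, metis nat inv)
  moreover obtain i n where "i \<in> I" "g = i \<circ> fr n" using g weil_iff by auto
  ultimately show ?thesis using X(2) r_comp[OF weil_inertia weil_fr] by simp
qed

lemma u_weil: "g \<in> W \<Longrightarrow> u (r g v) = r g (u v)"
  by (rule commute_weil) (auto simp: J(4,5) u_inertia)

lemma u_GL: "u \<in> carrier (GL scale)"
  unfolding GL_simps using injective_imp_bij[OF J(1) unipotent_injective[OF J(1,2)]] J(1) by blast

lemma r_\<phi>_N: "r \<phi> (N v) = inverse (of_nat q) \<star> N (r \<phi> v)"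
  using r_N[OF weil_\<phi>, of v] by (simp add: weil_val_\<phi> power_int_minus)

lemma q_inv: "inverse (of_nat q :: 'e) \<noteq> 0"
  using q_nonzero by simp

lemma u_N: "u (N v) = N (u v)"
  by (rule jordan_twisted_commute_unipotent[OF jordan r_\<phi>_inj q_inv wd(3) r_\<phi>_N])

abbreviation upow :: "int \<Rightarrow> 'v \<Rightarrow> 'v" where "upow n \<equiv> u [^]\<^bsub>GL scale\<^esub> n"

definition rss :: "('k \<Rightarrow> 'k) \<Rightarrow> 'v \<Rightarrow> 'v" where
  "rss g = r g \<circ> upow (- val g)"

lemma frobenius_ss_eq: "frobenius_ss absK K \<phi> scale (r, N) = (rss, N)"
  by (simp add: frobenius_ss_def rss_def[abs_def] u_def)

lemma upow_GL: "upow n \<in> carrier (GL scale)"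
  by (rule GL.int_pow_closed[OF u_GL])

lemma upow_add: "upow (m + n) = upow m \<circ> upow n"
  using GL.int_pow_mult[OF u_GL, of m n] by (simp add: GL_simps)

lemma upow_0: "upow 0 = id"
  by (simp add: GL_simps)

lemma upow_nat: "upow (int n) = u ^^ n"
  using GL_nat_pow[of u n] by (simp add: int_pow_int)

lemma rss_GL: "g \<in> W \<Longrightarrow> rss g \<in> carrier (GL scale)"
  unfolding rss_def using GL.m_closed[OF r_GL upow_GL] by (simp add: GL_simps)

lemmas rss_endo = GL_endo[OF rss_GL]

lemma rss_comp:
  assumes "g \<in> W" "h \<in> W"
  shows "rss (g \<circ> h) = rss g \<circ> rss h"
proof
  fix v
  have "r h (upow n v) = upow n (r h v)" for n v
    by (rule GL_int_pow_commute[OF u_GL]) (simp add: u_weil assms)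
  moreover have "upow (- val (g \<circ> h)) = upow (- val g) \<circ> upow (- val h)"
    by (simp add: weil_val_comp assms flip: upow_add)
  ultimately show "rss (g \<circ> h) v = (rss g \<circ> rss h) v"
    by (simp add: rss_def r_comp assms)
qed

lemma rss_inertia: "i \<in> I \<Longrightarrow> rss i = r i"
  by (simp add: rss_def weil_val_inertia upow_0[simplified])

lemma rss_id: "rss id = id"
  by (simp add: rss_inertia inertia_id r_id)

lemma rss_fr_nat: "rss (fr (int n)) = s ^^ n"
proof
  fix v
  have "rss (fr (int n)) v = (r \<phi> ^^ n) (upow (- int n) v)"
    by (simp add: rss_def weil_val_fr r_fr_nat)
  also have "\<dots> = (s ^^ n) ((u ^^ n) (upow (- int n) v))"
    using jordan_decompositionD(4)[OF jordan_funpow[OF jordan]] by simp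
  also have "(u ^^ n) (upow (- int n) v) = v"
    using fun_cong[OF upow_add[of "int n" "- int n"], of v] by (simp add: upow_nat[symmetric] GL_simps)
  finally show "rss (fr (int n)) v = (s ^^ n) v" .
qed

lemma rss_N: "g \<in> W \<Longrightarrow> rss g (N v) = (of_nat q powi (- val g)) \<star> N (rss g v)"
  using GL_int_pow_commute[OF u_GL, where X = N and n = "- val g" and v = v] u_N r_N[of g "upow (- val g) v"]
  by (simp add: rss_def)

lemma trace_rss:
  assumes "g \<in> W"
  shows "tr (rss g) = tr (r g)"
proof -
  have comm: "r g (u v) = u (r g v)" for v using u_weil[OF assms] by simp
  have comm': "rss g (u v) = u (rss g v)" for v
    using GL_int_pow_commute[OF u_GL, where X = u and n = "- val g" and v = v]
      comm[of "upow (- val g) v"] by (simp add: rss_def)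
  show ?thesis
  proof (cases "- val g" rule: int_cases2)
    case (nonneg n)
    then have "rss g = (\<lambda>v. r g ((u ^^ n) v))" by (auto simp: rss_def upow_nat)
    then show ?thesis using trace_unipotent_funpow[OF J(1,2) r_endo[OF assms] comm] by simp
  next
    \<comment> \<open>For a nonpositive exponent the roles are exchanged: \<open>r g\<close> is
      \<open>rss g\<close> followed by a nonnegative power of \<open>u\<close>, all of them
      commuting.\<close>
    case (nonpos n)
    have "upow (- int n) \<circ> upow (int n) = id" using upow_add[of "- int n" "int n"] by (simp add: GL_simps)
    then have "r g = (\<lambda>v. rss g ((u ^^ n) v))"
      using nonpos by (auto simp: rss_def fun_eq_iff simp flip: upow_nat)
    then show ?thesis using trace_unipotent_funpow[OF J(1,2) rss_endo[OF assms] comm'] by metis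
  qed
qed

lemma trace_r_of_nilp_exp:
  assumes g: "g \<in> W" and Y: "Y \<in> carrier (GL scale)"
    and rY: "r g = Y \<circ> nilp_exp scale (\<lambda>v. c \<star> N v)"
  shows "tr (r g) = tr Y"
proof (rule trace_eq_of_nilp_exp[OF wd(3,4) r_endo[OF g] r_N[OF g]])
  show "r g v = Y (nilp_exp scale (\<lambda>v. c \<star> N v) v)" for v by (simp add: rY)
qed (use Y r_GL[OF g] q_nonzero in \<open>auto simp: GL_simps\<close>)

lemma s_funpow_central:
  assumes "\<And>i v. i \<in> I \<Longrightarrow> (r \<phi> ^^ m) (r i v) = r i ((r \<phi> ^^ m) v)" and g: "g \<in> W"
  shows "(s ^^ m) (rss g v) = rss g ((s ^^ m) v)"
proof -
  have su: "(s ^^ m) (u v) = u ((s ^^ m) v)" for v by (rule funpow_commute) (rule J(5))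
  have "(s ^^ m) (r g v) = r g ((s ^^ m) v)" for v
    by (rule commute_weil[OF _ s_funpow_inertia[OF assms(1)] g])
      (rule funpow_commute, simp_all add: J(4,5))
  then show ?thesis
    using GL_int_pow_commute[OF u_GL, of "s ^^ m" "- val g"] su by (simp add: rss_def)
qed

text \<open>Rescaling \<open>s ^^ m\<close> by the rational number \<open>\<rho>\<close> allows both
  representations to be measured against one weight \<open>w'\<close>: \<open>\<rho> = 1\<close> for
  the first, and the value of the twist at the \<open>m\<close>-th power of Frobenius for the
  second.\<close>

lemma lefschetz:
  assumes m: "m > 0" and \<rho>: "\<rho> > 0" "real_of_rat \<rho> = real q powr (real m * real_of_int (w' - w) / 2)"
    and W_def: "\<And>i a. Wt i a \<longleftrightarrow> conjugates_abs (real q powr (real m * real_of_int (w' + i) / 2)) (a :: 'e)"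
    and eig: "of_rat \<rho> \<star> (s ^^ m) v = a \<star> v"
  shows "v \<noteq> 0 \<Longrightarrow> \<exists>i. Wt i a"
    and "Wt (int k) a \<Longrightarrow> (N ^^ k) v = 0 \<Longrightarrow> v = 0"
    and "v \<noteq> 0 \<Longrightarrow> Wt (- int k) a \<Longrightarrow>
      \<exists>u. of_rat \<rho> \<star> (s ^^ m) u = (a / (inverse (of_nat q) ^ m) ^ k) \<star> u \<and> (N ^^ k) u = v"
proof -
  define Wm where "Wm i b \<longleftrightarrow> conjugates_abs (real q powr (real m * real_of_int (w + i) / 2)) (b :: 'e)" for i b
  define b where "b = a / of_rat \<rho>"
  have \<rho>0: "(of_rat \<rho> :: 'e) \<noteq> 0" using \<rho>(1) by simp
  have "inverse (of_rat \<rho>) \<star> of_rat \<rho> \<star> (s ^^ m) v = inverse (of_rat \<rho>) \<star> a \<star> v" using eig by simp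
  then have sb: "(s ^^ m) v = b \<star> v" using \<rho>0 by (simp add: b_def divide_inverse mult.commute)
  obtain M where M: "monodromy_filtration scale N M"
    and pure: "\<And>i a v. v \<in> M i \<Longrightarrow> v \<notin> M (i - 1) \<Longrightarrow> r \<phi> v - a \<star> v \<in> M (i - 1) \<Longrightarrow> weil_number q (w + i) a"
    using wd_pure unfolding wd_pure_def by blast
  have pure': "Wm i (a ^ m)" if "v \<in> M i" "v \<notin> M (i - 1)" "r \<phi> v - a \<star> v \<in> M (i - 1)" for i a v
  proof -
    have "conjugates_abs ((real q powr (real_of_int (w + i) / 2)) ^ m) (a ^ m)"
      by (rule conjugates_abs_power[OF weil_number_imp_conjugates_abs[OF pure[OF that]] m])
    also have "(real q powr (real_of_int (w + i) / 2)) ^ m = real q powr (real m * real_of_int (w + i) / 2)"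
      using q_pos by (simp add: powr_powr mult.commute flip: powr_realpow)
    finally show ?thesis unfolding Wm_def .
  qed
  have Wm_unique: "i = j" if "Wm i a" "Wm j a" for i j a
    using conjugates_abs_weight_unique[OF that[unfolded Wm_def] q_gt_1 m] .
  have exps: "real_of_rat \<rho> * real q powr (real m * real_of_int (w + i) / 2) =
      real q powr (real m * real_of_int (w' + i) / 2)" for i
    unfolding \<rho>(2) powr_add[symmetric] by (simp add: field_simps)
  have Wt_Wm: "Wt i (of_rat \<rho> * c) \<longleftrightarrow> Wm i c" for i c
  proof
    assume "Wm i c"
    from conjugates_abs_scale[OF this[unfolded Wm_def] \<rho>(1)]
    show "Wt i (of_rat \<rho> * c)" unfolding W_def exps .
  next
    assume "Wt i (of_rat \<rho> * c)"
    from conjugates_abs_scale[OF this[unfolded W_def], of "inverse \<rho>"] \<rho>(1)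
    have "conjugates_abs (real_of_rat (inverse \<rho>) * real q powr (real m * real_of_int (w' + i) / 2))
        (of_rat (inverse \<rho>) * (of_rat \<rho> * c))" by simp
    also have "of_rat (inverse \<rho>) * (of_rat \<rho> * c) = c" using \<rho>0 by (simp add: of_rat_inverse)
    also have "real_of_rat (inverse \<rho>) * real q powr (real m * real_of_int (w' + i) / 2) =
        real q powr (real m * real_of_int (w + i) / 2)"
      unfolding exps[symmetric] using \<rho>(1) by (simp add: of_rat_inverse)
    finally show "Wm i c" unfolding Wm_def .
  qed
  have ab: "a = of_rat \<rho> * b" using \<rho>0 by (simp add: b_def)
  interpret F: pure_filtration scale N "r \<phi>" s u M "inverse (of_nat q)" m Wm
    by (intro pure_filtration.intro pure_filtration_axioms.intro alg_fd_space_axioms wd(3) M jordan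
        r_\<phi>_N q_inv) (fact pure' Wm_unique)+
  show "\<exists>i. Wt i a" if "v \<noteq> 0"
    unfolding ab Wt_Wm using F.eigenvector_weight[OF sb that] by blast
  show "v = 0" if "Wt (int k) a" "(N ^^ k) v = 0"
    using F.pure_lefschetz_inj[OF sb _ that(2)] that(1) unfolding ab Wt_Wm by blast
  show "\<exists>u. of_rat \<rho> \<star> (s ^^ m) u = (a / (inverse (of_nat q) ^ m) ^ k) \<star> u \<and> (N ^^ k) u = v"
    if v0: "v \<noteq> 0" and W: "Wt (- int k) a"
  proof -
    have "Wm (- int k) b" using W unfolding ab Wt_Wm .
    then obtain u where "(s ^^ m) u = (b / (inverse (of_nat q) ^ m) ^ k) \<star> u" "(N ^^ k) u = v"
      using F.pure_lefschetz_surj[OF sb v0] by blast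
    then show ?thesis by (intro exI[of _ u]) (simp add: ab)
  qed
qed

end

section \<open>Comparison of two pure representations\<close>

context local_galois
begin

text \<open>A positive \<open>card\<close> entails finiteness, so the distinct classes of 0 and 1
  can be counted.\<close>

lemma residue_card_gt_1:
  assumes "0 \<in> K" "1 \<in> K"
  shows "q > 1"
proof -
  define R where "R = {(x, y). x \<in> K \<and> y \<in> K \<and> absK x \<le> 1 \<and> absK y \<le> 1 \<and> absK (x - y) < 1}"
  define C where "C = {x \<in> K. absK x \<le> 1} // R"
  have q: "q = card C" by (simp add: residue_card_def C_def R_def)
  then have "finite C" using q_pos card_ge_0_finite by metis
  have abs0: "absK 0 = 0" using abs_eq_0 by simp
  have "R `` {0} \<in> C" "R `` {1} \<in> C"
    unfolding C_def using assms abs0 abs_1 by (auto intro!: quotientI)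
  then have "{R `` {0}, R `` {1}} \<subseteq> C" by blast
  moreover have "1 \<in> R `` {1}" "1 \<notin> R `` {0}"
    using assms abs0 abs_1 abs_minus[of 1] by (auto simp: R_def)
  then have "R `` {0} \<noteq> R `` {1}" by blast
  then have "card {R `` {0}, R `` {1}} = 2" by simp
  ultimately have "2 \<le> card C" using card_mono[OF \<open>finite C\<close>] by metis
  then show ?thesis using q by simp
qed

end

locale unramified_twist = local_galois +
  fixes \<psi> :: "('a \<Rightarrow> 'a) \<Rightarrow> 'e::field_char_0" and sqrt_q :: 'e
  assumes unramified: "unramified_character absK K \<psi>"
    and \<psi>_\<phi>: "\<psi> \<phi> = sqrt_q"
    and sqrt_q: "sqrt_q ^ 2 = of_nat (residue_card absK K)"
    and q_gt_1: "residue_card absK K > 1"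
begin

lemma \<psi>_nonzero: "g \<in> W \<Longrightarrow> \<psi> g \<noteq> 0"
  and \<psi>_comp: "g \<in> W \<Longrightarrow> h \<in> W \<Longrightarrow> \<psi> (g \<circ> h) = \<psi> g * \<psi> h"
  and \<psi>_inertia: "i \<in> I \<Longrightarrow> \<psi> i = 1"
  using unramified unfolding unramified_character_def by blast+

lemma sqrt_q_nonzero: "sqrt_q \<noteq> 0"
  using \<psi>_nonzero[OF weil_\<phi>] \<psi>_\<phi> by simp

lemma \<psi>_fr: "\<psi> (fr n) = sqrt_q powi n"
proof -
  have inv: "\<psi> (fr (- 1)) = inverse sqrt_q"
  proof -
    have "\<psi> (fr (- 1) \<circ> fr 1) = 1" unfolding fr_add[symmetric] by (simp add: fr_0 \<psi>_inertia inertia_id)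
    then have "\<psi> (fr (- 1)) * sqrt_q = 1" using \<psi>_comp[OF weil_fr weil_fr, of "- 1" 1] by (simp add: fr_1 \<psi>_\<phi>)
    then show ?thesis by (metis inverse_unique mult.commute)
  qed
  show ?thesis
  proof (induction n rule: int_induct[of _ 0])
    case base
    show ?case using \<psi>_inertia[OF inertia_id] by (simp only: fr_0 power_int_0_right)
  next
    case (step1 i)
    have "\<psi> (fr (i + 1)) = \<psi> (fr i) * \<psi> (fr 1)"
      using \<psi>_comp[OF weil_fr weil_fr, of i 1] by (simp only: fr_add)
    then show ?case using step1 sqrt_q_nonzero by (simp add: fr_1 \<psi>_\<phi> power_int_add)
  next
    case (step2 i)
    have "\<psi> (fr (i + - 1)) = \<psi> (fr i) * \<psi> (fr (- 1))"
      using \<psi>_comp[OF weil_fr weil_fr, of i "- 1"] by (simp only: fr_add)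
    then show ?case using step2 sqrt_q_nonzero by (simp add: inv power_int_diff divide_inverse)
  qed
qed

text \<open>\<psi> separates powers of Frobenius from inertia: it is trivial on \<open>I\<close>,
  while \<open>sqrt_q\<close> is not a root of unity because q exceeds 1. This makes
  \<open>weil_val\<close> well defined.\<close>

lemma fr_infinite: "fr n \<in> I \<Longrightarrow> n = 0"
proof (rule ccontr)
  assume n: "fr n \<in> I" "n \<noteq> 0"
  have "fr (int k) \<notin> I" if "k > 0" for k
  proof
    assume "fr (int k) \<in> I"
    then have "sqrt_q ^ k = 1" using \<psi>_fr[of "int k"] \<psi>_inertia by simp
    then have "(sqrt_q ^ 2) ^ k = 1" by (metis mult.commute power_mult power_one)
    then have "(of_nat (q ^ k) :: 'e) = of_nat 1" by (simp add: sqrt_q)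
    then have "q ^ k = 1" by (simp only: of_nat_eq_iff)
    then show False using q_gt_1 that one_less_power[of q k] by simp
  qed
  then show False using n inertia_inv[OF n(1)] fr_minus[of n]
    by (cases n rule: int_cases2) (auto simp: fr_minus)
qed

sublocale local_galois_val
  by unfold_locales (rule fr_infinite, simp add: fr_def)

end

lemma of_rat_power_int: "of_rat (x powi n) = (of_rat x powi n :: 'a::field_char_0)"
  by (simp add: power_int_def of_rat_power of_rat_inverse)

section \<open>The direct sum of the two representations\<close>

locale pure_pair = unramified_twist absK K \<phi> \<psi> sqrt_q +
  R1: pure_weil_deligne absK K \<phi> scale1 r1 N1 w1 + R2: pure_weil_deligne absK K \<phi> scale2 r2 N2 w2
  for absK :: "'k::{alg_closed_field, field_char_0} \<Rightarrow> real" and K :: "'k set" and \<phi> :: "'k \<Rightarrow> 'k"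
    and \<psi> :: "('k \<Rightarrow> 'k) \<Rightarrow> 'e::{alg_closed_field, field_char_0}" and sqrt_q :: 'e
    and scale1 :: "'e \<Rightarrow> 'v1::ab_group_add \<Rightarrow> 'v1" and r1 N1 w1
    and scale2 :: "'e \<Rightarrow> 'v2::ab_group_add \<Rightarrow> 'v2" and r2 N2 w2 +
  assumes trace_eq: "g \<in> carrier (weil_group absK K) \<Longrightarrow>
    lin_trace scale1 (r1 g) = \<psi> g powi (w1 - w2) * lin_trace scale2 (r2 g)"
begin

definition tw :: "('k \<Rightarrow> 'k) \<Rightarrow> 'e" where "tw g = \<psi> g powi (w1 - w2)"

lemma tw_comp: "g \<in> W \<Longrightarrow> h \<in> W \<Longrightarrow> tw (g \<circ> h) = tw g * tw h"
  by (simp add: tw_def \<psi>_comp power_int_mult_distrib)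

lemma tw_inertia: "i \<in> I \<Longrightarrow> tw i = 1"
  by (simp add: tw_def \<psi>_inertia)

definition scale :: "'e \<Rightarrow> 'v1 \<times> 'v2 \<Rightarrow> 'v1 \<times> 'v2" where
  "scale c p = (scale1 c (fst p), scale2 c (snd p))"

lemma lin_inl: "Vector_Spaces.linear scale1 scale (\<lambda>x. (x, 0))"
  and lin_inr: "Vector_Spaces.linear scale2 scale (\<lambda>y. (0, y))"
  and lin_fst: "Vector_Spaces.linear scale scale1 fst"
  and lin_snd: "Vector_Spaces.linear scale scale2 snd"
proof -
  have "vector_space scale"
    by (rule vector_space.intro)
      (simp_all add: scale_def R1.scale_right_distrib R2.scale_right_distrib
        R1.scale_left_distrib R2.scale_left_distrib prod_eq_iff)
  then show "Vector_Spaces.linear scale1 scale (\<lambda>x. (x, 0))" "Vector_Spaces.linear scale2 scale (\<lambda>y. (0, y))"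
    "Vector_Spaces.linear scale scale1 fst" "Vector_Spaces.linear scale scale2 snd"
    using R1.vector_space_axioms R2.vector_space_axioms
    by (simp_all add: Vector_Spaces.linear_iff scale_def)
qed

sublocale P: alg_fd_space scale
proof -
  interpret vector_space scale using lin_fst by (simp add: Vector_Spaces.linear_iff)
  show "alg_fd_space scale"
  proof (intro alg_fd_space.intro fd_space.intro fd_space_axioms.intro vector_space_axioms)
    let ?B = "(\<lambda>x. (x, 0)) ` R1.basis \<union> (\<lambda>y. (0, y)) ` R2.basis"
    have 1: "span ((\<lambda>x. (x, 0)) ` R1.basis) = range (\<lambda>x. (x, 0))"
      using module_hom.span_image[OF lin_inl[unfolded linear_iff_module_hom], of R1.basis] R1.basis(3) by simp
    have 2: "span ((\<lambda>y. (0, y)) ` R2.basis) = range (\<lambda>y. (0, y))"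
      using module_hom.span_image[OF lin_inr[unfolded linear_iff_module_hom], of R2.basis] R2.basis(3) by simp
    have "(x, y) \<in> span ?B" for x y
    proof -
      have "(x, 0) \<in> span ?B" "(0, y) \<in> span ?B"
        using 1 2 span_mono[of "(\<lambda>x. (x, 0)) ` R1.basis" ?B] span_mono[of "(\<lambda>y. (0, y)) ` R2.basis" ?B]
        by blast+
      from span_add[OF this] show ?thesis by simp
    qed
    then have "span ?B = UNIV" by auto
    then show "\<exists>B. finite B \<and> span B = UNIV"
      using R1.basis(1) R2.basis(1) by (intro exI[of _ ?B]) simp
  qed
qed

definition pair_map :: "('v1 \<Rightarrow> 'v1) \<Rightarrow> ('v2 \<Rightarrow> 'v2) \<Rightarrow> 'v1 \<times> 'v2 \<Rightarrow> 'v1 \<times> 'v2" where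
  "pair_map f g p = (f (fst p), g (snd p))"

lemma endo_pair_map: "endo scale1 f \<Longrightarrow> endo scale2 g \<Longrightarrow> endo scale (pair_map f g)"
  by (simp add: P.endo_iff R1.endo_iff R2.endo_iff pair_map_def scale_def)

lemma pair_map_funpow: "(pair_map f g ^^ n) p = ((f ^^ n) (fst p), (g ^^ n) (snd p))"
  by (induction n) (simp_all add: pair_map_def)

definition R2' :: "('k \<Rightarrow> 'k) \<Rightarrow> 'v2 \<Rightarrow> 'v2" where "R2' g y = scale2 (tw g) (R2.rss g y)"

lemma R2'_endo: "g \<in> W \<Longrightarrow> endo scale2 (R2' g)"
  unfolding R2'_def[abs_def] by (rule lin_smult[OF R2.rss_endo])

lemma R2'_comp: "g \<in> W \<Longrightarrow> h \<in> W \<Longrightarrow> R2' (g \<circ> h) y = R2' g (R2' h y)"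
  by (simp add: R2'_def tw_comp R2.rss_comp lin_scale[OF R2.rss_endo])

lemma R2'_id: "R2' id y = y"
  using tw_inertia[OF inertia_id] R2.rss_id by (simp only: R2'_def R2.scale_one id_apply)

definition Op :: "('k \<Rightarrow> 'k) \<Rightarrow> 'v1 \<times> 'v2 \<Rightarrow> 'v1 \<times> 'v2" where "Op g = pair_map (R1.rss g) (R2' g)"

abbreviation "NN \<equiv> pair_map N1 N2"

lemma Op_endo: "g \<in> W \<Longrightarrow> endo scale (Op g)"
  unfolding Op_def by (rule endo_pair_map[OF R1.rss_endo R2'_endo])

lemma Op_comp: "g \<in> W \<Longrightarrow> h \<in> W \<Longrightarrow> Op (g \<circ> h) p = Op g (Op h p)"
  by (simp add: Op_def pair_map_def R1.rss_comp R2'_comp)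

lemma Op_id: "Op id p = p"
  using R1.rss_id R2'_id by (simp only: Op_def pair_map_def id_apply prod.collapse)

lemma Op_N: "g \<in> W \<Longrightarrow> Op g (NN p) = scale (of_nat q powi (- val g)) (NN (Op g p))"
  by (simp add: Op_def pair_map_def scale_def R1.rss_N R2'_def R2.rss_N lin_scale[OF R2.wd(3)] mult.commute)

lemma Op_fr_nat: "Op (fr (int n)) p =
    ((R1.s ^^ n) (fst p), scale2 ((sqrt_q powi (w1 - w2)) ^ n) ((R2.s ^^ n) (snd p)))"
proof -
  have "tw (fr (int n)) = (sqrt_q powi (w1 - w2)) ^ n"
    by (simp add: tw_def \<psi>_fr power_int_power power_int_power' mult.commute)
  then show ?thesis by (simp add: Op_def pair_map_def R1.rss_fr_nat R2'_def R2.rss_fr_nat)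
qed

lemma Op_fr_power: "(Op (fr n) ^^ k) p = Op (fr (n * int k)) p"
proof (induction k arbitrary: p)
  case 0
  have "Op (fr (n * int 0)) p = p" by (simp only: fr_0 mult_zero_right of_nat_0 Op_id)
  then show ?case by simp
next
  case (Suc k)
  have "fr (n * int (Suc k)) = fr n \<circ> fr (n * int k)" by (simp add: fr_add[symmetric] algebra_simps)
  then have "Op (fr (n * int (Suc k))) p = Op (fr n) (Op (fr (n * int k)) p)"
    by (simp only: Op_comp[OF weil_fr weil_fr])
  then show ?case by (simp only: funpow.simps o_apply Suc)
qed

text \<open>In the normal form \<open>h \<circ> fr n\<close> the exponent is reduced modulo
  \<open>m\<close>, and \<open>h\<close> acts through the finite images of inertia under
  \<open>r1\<close> and \<open>r2\<close>.\<close>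

lemma finite_mod_fr:
  assumes "m > 0"
  shows "\<exists>F. finite F \<and> F \<subseteq> Op ` W \<and>
    (\<forall>A\<in>Op ` W. \<exists>B\<in>F. \<exists>i j. \<forall>p. A ((Op (fr (int m)) ^^ i) p) = B ((Op (fr (int m)) ^^ j) p))"
proof -
  define F where "F = (\<lambda>(i, j). Op (i \<circ> fr (int j))) ` (I \<times> {..<m})"
  have "finite F"
  proof -
    have "F \<subseteq> (\<lambda>(X, Y, j) p. pair_map X Y (Op (fr (int j)) p)) ` (R1.rss ` I \<times> R2' ` I \<times> {..<m})"
    proof
      fix A assume "A \<in> F"
      then obtain i j where ij: "i \<in> I" "j < m" "A = Op (i \<circ> fr (int j))" by (auto simp: F_def)
      have "A = (\<lambda>p. pair_map (R1.rss i) (R2' i) (Op (fr (int j)) p))"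
        by (rule ext) (simp only: ij(3) Op_comp[OF weil_inertia[OF ij(1)] weil_fr], simp add: Op_def)
      then show "A \<in> (\<lambda>(X, Y, j) p. pair_map X Y (Op (fr (int j)) p)) ` (R1.rss ` I \<times> R2' ` I \<times> {..<m})"
        using ij by (intro image_eqI[of _ _ "(R1.rss i, R2' i, j)"]) auto
    qed
    moreover have "R1.rss ` I = r1 ` I" "R2' ` I = r2 ` I"
      by (auto simp: R1.rss_inertia R2'_def[abs_def] R2.rss_inertia tw_inertia image_def)
    ultimately show ?thesis
      using R1.r_inertia_finite R2.r_inertia_finite by (simp add: finite_subset)
  qed
  moreover have "F \<subseteq> Op ` W"
    unfolding F_def using weil_comp[OF weil_inertia weil_fr] by auto
  moreover have "\<exists>B\<in>F. \<exists>i j. \<forall>p. A ((Op (fr (int m)) ^^ i) p) = B ((Op (fr (int m)) ^^ j) p)"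
    if A: "A \<in> Op ` W" for A
  proof -
    obtain h n where h: "h \<in> I" "A = Op (h \<circ> fr n)" 
    proof -
      obtain g where g: "g \<in> W" "A = Op g" using A by (rule imageE)
      obtain h n where "h \<in> I" "g = h \<circ> fr n" using g(1) unfolding weil_iff by (elim bexE exE)
      then show ?thesis using that[of h n] g(2) by (simp only:)
    qed
    define j where "j = nat (n mod int m)"
    have j: "int j = n mod int m" "j < m" using assms by (auto simp: j_def nat_less_iff)
    have B: "Op (h \<circ> fr (int j)) \<in> F" using h(1) j(2) by (auto simp: F_def)
    \<comment> \<open>The multiple of \<open>m\<close> is put on the side where its exponent is
      nonnegative.\<close>
    obtain a b where ab: "n + int m * int a = int j + int m * int b"
    proof (cases "n div int m \<ge> 0")
      case True
      have "n + int m * int 0 = int j + int m * int (nat (n div int m))"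
        using True j(1) by (simp add: algebra_simps)
      then show ?thesis by (rule that)
    next
      case False
      have "n + int m * int (nat (- (n div int m))) = int j + int m * int 0"
        using False j(1) minus_mult_div_eq_mod[of n "int m"] by simp
      then show ?thesis by (rule that)
    qed
    have "A ((Op (fr (int m)) ^^ a) p) = Op (h \<circ> fr (int j)) ((Op (fr (int m)) ^^ b) p)" for p
    proof -
      have "A ((Op (fr (int m)) ^^ a) p) = Op (h \<circ> fr (n + int m * int a)) p"
        by (simp only: h(2) Op_fr_power fr_add Op_comp weil_comp weil_inertia[OF h(1)] weil_fr)
      also have "\<dots> = Op (h \<circ> fr (int j)) ((Op (fr (int m)) ^^ b) p)"
        by (simp only: ab Op_fr_power fr_add Op_comp weil_comp weil_inertia[OF h(1)] weil_fr)
      finally show ?thesis .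
    qed
    then show ?thesis using B by blast
  qed
  ultimately show ?thesis by (intro exI[of _ F]) blast
qed

lemma diagonalizable_pair:
  assumes d1: "R1.diagonalizable f" and d2: "R2.diagonalizable g"
  shows "P.diagonalizable (pair_map f (\<lambda>y. scale2 c (g y)))"
proof -
  obtain A1 where A1: "finite A1" "\<And>v. (\<Sum>a\<in>A1. R1.eigenproj f a v) = v"
    using R1.eigenproj_sum[OF d1] by blast
  obtain A2 where A2: "finite A2" "\<And>v. (\<Sum>a\<in>A2. R2.eigenproj g a v) = v"
    using R2.eigenproj_sum[OF d2] by blast
  note f = R1.diagonalizable_endo[OF d1] and g = R2.diagonalizable_endo[OF d2]
  define Z where "Z = pair_map f (\<lambda>y. scale2 c (g y))"
  have Z: "endo scale Z" unfolding Z_def by (rule endo_pair_map[OF f lin_smult[OF g]])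
  let ?A = "A1 \<union> (\<lambda>a. c * a) ` A2"
  let ?S = "{p. \<exists>a\<in>?A. Z p = scale a p}"
  have "(x, y) \<in> P.span ?S" for x y
  proof -
    have "(R1.eigenproj f a x, 0) \<in> ?S" if "a \<in> A1" for a
      using that by (auto simp: Z_def pair_map_def scale_def R1.eigenproj_eigen[OF d1] lin_zero[OF g] intro!: bexI[of _ a])
    then have "(\<Sum>a\<in>A1. (R1.eigenproj f a x, 0)) \<in> P.span ?S" by (intro P.span_sum P.span_base)
    moreover have "(0, R2.eigenproj g a y) \<in> ?S" if "a \<in> A2" for a
      using that by (auto simp: Z_def pair_map_def scale_def R2.eigenproj_eigen[OF d2] lin_zero[OF f] intro!: bexI[of _ "c * a"])
    then have "(\<Sum>a\<in>A2. (0, R2.eigenproj g a y)) \<in> P.span ?S" by (intro P.span_sum P.span_base)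
    ultimately have "(\<Sum>a\<in>A1. (R1.eigenproj f a x, 0)) + (\<Sum>a\<in>A2. (0, R2.eigenproj g a y)) \<in> P.span ?S"
      by (rule P.span_add)
    moreover have "(\<Sum>a\<in>A1. (R1.eigenproj f a x, 0::'v2)) = (x, 0)"
      using lin_sum[OF lin_inl, of "\<lambda>a. R1.eigenproj f a x" A1] A1(2) by simp
    moreover have "(\<Sum>a\<in>A2. (0::'v1, R2.eigenproj g a y)) = (0, y)"
      using lin_sum[OF lin_inr, of "\<lambda>a. R2.eigenproj g a y" A2] A2(2) by simp
    ultimately show ?thesis by simp
  qed
  then show ?thesis
    unfolding Z_def[symmetric] using A1(1) A2(1) by (intro P.diagonalizableI[OF Z, of ?A]) auto
qed

text \<open>\<open>k1 * k2\<close> serves both representations. The additional factor 2 turns the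
  power of \<open>sqrt_q\<close> in the twist into a power of q.\<close>

lemma common_order:
  obtains k where "k > 0"
    "\<And>i v. i \<in> I \<Longrightarrow> (r1 \<phi> ^^ (2 * k)) (r1 i v) = r1 i ((r1 \<phi> ^^ (2 * k)) v)"
    "\<And>i v. i \<in> I \<Longrightarrow> (r2 \<phi> ^^ (2 * k)) (r2 i v) = r2 i ((r2 \<phi> ^^ (2 * k)) v)"
proof -
  obtain k1 where k1: "k1 > 0" "\<And>i v. i \<in> I \<Longrightarrow> (r1 \<phi> ^^ k1) (r1 i v) = r1 i ((r1 \<phi> ^^ k1) v)"
    using R1.finite_order_conj by blast
  obtain k2 where k2: "k2 > 0" "\<And>i v. i \<in> I \<Longrightarrow> (r2 \<phi> ^^ k2) (r2 i v) = r2 i ((r2 \<phi> ^^ k2) v)"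
    using R2.finite_order_conj by blast
  have 1: "f ^^ (2 * (k1 * k2)) = (f ^^ k1) ^^ (2 * k2)" for f :: "'v1 \<Rightarrow> 'v1"
    by (simp add: funpow_mult algebra_simps)
  have 2: "f ^^ (2 * (k1 * k2)) = (f ^^ k2) ^^ (2 * k1)" for f :: "'v2 \<Rightarrow> 'v2"
    by (simp add: funpow_mult algebra_simps)
  show ?thesis
  proof (rule that[of "k1 * k2"])
    show "(r1 \<phi> ^^ (2 * (k1 * k2))) (r1 i v) = r1 i ((r1 \<phi> ^^ (2 * (k1 * k2))) v)" if "i \<in> I" for i v
      unfolding 1 by (rule funpow_commute) (rule k1(2)[OF that])
    show "(r2 \<phi> ^^ (2 * (k1 * k2))) (r2 i v) = r2 i ((r2 \<phi> ^^ (2 * (k1 * k2))) v)" if "i \<in> I" for i v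
      unfolding 2 by (rule funpow_commute) (rule k2(2)[OF that])
  qed (use k1 k2 in simp)
qed

theorem rss_isomorphic:
  "wd_iso absK K scale1 scale2 (R1.rss, N1) (wd_twist scale2 tw (R2.rss, N2))"
proof -
  obtain k where k: "k > 0"
    "\<And>i v. i \<in> I \<Longrightarrow> (r1 \<phi> ^^ (2 * k)) (r1 i v) = r1 i ((r1 \<phi> ^^ (2 * k)) v)"
    "\<And>i v. i \<in> I \<Longrightarrow> (r2 \<phi> ^^ (2 * k)) (r2 i v) = r2 i ((r2 \<phi> ^^ (2 * k)) v)"
    using common_order by blast
  define m where "m = 2 * k"
  have m: "m > 0" using k(1) by (simp add: m_def)
  \<comment> \<open>The value of \<open>tw\<close> at \<open>fr m\<close>: since
    \<open>m = 2 * k\<close>, it is a power of q and thus rational, and its real size accounts for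
    the difference of the weights.\<close>
  define \<rho> :: rat where "\<rho> = of_nat q powi ((w1 - w2) * int k)"
  have \<rho>_pos: "\<rho> > 0" unfolding \<rho>_def using q_pos by (intro zero_less_power_int) simp
  have \<rho>_E: "of_rat \<rho> = (sqrt_q powi (w1 - w2)) ^ m"
  proof -
    have "(sqrt_q powi (w1 - w2)) ^ m = (sqrt_q powi (w1 - w2)) powi int m"
      by (simp only: power_int_of_nat)
    also have "\<dots> = sqrt_q powi (int 2 * ((w1 - w2) * int k))"
      by (simp only: power_int_mult[symmetric] m_def) (simp add: mult_ac)
    also have "\<dots> = (sqrt_q ^ 2) powi ((w1 - w2) * int k)"
      by (simp only: power_int_mult power_int_of_nat)
    finally show ?thesis by (simp add: \<rho>_def sqrt_q of_rat_power_int)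
  qed
  have \<rho>_R: "real_of_rat \<rho> = real q powr (real m * real_of_int (w1 - w2) / 2)"
  proof -
    have "real_of_rat \<rho> = real q powi ((w1 - w2) * int k)" by (simp add: \<rho>_def of_rat_power_int)
    also have "\<dots> = real q powr real_of_int ((w1 - w2) * int k)"
      by (rule powr_real_of_int'[symmetric]) (use q_pos in auto)
    finally show ?thesis by (simp add: m_def mult.commute)
  qed
  \<comment> \<open>Weights are measured relative to \<open>w1\<close> on both summands; on the
    second one the factor \<open>\<rho>\<close> contained in \<open>Z\<close> compensates the
    difference.\<close>
  define Wt where "Wt i a \<longleftrightarrow> conjugates_abs (real q powr (real m * real_of_int (w1 + i) / 2)) (a :: 'e)" for i a
  \<comment> \<open>At eigenvalues of \<open>Z\<close>, \<open>Wt_ex\<close> and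
    \<open>Wt_unique\<close> make this description proper; its other values are arbitrary.\<close>
  define wt where "wt a = (THE i. Wt i a)" for a
  define Z where "Z = Op (fr (int m))"
  define \<kappa> where "\<kappa> = inverse (of_nat q :: 'e) ^ m"
  have Wt_unique: "i = j" if "Wt i a" "Wt j a" for i j a
    using conjugates_abs_weight_unique[OF that[unfolded Wt_def] q_gt_1 m] .
  have wt_eq: "wt a = i" if "Wt i a" for i a
    unfolding wt_def using that Wt_unique by blast
  have Z_def': "Z p = ((R1.s ^^ m) (fst p), scale2 (of_rat \<rho>) ((R2.s ^^ m) (snd p)))" for p
    by (simp add: Z_def Op_fr_nat \<rho>_E)
  have one: "(0::rat) < 1" "real_of_rat 1 = real q powr (real m * real_of_int (w1 - w1) / 2)"
    using q_pos by simp_all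
  note L1 = R1.lefschetz[where w' = w1, OF m one Wt_def]
  note L2 = R2.lefschetz[where w' = w1, OF m \<rho>_pos \<rho>_R Wt_def]
  have eig: "scale1 (of_rat 1) ((R1.s ^^ m) (fst p)) = scale1 a (fst p)"
    "scale2 (of_rat \<rho>) ((R2.s ^^ m) (snd p)) = scale2 a (snd p)" if "Z p = scale a p" for p a
    using that by (simp_all add: Z_def' scale_def prod_eq_iff)
  have Wt_ex: "\<exists>i. Wt i a" if "p \<noteq> 0" "Z p = scale a p" for p a
  proof -
    have "fst p \<noteq> 0 \<or> snd p \<noteq> 0" using that(1) by (simp add: prod_eq_iff)
    then show ?thesis using L1(1)[OF eig(1)[OF that(2)]] L2(1)[OF eig(2)[OF that(2)]] by blast
  qed
  interpret S: lefschetz_system scale "Op ` W" NN Z \<kappa> wt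
  proof (intro lefschetz_system.intro lefschetz_system_axioms.intro operator_group.intro
      operator_group_axioms.intro P.alg_fd_space_axioms)
    show "endo scale g" if g: "g \<in> Op ` W" for g using that Op_endo by blast
    show "(\<lambda>v. g (h v)) \<in> Op ` W" if g: "g \<in> Op ` W" and h: "h \<in> Op ` W" for g h
    proof -
      obtain a b where "a \<in> W" "b \<in> W" "g = Op a" "h = Op b" using g h by blast
      then have "(\<lambda>v. g (h v)) = Op (a \<circ> b)" "a \<circ> b \<in> W" using Op_comp weil_comp by auto
      then show ?thesis by blast
    qed
    show "(\<lambda>v. v) \<in> Op ` W"
      using weil_id Op_id by (intro image_eqI[of _ _ id]) auto
    show "\<exists>h\<in>Op ` W. \<forall>v. h (g v) = v \<and> g (h v) = v" if g: "g \<in> Op ` W" for g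
    proof -
      obtain a where a: "a \<in> W" "g = Op a" using g by blast
      have "a \<circ> inv\<^bsub>\<Gamma>\<^esub> a = id" "inv\<^bsub>\<Gamma>\<^esub> a \<circ> a = id"
        using gal_cancel[OF weil_gal[OF a(1)]] by (auto simp: fun_eq_iff)
      then have "Op (inv\<^bsub>\<Gamma>\<^esub> a) (g v) = v" "g (Op (inv\<^bsub>\<Gamma>\<^esub> a) v) = v" for v
        using Op_comp[OF a(1) weil_inv[OF a(1)], of v] Op_comp[OF weil_inv[OF a(1)] a(1), of v] Op_id[of v] a(2)
        by metis+
      then show ?thesis using weil_inv[OF a(1)] by blast
    qed
    show "endo scale NN" by (rule endo_pair_map[OF R1.wd(3) R2.wd(3)])
    show "\<exists>c. c \<noteq> 0 \<and> (\<forall>v. g (NN v) = scale c (NN (g v)))" if g: "g \<in> Op ` W" for g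
    proof -
      obtain a where "a \<in> W" "g = Op a" using g by blast
      then show ?thesis using Op_N R1.q_nonzero
        by (intro exI[of _ "of_nat q powi (- val a)"]) simp
    qed
    show "Z \<in> Op ` W" unfolding Z_def using weil_fr by blast
    have "Z = pair_map (R1.s ^^ m) (\<lambda>y. scale2 (of_rat \<rho>) ((R2.s ^^ m) y))"
      using Z_def' by (auto simp: pair_map_def)
    then show "P.diagonalizable Z"
      using diagonalizable_pair[OF R1.diagonalizable_funpow[OF R1.J(3)] R2.diagonalizable_funpow[OF R2.J(3)]]
      by simp
    show "Z (g v) = g (Z v)" if g: "g \<in> Op ` W" for g v
    proof -
      obtain a where a: "a \<in> W" "g = Op a" using g by blast
      have "(R1.s ^^ m) (R1.rss a x) = R1.rss a ((R1.s ^^ m) x)" for x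
        by (rule R1.s_funpow_central[OF _ a(1)]) (simp add: m_def k(2))
      moreover have "(R2.s ^^ m) (R2.rss a x) = R2.rss a ((R2.s ^^ m) x)" for x
        by (rule R2.s_funpow_central[OF _ a(1)]) (simp add: m_def k(3))
      ultimately show ?thesis
        by (simp add: a(2) Z_def' Op_def pair_map_def R2'_def lin_scale[OF R2.rss_endo[OF a(1)]]
            lin_scale[OF P.endo_funpow] lin_scale[OF R2.endo_funpow[OF R2.J(6)]] mult.commute)
    qed
    show "\<exists>F. finite F \<and> F \<subseteq> Op ` W \<and>
      (\<forall>g\<in>Op ` W. \<exists>h\<in>F. \<exists>i j. \<forall>v. g ((Z ^^ i) v) = h ((Z ^^ j) v))"
      unfolding Z_def by (rule finite_mod_fr[OF m])
    show "Z (NN v) = scale \<kappa> (NN (Z v))" for v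
      using Op_N[OF weil_fr, of "int m" v]
      by (simp add: Z_def \<kappa>_def weil_val_fr power_int_minus power_inverse)
    show "\<kappa> \<noteq> 0" unfolding \<kappa>_def using R1.q_nonzero by simp
    show "\<kappa> ^ n \<noteq> 1" if "n > 0" for n
    proof
      assume "\<kappa> ^ n = 1"
      then have "inverse ((of_nat q :: 'e) ^ (m * n)) = 1" by (simp add: \<kappa>_def power_mult power_inverse)
      then have "(of_nat (q ^ (m * n)) :: 'e) = of_nat 1" by simp
      then have "q ^ (m * n) = 1" by (simp only: of_nat_eq_iff)
      then show False using one_less_power[OF q_gt_1, of "m * n"] m that by simp
    qed
    show "wt (\<kappa> ^ n * a) = wt a - 2 * int n" if v: "v \<noteq> 0" "Z v = scale a v" for v a n
    proof -
      obtain i where i: "Wt i a" using Wt_ex v by blast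
      have "conjugates_abs (real_of_rat (inverse (of_nat q) ^ (m * n)) * real q powr (real m * real_of_int (w1 + i) / 2))
          (of_rat (inverse (of_nat q) ^ (m * n)) * a)"
        by (rule conjugates_abs_scale[OF i[unfolded Wt_def]]) (use q_pos in simp)
      also have "of_rat (inverse (of_nat q) ^ (m * n)) * a = \<kappa> ^ n * a"
        by (simp add: \<kappa>_def of_rat_power of_rat_inverse power_mult)
      also have "real_of_rat (inverse (of_nat q) ^ (m * n)) * real q powr (real m * real_of_int (w1 + i) / 2) =
          real q powr (real m * real_of_int (w1 + (i - 2 * int n)) / 2)"
      proof -
        have "real_of_rat (inverse (of_nat q) ^ (m * n)) = real q powr (- real (m * n))"
        proof -
          have p: "real q powr real (m * n) = real q ^ (m * n)" by (rule powr_realpow) (use q_pos in simp)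
          show ?thesis unfolding powr_minus p by (simp add: of_rat_power of_rat_inverse power_inverse)
        qed
        then show ?thesis by (simp add: algebra_simps add_divide_distrib diff_divide_distrib flip: powr_add)
      qed
      finally have "Wt (i - 2 * int n) (\<kappa> ^ n * a)" unfolding Wt_def .
      then show ?thesis using wt_eq i by simp
    qed
    show "v = 0" if v: "Z v = scale a v" "wt a = int j" "(NN ^^ j) v = 0" for v a j
    proof (rule ccontr)
      assume "v \<noteq> 0"
      then obtain i where i: "Wt i a" using Wt_ex v(1) by blast
      then have W: "Wt (int j) a" using wt_eq v(2) by simp
      have "(N1 ^^ j) (fst v) = 0" "(N2 ^^ j) (snd v) = 0"
        using v(3) by (simp_all add: pair_map_funpow prod_eq_iff)
      then have "fst v = 0" "snd v = 0"
        using L1(2)[OF eig(1)[OF v(1)] W] L2(2)[OF eig(2)[OF v(1)] W] by blast+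
      then show False using \<open>v \<noteq> 0\<close> by (simp add: prod_eq_iff)
    qed
    show "\<exists>u. Z u = scale (a / \<kappa> ^ j) u \<and> (NN ^^ j) u = v"
      if v: "v \<noteq> 0" "Z v = scale a v" "wt a = - int j" for v a j
    proof -
      obtain i where i: "Wt i a" using Wt_ex v(1,2) by blast
      then have W: "Wt (- int j) a" using wt_eq v(3) by simp
      have "\<exists>u. scale1 (of_rat 1) ((R1.s ^^ m) u) = scale1 (a / \<kappa> ^ j) u \<and> (N1 ^^ j) u = fst v"
      proof (cases "fst v = 0")
        case True
        then show ?thesis
          by (intro exI[of _ 0]) (simp add: lin_zero[OF R1.endo_funpow[OF R1.J(6)]] lin_zero[OF R1.endo_funpow[OF R1.wd(3)]])
      next
        case False
        then show ?thesis unfolding \<kappa>_def by (rule L1(3)[OF eig(1)[OF v(2)] _ W])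
      qed
      moreover have "\<exists>u. scale2 (of_rat \<rho>) ((R2.s ^^ m) u) = scale2 (a / \<kappa> ^ j) u \<and> (N2 ^^ j) u = snd v"
      proof (cases "snd v = 0")
        case True
        then show ?thesis
          by (intro exI[of _ 0]) (simp add: lin_zero[OF R2.endo_funpow[OF R2.J(6)]] lin_zero[OF R2.endo_funpow[OF R2.wd(3)]])
      next
        case False
        then show ?thesis unfolding \<kappa>_def by (rule L2(3)[OF eig(2)[OF v(2)] _ W])
      qed
      ultimately obtain u1 u2 where "scale1 (of_rat 1) ((R1.s ^^ m) u1) = scale1 (a / \<kappa> ^ j) u1"
        "(N1 ^^ j) u1 = fst v" "scale2 (of_rat \<rho>) ((R2.s ^^ m) u2) = scale2 (a / \<kappa> ^ j) u2"
        "(N2 ^^ j) u2 = snd v" by blast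
      then show ?thesis
        by (intro exI[of _ "(u1, u2)"]) (simp add: Z_def' scale_def pair_map_funpow)
    qed
  qed
  \<comment> \<open>The two summands enter as projections of the direct sum, and equality of their
    traces is the hypothesis on characters.\<close>
  define f1 :: "'v1 \<times> 'v2 \<Rightarrow> 'v1 \<times> 'v2" where "f1 p = (fst p, 0)" for p
  define f2 :: "'v1 \<times> 'v2 \<Rightarrow> 'v1 \<times> 'v2" where "f2 p = (0, snd p)" for p
  have lf: "endo scale f1" "endo scale f2"
    using lin_comp[OF lin_fst lin_inl] lin_comp[OF lin_snd lin_inr] by (simp_all add: f1_def[abs_def] f2_def[abs_def])
  have Op0: "R1.rss g 0 = 0" "R2' g 0 = 0" if "g \<in> W" for g
    using lin_zero[OF R1.rss_endo[OF that]] lin_zero[OF R2'_endo[OF that]] by simp_all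
  have comp: "S.compatible f1" "S.compatible f2"
    unfolding S.compatible_def S.equivariant_def using lf
    by (auto simp: f1_def f2_def Op_def pair_map_def Op0 lin_zero[OF R1.wd(3)] lin_zero[OF R2.wd(3)])
  have tr: "P.tr (\<lambda>v. A (f1 v)) = P.tr (\<lambda>v. A (f2 v))" if A: "A \<in> Op ` W" for A
  proof -
    obtain g where g: "g \<in> W" "A = Op g" using A by blast
    have "P.tr (\<lambda>v. A (f1 v)) = P.tr (\<lambda>v. (R1.rss g (fst v), 0))"
      by (simp add: g Op_def pair_map_def f1_def Op0)
    also have "\<dots> = lin_trace scale1 (R1.rss g)"
      using trace_swap[OF P.fd_space_axioms R1.fd_space_axioms lin_comp[OF lin_fst R1.rss_endo[OF g(1)]] lin_inl]
      by simp
    also have "\<dots> = tw g * lin_trace scale2 (R2.rss g)"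
      using trace_eq[OF g(1)] by (simp add: R1.trace_rss R2.trace_rss g(1) tw_def)
    also have "\<dots> = lin_trace scale2 (R2' g)" unfolding R2'_def[abs_def] by (simp add: R2.trace_scale)
    also have "\<dots> = P.tr (\<lambda>v. (0, R2' g (snd v)))"
      using trace_swap[OF P.fd_space_axioms R2.fd_space_axioms lin_comp[OF lin_snd R2'_endo[OF g(1)]] lin_inr]
      by simp
    also have "\<dots> = P.tr (\<lambda>v. A (f2 v))"
      by (simp add: g Op_def pair_map_def f2_def Op0)
    finally show ?thesis .
  qed
  \<comment> \<open>\<open>A\<close> maps into the second summand and \<open>B\<close> into the
    first, so their off-diagonal blocks \<open>T\<close> and \<open>T'\<close> are inverse
    isomorphisms.\<close>
  obtain A B where A: "S.compatible A" and B: "S.compatible B"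
    and AB: "\<And>v. f2 (A v) = A v" "\<And>v. f1 (B v) = B v" "\<And>v. B (A v) = f1 v" "\<And>v. A (B v) = f2 v"
    using S.trace_eq_imp_equivalent[OF comp(1) _ comp(2) _ tr] by (auto simp: f1_def f2_def)
  define T where "T x = snd (A (x, 0))" for x
  define T' where "T' y = fst (B (0, y))" for y
  have AT: "A (x, 0) = (0, T x)" for x using AB(1)[of "(x, 0)"] by (simp add: f2_def T_def prod_eq_iff)
  have BT: "B (0, y) = (T' y, 0)" for y using AB(2)[of "(0, y)"] by (simp add: f1_def T'_def prod_eq_iff)
  have "T' (T x) = x" for x using AB(3)[of "(x, 0)"] by (simp add: AT BT f1_def)
  moreover have "T (T' y) = y" for y using AB(4)[of "(0, y)"] by (simp add: AT BT f2_def)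
  ultimately have "bij T" by (intro o_bij[of T' T]) (auto simp: fun_eq_iff)
  moreover have "Vector_Spaces.linear scale1 scale2 T"
    unfolding T_def[abs_def] by (rule lin_comp[OF lin_comp[OF lin_inl S.compatible_endo[OF A]] lin_snd])
  moreover have "T (R1.rss g x) = R2' g (T x)" if "g \<in> W" for g x
    using S.equivariant_commute[OF S.compatible_equivariant[OF A], of "Op g" "(x, 0)"] that
    by (simp add: AT Op_def pair_map_def Op0)
  moreover have "T (N1 x) = N2 (T x)" for x
    using A[unfolded S.compatible_def, THEN conjunct2, rule_format, of "(x, 0)"]
    by (simp add: AT pair_map_def lin_zero[OF R2.wd(3)])
  ultimately show ?thesis
    unfolding wd_iso_def wd_twist_def twist_def
    by (auto simp: R2'_def fun_eq_iff intro!: exI[of _ T])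
qed

end

text \<open>\<open>card\<close> is 0 for infinite sets, so positivity includes finiteness of the
  residue field. With exponent 0 the Frobenius condition at \<open>x = 0\<close> would say that
  \<open>\<phi> 1 = 1\<close> has absolute value below 1.\<close>

lemma geom_frobenius_imp_residue_card_pos:
  fixes absK :: "'k::{alg_closed_field, field_char_0} \<Rightarrow> real"
  assumes "nonarch_absolute_value absK" "\<phi> \<in> geom_frobenius absK K"
  shows "residue_card absK K > 0"
proof (rule ccontr)
  assume "\<not> ?thesis"
  then have q: "residue_card absK K = 0" by simp
  have abs: "absK x = 0 \<longleftrightarrow> x = 0" "absK (x * y) = absK x * absK y" for x y
    using assms(1) unfolding nonarch_absolute_value_def by auto
  have gf: "\<forall>x. absK x \<le> 1 \<longrightarrow> absK (\<phi> (x ^ residue_card absK K) - x) < 1"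
    and \<phi>: "bij \<phi>" "\<And>x y. \<phi> (x + y) = \<phi> x + \<phi> y" "\<And>x y. \<phi> (x * y) = \<phi> x * \<phi> y"
    using assms(2) unfolding geom_frobenius_def gal_group_def by auto
  have "absK (\<phi> (0 ^ residue_card absK K) - 0) < 1"
    using gf abs(1)[of 0] by (metis zero_le_one)
  then have "absK (\<phi> 1) < 1" by (simp add: q)
  moreover have "\<phi> 0 = 0" using \<phi>(2)[of 0 0] by simp
  then have "\<phi> 1 \<noteq> 0" using \<phi>(1) by (metis bij_pointE zero_neq_one)
  then have "\<phi> 1 = 1" using \<phi>(3)[of 1 1] by simp
  moreover have "absK 1 = 1" using abs(2)[of 1 1] abs(1)[of 1] by simp
  ultimately show False by simp
qed

lemma twist_powi_trace_eq:
  fixes smul1 :: "'e::field_char_0 \<Rightarrow> 'v1::ab_group_add \<Rightarrow> 'v1"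
    and smul2 :: "'e \<Rightarrow> 'v2::ab_group_add \<Rightarrow> 'v2"
  assumes "fd_space smul1" "fd_space smul2" "\<psi> g \<noteq> 0"
    and "lin_trace smul1 (twist smul1 (\<lambda>h. \<psi> h powi (- w1)) \<rho>1 g) =
      lin_trace smul2 (twist smul2 (\<lambda>h. \<psi> h powi (- w2)) \<rho>2 g)"
  shows "lin_trace smul1 (\<rho>1 g) = \<psi> g powi (w1 - w2) * lin_trace smul2 (\<rho>2 g)"
proof -
  have "\<psi> g powi (- w1) * lin_trace smul1 (\<rho>1 g) = \<psi> g powi (- w2) * lin_trace smul2 (\<rho>2 g)"
    using assms(4) fd_space.trace_scale[OF assms(1), of "\<psi> g powi (- w1)" "\<rho>1 g"]
      fd_space.trace_scale[OF assms(2), of "\<psi> g powi (- w2)" "\<rho>2 g"] by (simp add: twist_def)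
  then have "\<psi> g powi w1 * (\<psi> g powi (- w1) * lin_trace smul1 (\<rho>1 g)) =
      \<psi> g powi w1 * (\<psi> g powi (- w2) * lin_trace smul2 (\<rho>2 g))" by simp
  moreover have "\<psi> g powi w1 * (\<psi> g powi (- w1) * x) = x" for x
    using assms(3) by (simp add: power_int_minus)
  moreover have "\<psi> g powi w1 * (\<psi> g powi (- w2) * x) = \<psi> g powi (w1 - w2) * x" for x
    using assms(3) by (simp add: power_int_minus power_int_diff divide_inverse)
  ultimately show ?thesis by simp
qed

theorem theorem1p1:
  fixes p l :: nat
    and absK :: "'k::{alg_closed_field, field_char_0} \<Rightarrow> real"
    and absE :: "'e::{alg_closed_field, field_char_0} \<Rightarrow> real"
    and K :: "'k set"
    and \<phi> :: "'k \<Rightarrow> 'k" and \<pi> :: 'k and \<zeta> :: "nat \<Rightarrow> 'k"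
    and sqrt_q :: 'e and \<psi> :: "('k \<Rightarrow> 'k) \<Rightarrow> 'e"
    and smul1 :: "'e \<Rightarrow> 'v1::ab_group_add \<Rightarrow> 'v1"
    and smul2 :: "'e \<Rightarrow> 'v2::ab_group_add \<Rightarrow> 'v2"
    and \<rho>1 :: "('k \<Rightarrow> 'k) \<Rightarrow> 'v1 \<Rightarrow> 'v1"
    and \<rho>2 :: "('k \<Rightarrow> 'k) \<Rightarrow> 'v2 \<Rightarrow> 'v2"
    and w1 w2 :: int
  assumes "prime p" and "prime l" and "p \<noteq> l"
    and "padic_algebraic_closure l absK"
    and "padic_algebraic_closure p absE"
    and "finite_extension (padic_numbers absK) K"
    and "\<phi> \<in> geom_frobenius absK K"
    and "uniformizer absK K \<pi>"
    and "compatible_roots_of_unity l \<zeta>"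
    and "sqrt_q ^ 2 = of_nat (residue_card absK K)"
    and "unramified_character absK K \<psi>"
    and "\<forall>g \<in> geom_frobenius absK K. \<psi> g = sqrt_q"
    and "fin_dim_space smul1" and "fin_dim_space smul2"
    and "continuous_galois_rep absE K smul1 \<rho>1"
    and "continuous_galois_rep absE K smul2 \<rho>2"
    and "galois_pure p absK K absE \<phi> \<pi> \<zeta> smul1 w1 \<rho>1"
    and "galois_pure p absK K absE \<phi> \<pi> \<zeta> smul2 w2 \<rho>2"
    and "\<forall>g \<in> carrier (weil_group absK K).
           lin_trace smul1 (twist smul1 (\<lambda>h. \<psi> h powi (- w1)) \<rho>1 g) =
           lin_trace smul2 (twist smul2 (\<lambda>h. \<psi> h powi (- w2)) \<rho>2 g)"
  shows "wd_iso absK K smul1 smul2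
           (frobenius_ss absK K \<phi> smul1 (WD p absK K absE \<phi> \<pi> \<zeta> smul1 \<rho>1))
           (wd_twist smul2 (\<lambda>h. \<psi> h powi (w1 - w2))
             (frobenius_ss absK K \<phi> smul2 (WD p absK K absE \<phi> \<pi> \<zeta> smul2 \<rho>2)))"
proof -
  note p = assms(5) and l = assms(4)
  define N1 where "N1 = monodromy_operator p absK K absE \<pi> \<zeta> smul1 \<rho>1"
  define N2 where "N2 = monodromy_operator p absK K absE \<pi> \<zeta> smul2 \<rho>2"
  define t where "t g = - tame_char p absE \<pi> \<zeta> (\<phi> [^]\<^bsub>gal_group K\<^esub> (- weil_val absK K g) \<circ> g)" for g
  define r1 where "r1 g = \<rho>1 g \<circ> nilp_exp smul1 (\<lambda>v. smul1 (t g) (N1 v))" for g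
  define r2 where "r2 g = \<rho>2 g \<circ> nilp_exp smul2 (\<lambda>v. smul2 (t g) (N2 v))" for g
  have WD1: "WD p absK K absE \<phi> \<pi> \<zeta> smul1 \<rho>1 = (r1, N1)"
    unfolding WD_def Let_def N1_def[symmetric] r1_def[abs_def] t_def ..
  have WD2: "WD p absK K absE \<phi> \<pi> \<zeta> smul2 \<rho>2 = (r2, N2)"
    unfolding WD_def Let_def N2_def[symmetric] r2_def[abs_def] t_def ..
  have nonarch: "nonarch_absolute_value absK"
    and alg: "\<And>x. \<exists>P. P \<noteq> 0 \<and> (\<forall>i. coeff P i \<in> padic_numbers absK) \<and> poly P x = 0"
    using l unfolding padic_algebraic_closure_def by auto
  have K: "0 \<in> K" "1 \<in> K" "padic_numbers absK \<subseteq> K"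
    using assms(6) unfolding finite_extension_def is_subfield_def by auto
  interpret local_galois absK K \<phi>
    by unfold_locales (fact nonarch geom_frobenius_imp_residue_card_pos[OF nonarch assms(7)] assms(7))+
  interpret unramified_twist absK K \<phi> \<psi> sqrt_q
    by unfold_locales (use assms(7,10,11,12) residue_card_gt_1[OF K(1,2)] in auto)
  interpret R1: alg_fd_space smul1 using fd_spaceI[OF assms(13)] by (rule alg_fd_space.intro)
  interpret R2: alg_fd_space smul2 using fd_spaceI[OF assms(14)] by (rule alg_fd_space.intro)
  have alg_K: "\<exists>P. P \<noteq> 0 \<and> (\<forall>i. coeff P i \<in> K) \<and> poly P x = 0" for x
    using alg[of x] K(3) by blast
  interpret R1: pure_weil_deligne absK K \<phi> smul1 r1 N1 w1
    by unfold_locales (use assms(17) alg_K q_gt_1 in \<open>simp_all add: galois_pure_def WD1\<close>)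
  interpret R2: pure_weil_deligne absK K \<phi> smul2 r2 N2 w2
    by unfold_locales (use assms(18) alg_K q_gt_1 in \<open>simp_all add: galois_pure_def WD2\<close>)
  have \<rho>1: "\<rho>1 g \<in> carrier (GL smul1)" and \<rho>2: "\<rho>2 g \<in> carrier (GL smul2)" if "g \<in> W" for g
    using assms(15,16) weil_gal[OF that] unfolding continuous_galois_rep_def by (auto simp: hom_def)
  interpret pure_pair absK K \<phi> \<psi> sqrt_q smul1 r1 N1 w1 smul2 r2 N2 w2
  proof unfold_locales
    fix g assume g: "g \<in> W"
    \<comment> \<open>Passing from \<open>\<rho>1\<close> to \<open>r1\<close> multiplies by the
      exponential of a multiple of \<open>N1\<close>, which leaves traces unchanged.\<close>
    have "lin_trace smul1 (r1 g) = lin_trace smul1 (\<rho>1 g)"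
      by (rule R1.trace_r_of_nilp_exp[OF g \<rho>1[OF g] r1_def])
    moreover have "lin_trace smul2 (r2 g) = lin_trace smul2 (\<rho>2 g)"
      by (rule R2.trace_r_of_nilp_exp[OF g \<rho>2[OF g] r2_def])
    moreover have "lin_trace smul1 (\<rho>1 g) = \<psi> g powi (w1 - w2) * lin_trace smul2 (\<rho>2 g)"
      using twist_powi_trace_eq[where \<psi> = \<psi> and g = g, OF R1.fd_space_axioms R2.fd_space_axioms \<psi>_nonzero[OF g]]
        assms(19) g by blast
    ultimately show "lin_trace smul1 (r1 g) = \<psi> g powi (w1 - w2) * lin_trace smul2 (r2 g)" by simp
  qed
  show ?thesis
    unfolding WD1 WD2 R1.frobenius_ss_eq R2.frobenius_ss_eq
    using rss_isomorphic unfolding tw_def[abs_def] .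
qed

end
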